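(* Let $\mathcal{CL}\subset\mathbb{P}^2_{\mathbb{C}}$ be a conic-line arrangement of even degree $d=2m\ge 4$ having only ADE singularities. If $\mathcal{CL}$ is maximizing, then $d\le 18$.
   Context: A conic-line arrangement is a reduced plane curve in $\mathbb{P}^2_{\mathbb{C}}$ all of whose irreducible components are lines or smooth conics. ADE singularities are the simple plane curve singularities $A_k$ ($k\ge1$), $D_k$ ($k\ge4$), $E_6,E_7,E_8$. Let $S=\mathbb{C}[x,y,z]$. For a reduced plane curve $\mathcal{C}=\{f=0\}$ of degree $d$, put $$\operatorname{AR}(f)=\{(a,b,c)\in S^{\oplus 3}: a f_x+b f_y+c f_z=0\},$$ a graded $S$-module graded by the common degree of $a,b,c$. The curve $\mathcal{C}$ is free with exponents $(d_1,d_2)$, $d_1\le d_2$, if $\operatorname{AR}(f)\simeq S(-d_1)\oplus S(-d_2)$ as graded modules, where $d_1+d_2=d-1$. A reduced plane curve of even degree $d=2m$ with only ADE singularities is maximizing if and only if it is free with exponents $(m-1,m)$; this characterization is taken here as the definition of maximizing. *)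

theory Defs
  imports
    "HOL-Analysis.Analysis"
    "HOL-Library.Poly_Mapping"
    "HOL-Computational_Algebra.Squarefree"
begin

text \<open>
  The ring \<open>S = \<complex>[x, y, z]\<close>: finitely supported functions from exponent vectors to \<open>\<complex>\<close>, with the
  convolution product of \<open>Poly_Mapping\<close>. The variables \<open>x, y, z\<close> have the indices \<open>1, 2, 3 :: 3\<close>.
\<close>

type_synonym tpoly = "(3 \<Rightarrow>\<^sub>0 nat) \<Rightarrow>\<^sub>0 complex"

definition tpoly_eval :: "tpoly \<Rightarrow> complex ^ 3 \<Rightarrow> complex" where
  "tpoly_eval f v =
     (\<Sum>m\<in>Poly_Mapping.keys f. Poly_Mapping.lookup f m * (\<Prod>i\<in>UNIV. (v $ i) ^ Poly_Mapping.lookup m i))"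

text \<open>Exponents are subtracted truncatingly, but where this matters the coefficient is \<open>0\<close>.\<close>

definition tpoly_pderiv :: "3 \<Rightarrow> tpoly \<Rightarrow> tpoly" where
  "tpoly_pderiv i f =
     (\<Sum>m\<in>Poly_Mapping.keys f.
        Poly_Mapping.single (m - Poly_Mapping.single i 1)
          (of_nat (Poly_Mapping.lookup m i) * Poly_Mapping.lookup f m))"

text \<open>The zero polynomial is homogeneous of every degree, so these are the graded pieces of \<open>S\<close>.\<close>

definition homogeneous_piece :: "nat \<Rightarrow> tpoly set" where
  "homogeneous_piece k = {f. \<forall>m\<in>Poly_Mapping.keys f. (\<Sum>i\<in>UNIV. Poly_Mapping.lookup m i) = k}"

text \<open>
  Curves in \<open>\<P>\<^sup>2\<close> are given by their equations, points of \<open>\<P>\<^sup>2\<close> by nonzero vectors of \<open>\<complex>\<^sup>3\<close>.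
\<close>

definition reduced_plane_curve :: "nat \<Rightarrow> tpoly \<Rightarrow> bool" where
  "reduced_plane_curve d f \<longleftrightarrow> d \<ge> 1 \<and> f \<noteq> 0 \<and> f \<in> homogeneous_piece d \<and> squarefree f"

definition singular_point :: "tpoly \<Rightarrow> complex ^ 3 \<Rightarrow> bool" where
  "singular_point f q \<longleftrightarrow>
     q \<noteq> 0 \<and> tpoly_eval f q = 0 \<and> (\<forall>i. tpoly_eval (tpoly_pderiv i f) q = 0)"

definition is_line :: "tpoly \<Rightarrow> bool" where
  "is_line p \<longleftrightarrow> p \<noteq> 0 \<and> p \<in> homogeneous_piece 1"

definition is_smooth_conic :: "tpoly \<Rightarrow> bool" where
  "is_smooth_conic p \<longleftrightarrow> p \<noteq> 0 \<and> p \<in> homogeneous_piece 2 \<and> (\<forall>q. \<not> singular_point p q)"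

definition conic_line_arrangement :: "nat \<Rightarrow> tpoly \<Rightarrow> bool" where
  "conic_line_arrangement d f \<longleftrightarrow>
     reduced_plane_curve d f \<and>
     (\<forall>p. irreducible p \<and> p dvd f \<longrightarrow> is_line p \<or> is_smooth_conic p)"

text \<open>
  The equation of the curve near the point \<open>q\<close>, in an affine chart around \<open>q\<close> with \<open>q\<close> translated
  to the origin. It only depends on the projective point represented by \<open>q\<close>.
\<close>

definition local_equation :: "tpoly \<Rightarrow> complex ^ 3 \<Rightarrow> complex \<times> complex \<Rightarrow> complex" where
  "local_equation f q = (\<lambda>(s, t).
     tpoly_eval f
       (if q $ 1 \<noteq> 0 then vector [1, q $ 2 / q $ 1 + s, q $ 3 / q $ 1 + t]
        else if q $ 2 \<noteq> 0 then vector [q $ 1 / q $ 2 + s, 1, q $ 3 / q $ 2 + t]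
        else vector [q $ 1 / q $ 3 + s, q $ 2 / q $ 3 + t, 1]))"

text \<open>Holomorphy in two variables on an open set: the derivative exists and is \<open>\<complex>\<close>-linear.\<close>

definition holomorphic2_on :: "(complex \<times> complex \<Rightarrow> complex) \<Rightarrow> (complex \<times> complex) set \<Rightarrow> bool" where
  "holomorphic2_on F U \<longleftrightarrow>
     (\<forall>p\<in>U. \<exists>a b. (F has_derivative (\<lambda>h. a * fst h + b * snd h)) (at p))"

definition biholomorphic2 ::
  "(complex \<times> complex) set \<Rightarrow> (complex \<times> complex) set \<Rightarrow>
   (complex \<times> complex \<Rightarrow> complex \<times> complex) \<Rightarrow> (complex \<times> complex \<Rightarrow> complex \<times> complex) \<Rightarrow> bool" where
  "biholomorphic2 U V \<Phi> \<Psi> \<longleftrightarrow>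
     open U \<and> open V \<and> homeomorphism U V \<Phi> \<Psi> \<and>
     holomorphic2_on (fst \<circ> \<Phi>) U \<and> holomorphic2_on (snd \<circ> \<Phi>) U \<and>
     holomorphic2_on (fst \<circ> \<Psi>) V \<and> holomorphic2_on (snd \<circ> \<Psi>) V"

text \<open>
  The germs at the origin of \<open>F = 0\<close> and \<open>G = 0\<close> are analytically isomorphic: \<open>F\<close> becomes a unit
  times \<open>G\<close> after a holomorphic change of coordinates.
\<close>

definition analytically_equivalent ::
  "(complex \<times> complex \<Rightarrow> complex) \<Rightarrow> (complex \<times> complex \<Rightarrow> complex) \<Rightarrow> bool" where
  "analytically_equivalent F G \<longleftrightarrow>
     (\<exists>U V \<Phi> \<Psi> u.
        biholomorphic2 U V \<Phi> \<Psi> \<and> (0, 0) \<in> U \<and> \<Phi> (0, 0) = (0, 0) \<and>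
        holomorphic2_on u U \<and>
        (\<forall>p\<in>U. u p \<noteq> 0 \<and> F (\<Phi> p) = u p * G p))"

definition ADE_normal_forms :: "(complex \<times> complex \<Rightarrow> complex) set" where
  "ADE_normal_forms =
     {\<lambda>(x, y). x\<^sup>2 + y ^ (k + 1) | k. k \<ge> 1} \<union>
     {\<lambda>(x, y). x\<^sup>2 * y + y ^ (k - 1) | k. k \<ge> 4} \<union>
     {\<lambda>(x, y). x ^ 3 + y ^ 4, \<lambda>(x, y). x ^ 3 + x * y ^ 3, \<lambda>(x, y). x ^ 3 + y ^ 5}"

definition only_ADE_singularities :: "tpoly \<Rightarrow> bool" where
  "only_ADE_singularities f \<longleftrightarrow>
     (\<forall>q. singular_point f q \<longrightarrow>
        (\<exists>G\<in>ADE_normal_forms. analytically_equivalent (local_equation f q) G))"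

definition AR :: "tpoly \<Rightarrow> (tpoly ^ 3) set" where
  "AR f = {\<rho>. (\<Sum>i\<in>UNIV. \<rho> $ i * tpoly_pderiv i f) = 0}"

definition AR_piece :: "tpoly \<Rightarrow> nat \<Rightarrow> (tpoly ^ 3) set" where
  "AR_piece f k = {\<rho> \<in> AR f. \<forall>i. \<rho> $ i \<in> homogeneous_piece k}"

text \<open>The degree \<open>k\<close> piece of \<open>S(-e)\<close>.\<close>

definition shifted_piece :: "nat \<Rightarrow> nat \<Rightarrow> tpoly set" where
  "shifted_piece e k = (if e \<le> k then homogeneous_piece (k - e) else {0})"

text \<open>\<open>\<phi>\<close> is an isomorphism of graded \<open>S\<close>-modules from \<open>S(-d\<^sub>1) \<oplus> S(-d\<^sub>2)\<close> to \<open>AR(f)\<close>.\<close>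

definition graded_iso_AR :: "tpoly \<Rightarrow> nat \<Rightarrow> nat \<Rightarrow> (tpoly \<times> tpoly \<Rightarrow> tpoly ^ 3) \<Rightarrow> bool" where
  "graded_iso_AR f d\<^sub>1 d\<^sub>2 \<phi> \<longleftrightarrow>
     bij_betw \<phi> UNIV (AR f) \<and>
     (\<forall>u v. \<phi> (u + v) = \<phi> u + \<phi> v) \<and>
     (\<forall>a p q. \<phi> (a * p, a * q) = a *s \<phi> (p, q)) \<and>
     (\<forall>k. \<phi> ` (shifted_piece d\<^sub>1 k \<times> shifted_piece d\<^sub>2 k) = AR_piece f k)"

definition free_with_exponents :: "nat \<Rightarrow> tpoly \<Rightarrow> nat \<Rightarrow> nat \<Rightarrow> bool" where
  "free_with_exponents d f d\<^sub>1 d\<^sub>2 \<longleftrightarrow>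
     reduced_plane_curve d f \<and> d\<^sub>1 \<le> d\<^sub>2 \<and> d\<^sub>1 + d\<^sub>2 = d - 1 \<and> (\<exists>\<phi>. graded_iso_AR f d\<^sub>1 d\<^sub>2 \<phi>)"

definition maximizing :: "nat \<Rightarrow> tpoly \<Rightarrow> bool" where
  "maximizing d f \<longleftrightarrow>
     reduced_plane_curve d f \<and> only_ADE_singularities f \<and>
     (\<exists>m. d = 2 * m \<and> free_with_exponents d f (m - 1) m)"

end

theory Submission
  imports Defs "HOL-Complex_Analysis.Conformal_Mappings"
begin

text \<open>
  A maximizing curve of degree \<open>d = 2 k\<close> is free with exponents \<open>(k - 1, k)\<close>, so it has a nonzero
  syzygy of degree \<open>r = k - 1\<close>: a polynomial vector field \<open>\<theta>\<close> on \<open>\<complex>\<^sup>3\<close> with coefficients of degree \<open>r\<close>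
  and \<open>\<theta> f = 0\<close>. The proof compares \<open>r\<close> with the integrability of negative powers of \<open>f\<close>.

  The analytic half is that \<open>s d > r + 2\<close> is impossible for nonzero \<open>\<theta>\<close> if the function
  \<open>\<bar>f\<bar> ^ (- 2 s)\<close> is locally integrable away from the origin. Put \<open>N = \<bar>x\<bar>\<^sup>2\<close>,
  \<open>\<epsilon> = s d - (r + 2) > 0\<close> and \<open>W = \<bar>f\<bar> ^ (- 2 s) N ^ \<epsilon>\<close>. As \<open>\<theta> f = 0\<close>, the divergence of \<open>W \<theta>\<close> is
  \<open>W G\<close> with \<open>G = div \<theta> + \<epsilon> (\<theta> N) / N\<close>, and \<open>\<theta>\<close> kills the conjugate of the holomorphic function
  \<open>div \<theta>\<close>, so that \<open>\<theta>\<close> applied to the conjugate of \<open>G\<close> is \<open>\<epsilon> (N \<bar>\<theta>\<bar>\<^sup>2 - \<bar>\<theta> N\<bar>\<^sup>2) / N\<^sup>2\<close>, which is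
  nonnegative by the Cauchy-Schwarz inequality. Integrating the divergence of the field
  \<open>cnj G W \<theta>\<close> would therefore give
  \<open>\<integral> W (\<bar>G\<bar>\<^sup>2 + \<epsilon> (N \<bar>\<theta>\<bar>\<^sup>2 - \<bar>\<theta> N\<bar>\<^sup>2) / N\<^sup>2) = 0\<close>.
  The integrand is homogeneous of degree \<open>- 6\<close>, the critical degree on \<open>\<complex>\<^sup>3\<close>: all shells of the same logarithmic
  width contribute the same amount. A cutoff that is slow on the logarithmic scale produces an error that stays bounded while the
  main term grows with the number of shells, so the integrand vanishes
  (\<open>Q_AE_0\<close>). Equality in the Cauchy-Schwarz inequality makes \<open>\<theta>\<close> radial, and Euler's identity together with
  \<open>\<theta> f = 0\<close> makes it zero (\<open>\<theta>_eq_0\<close>). This is an elementary substitute for the Hodge theoretic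
  or Bogomolov-Sommese type vanishing theorems that bound syzygies by log canonical thresholds.

  The geometric half is that \<open>\<bar>f\<bar> ^ (- 2 s)\<close> is locally integrable for \<open>s < 5 / 9\<close>. The components are smooth curves
  and two of them have contact at most four (\<open>contact_at_most_four\<close>). Comparing \<open>f\<close> with the
  ADE normal forms along curves shows that at most three components pass through a point and that three of
  them are never all tangent to each other (\<open>ADE_branch_conditions\<close>). The worst case is two conics with contact
  four and a third component transversal to both, a \<open>D\<close> singularity of index ten, whose log
  canonical threshold is \<open>5 / 9\<close>. Integrability is reduced to one complex dimension: if \<open>h\<close> is the
  absolute value of a linear form that vanishes at the point but on no tangent, then at every
  point \<open>x\<close> all branches but the smallest one are bounded below by a multiple of \<open>h ^ 4\<close>, or of \<open>h\<close> if they are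
  transversal to it. So \<open>\<bar>f\<bar> ^ (- 2 s)\<close> is bounded by negative powers of the smallest branch and of \<open>h\<close> with
  exponents that are integrable along lines
  (\<open>branches_inequality\<close>, \<open>nn_integral_line_powr\<close>).

  For \<open>d \<ge> 20\<close> some \<open>s < 5 / 9\<close> satisfies \<open>s d > d / 2 + 1 = r + 2\<close>, which contradicts the first half.
\<close>

section \<open>Ternary polynomials as functions\<close>

abbreviation "ev \<equiv> tpoly_eval"
abbreviation "lookup \<equiv> Poly_Mapping.lookup"
abbreviation "keys \<equiv> Poly_Mapping.keys"

lemma prod_3: "(\<Prod>i\<in>(UNIV::3 set). F i) = F 1 * F 2 * (F 3 :: complex)"
  unfolding UNIV_3 by (simp add: mult.assoc)

definition mon :: "(3 \<Rightarrow>\<^sub>0 nat) \<Rightarrow> complex ^ 3 \<Rightarrow> complex" where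
  "mon m v = (\<Prod>i\<in>UNIV. (v $ i) ^ lookup m i)"

lemma mon_0 [simp]: "mon 0 v = 1"
  by (simp add: mon_def)

lemma mon_add: "mon (m + n) v = mon m v * mon n v"
  by (simp add: mon_def lookup_add power_add prod.distrib)

lemma mon_single: "mon (Poly_Mapping.single i k) v = (v $ i) ^ k"
proof -
  have "mon (Poly_Mapping.single i k) v = (\<Prod>j\<in>UNIV. if j = i then (v $ i) ^ k else 1)"
    unfolding mon_def by (rule prod.cong) (auto simp: lookup_single when_def)
  then show ?thesis by simp
qed

lemma mon_scale: "mon m (c *s v) = c ^ (\<Sum>i\<in>UNIV. lookup m i) * mon m v"
  by (simp add: mon_def power_mult_distrib prod.distrib power_sum)

lemma tpoly_eval_superset:
  assumes "finite A" "keys f \<subseteq> A"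
  shows "ev f v = (\<Sum>m\<in>A. lookup f m * mon m v)"
  unfolding tpoly_eval_def mon_def[symmetric] using assms
  by (intro sum.mono_neutral_left) (auto simp: in_keys_iff)

lemma tpoly_eval_mon: "ev f v = (\<Sum>m\<in>keys f. lookup f m * mon m v)"
  by (rule tpoly_eval_superset) auto

lemma tpoly_eval_0 [simp]: "ev 0 v = 0"
  by (simp add: tpoly_eval_mon)

lemma tpoly_eval_single [simp]: "ev (Poly_Mapping.single m c) v = c * mon m v"
  by (subst tpoly_eval_superset[of "{m}"]) auto

lemma tpoly_eval_add [simp]: "ev (f + g) v = ev f v + ev g v"
proof -
  let ?A = "keys f \<union> keys g"
  have "keys (f + g) \<subseteq> ?A" by (rule Poly_Mapping.keys_add)
  then show ?thesis
    by (simp add: tpoly_eval_superset[of ?A] lookup_add algebra_simps sum.distrib)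
qed

lemma tpoly_eval_sum [simp]: "ev (\<Sum>i\<in>A. F i) v = (\<Sum>i\<in>A. ev (F i) v)"
  by (induction A rule: infinite_finite_induct) auto

lemma tpoly_as_sum:
  fixes f :: tpoly
  shows "f = (\<Sum>m\<in>keys f. Poly_Mapping.single m (lookup f m))"
proof (rule poly_mapping_eqI)
  fix k
  show "lookup f k = lookup (\<Sum>m\<in>keys f. Poly_Mapping.single m (lookup f m)) k"
    by (simp add: lookup_sum lookup_single when_def in_keys_iff)
qed

lemma tpoly_eval_mult [simp]: "ev (f * g) v = ev f v * ev g v"
proof -
  have "f * g = (\<Sum>m\<in>keys f. Poly_Mapping.single m (lookup f m)) *
      (\<Sum>n\<in>keys g. Poly_Mapping.single n (lookup g n))"
    by (rule arg_cong2[OF tpoly_as_sum tpoly_as_sum])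
  also have "\<dots> = (\<Sum>m\<in>keys f. \<Sum>n\<in>keys g.
       Poly_Mapping.single (m + n) (lookup f m * lookup g n))"
    by (simp add: sum_product mult_single)
  finally have "ev (f * g) v = (\<Sum>m\<in>keys f. \<Sum>n\<in>keys g.
       lookup f m * mon m v * (lookup g n * mon n v))"
    by (simp add: mon_add mult_ac)
  then show ?thesis by (simp add: tpoly_eval_mon[of f] tpoly_eval_mon[of g] sum_product)
qed

lemma tpoly_eval_1 [simp]: "ev 1 v = 1"
  using tpoly_eval_single[of 0 1 v] by simp

lemma tpoly_eval_uminus [simp]: "ev (- f) v = - ev f v"
  using tpoly_eval_add[of f "- f" v] by (simp add: eq_neg_iff_add_eq_0 add.commute)

lemma tpoly_eval_diff [simp]: "ev (f - g) v = ev f v - ev g v"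
  using tpoly_eval_add[of f "- g" v] by simp

lemma tpoly_eval_prod [simp]: "ev (\<Prod>i\<in>A. F i) v = (\<Prod>i\<in>A. ev (F i) v)"
  by (induction A rule: infinite_finite_induct) auto

text \<open>Kronecker substitution: the monomials occurring in \<open>f\<close> have exponents below some \<open>M\<close>, so that
  along the curve \<open>(T, T ^ M, T ^ (M * M))\<close> they restrict to pairwise different powers of \<open>T\<close>.\<close>

lemma tpoly_eval_eq_0D:
  assumes "\<And>v. ev f v = 0"
  shows "f = 0"
proof (rule ccontr)
  assume "f \<noteq> 0"
  define M where "M = Suc (\<Sum>m\<in>keys f. \<Sum>i\<in>UNIV. lookup m i)"
  have less: "lookup m i < M" if "m \<in> keys f" for m i
  proof -
    have "lookup m i \<le> (\<Sum>i\<in>UNIV. lookup m i)"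
      by (rule member_le_sum) auto
    also have "\<dots> \<le> (\<Sum>m\<in>keys f. \<Sum>i\<in>UNIV. lookup m i)"
      using that by (intro member_le_sum) auto
    finally show ?thesis by (simp add: M_def)
  qed
  \<comment> \<open>The digits of \<open>e m\<close> in base \<open>M\<close> are the exponents.\<close>
  define e where "e m = lookup m 1 + M * (lookup m 2 + M * lookup m (3::3))"
    for m
  have inj: "inj_on e (keys f)"
  proof (rule inj_onI)
    fix m n assume mn: "m \<in> keys f" "n \<in> keys f" "e m = e n"
    have l: "lookup m i < M" "lookup n i < M" for i using less mn by auto
    have "e m mod M = e n mod M" "e m div M = e n div M" using mn by auto
    then have 1: "lookup m 1 = lookup n 1"
      and q: "lookup m 2 + M * lookup m 3 =
        lookup n 2 + M * lookup n 3"
      using l[of 1] by (simp_all add: e_def)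
    then have "(lookup m 2 + M * lookup m 3) mod M =
        (lookup n 2 + M * lookup n 3) mod M" by simp
    then have 2: "lookup m 2 = lookup n 2" using l[of 2] by simp
    with q have "M * lookup m 3 = M * lookup n 3" by simp
    moreover have "M \<noteq> 0" by (simp add: M_def)
    ultimately have 3: "lookup m 3 = lookup n 3" by (simp only: mult_cancel1) simp
    have "lookup m i = lookup n i" for i
      using exhaust_3[of i] 1 2 3 by auto
    then show "m = n" by (intro poly_mapping_eqI) auto
  qed
  define q :: "complex poly" where "q = (\<Sum>m\<in>keys f. monom (lookup f m) (e m))"
  have "poly q t = 0" for t
  proof -
    have "mon m (vector [t, t ^ M, t ^ (M * M)]) = t ^ e m" for m
      unfolding mon_def prod_3 vector_3 e_def
      by (simp only: power_add power_mult [symmetric] distrib_left mult.assoc)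
    then have "ev f (vector [t, t ^ M, t ^ (M * M)]) = poly q t"
      by (simp add: tpoly_eval_mon q_def poly_sum poly_monom)
    then show ?thesis using assms by metis
  qed
  then have "q = 0" using poly_all_0_iff_0 by blast
  obtain m where m: "m \<in> keys f" using \<open>f \<noteq> 0\<close> by fastforce
  have "coeff q (e m) = (\<Sum>n\<in>keys f. if n = m then lookup f n else 0)"
    unfolding q_def coeff_sum using inj m by (intro sum.cong) (auto simp: inj_on_def)
  then have "lookup f m = 0" using m \<open>q = 0\<close> by simp
  with m show False by (auto simp: in_keys_iff)
qed

text \<open>The pairing is bilinear, not Hermitian; Hermitian products are written with \<open>vcnj\<close> below.\<close>

definition cdot :: "complex ^ 3 \<Rightarrow> complex ^ 3 \<Rightarrow> complex" where
  "cdot a v = (\<Sum>i\<in>UNIV. a $ i * v $ i)"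

definition tgrad :: "tpoly \<Rightarrow> complex ^ 3 \<Rightarrow> complex ^ 3" where
  "tgrad f v = (\<chi> i. ev (tpoly_pderiv i f) v)"

text \<open>The truncating subtraction of exponents is harmless: whenever it truncates, the factor in front is \<open>0\<close>.\<close>

lemma mon_has_derivative:
  "(mon m has_derivative
     (\<lambda>h. \<Sum>i\<in>UNIV. of_nat (lookup m i) * mon (m - Poly_Mapping.single i 1) v * h $ i)) (at v)"
proof -
  have *: "((\<lambda>v::complex^3. (v $ i) ^ k) has_derivative (\<lambda>h. of_nat k * (v $ i) ^ (k - 1) * h $ i)) (at v)" for i k
    by (rule derivative_eq_intros refl bounded_linear.has_derivative[OF bounded_linear_vec_nth])+
       (simp add: mult_ac)
  have "((\<lambda>v. \<Prod>i\<in>UNIV. (v $ i) ^ lookup m i) has_derivative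
     (\<lambda>h. \<Sum>i\<in>UNIV. of_nat (lookup m i) * (v $ i) ^ (lookup m i - 1) * h $ i *
        (\<Prod>j\<in>UNIV - {i}. (v $ j) ^ lookup m j))) (at v)"
    by (rule has_derivative_prod) (rule *)
  moreover have "(\<lambda>h. \<Sum>i\<in>UNIV. of_nat (lookup m i) * (v $ i) ^ (lookup m i - 1) * h $ i *
        (\<Prod>j\<in>UNIV - {i}. (v $ j) ^ lookup m j)) =
     (\<lambda>h. \<Sum>i\<in>UNIV. of_nat (lookup m i) * mon (m - Poly_Mapping.single i 1) v * h $ i)"
  proof (intro ext sum.cong refl)
    fix h :: "complex ^ 3" and i :: 3
    have "mon (m - Poly_Mapping.single i 1) v =
      (v $ i) ^ (lookup m i - 1) * (\<Prod>j\<in>UNIV - {i}. (v $ j) ^ lookup m j)"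
      unfolding mon_def
      by (subst prod.remove[of _ i]) (auto simp: lookup_minus lookup_single when_def intro!: prod.cong)
    then show "of_nat (lookup m i) * (v $ i) ^ (lookup m i - 1) * h $ i *
        (\<Prod>j\<in>UNIV - {i}. (v $ j) ^ lookup m j) =
      of_nat (lookup m i) * mon (m - Poly_Mapping.single i 1) v * h $ i"
      by (simp add: mult_ac)
  qed
  ultimately show ?thesis unfolding mon_def[abs_def] by simp
qed

lemma tpoly_eval_pderiv:
  "ev (tpoly_pderiv i f) v =
     (\<Sum>m\<in>keys f. lookup f m * (of_nat (lookup m i) * mon (m - Poly_Mapping.single i 1) v))"
  by (simp add: tpoly_pderiv_def mult_ac)

lemma tpoly_eval_has_derivative:
  "(ev f has_derivative cdot (tgrad f v)) (at v)"
proof -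
  have "((\<lambda>v. \<Sum>m\<in>keys f. lookup f m * mon m v) has_derivative
      (\<lambda>h. \<Sum>m\<in>keys f. lookup f m *
        (\<Sum>i\<in>UNIV. of_nat (lookup m i) * mon (m - Poly_Mapping.single i 1) v * h $ i))) (at v)"
    by (intro has_derivative_sum has_derivative_mult_right mon_has_derivative)
  moreover have "(\<lambda>h. \<Sum>m\<in>keys f. lookup f m *
        (\<Sum>i\<in>UNIV. of_nat (lookup m i) * mon (m - Poly_Mapping.single i 1) v * h $ i)) =
      cdot (tgrad f v)"
    unfolding cdot_def tgrad_def vec_lambda_beta tpoly_eval_pderiv
    by (subst sum_distrib_right, subst sum.swap, simp add: sum_distrib_left mult_ac)
  ultimately show ?thesis by (simp add: tpoly_eval_mon[abs_def])
qed

lemma continuous_on_tpoly_eval [continuous_intros]: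
  assumes "continuous_on S h"
  shows "continuous_on S (\<lambda>x. ev f (h x))"
  unfolding tpoly_eval_def by (intro continuous_intros assms)

lemma continuous_on_tgrad [continuous_intros]:
  "continuous_on S h \<Longrightarrow> continuous_on S (\<lambda>x. tgrad f (h x))"
  unfolding tgrad_def by (intro continuous_on_vec_lambda continuous_intros)

lemma tpoly_eval_homogeneous:
  assumes "f \<in> homogeneous_piece k"
  shows "ev f (c *s v) = c ^ k * ev f v"
proof -
  have "lookup f m * mon m (c *s v) = c ^ k * (lookup f m * mon m v)"
    if "m \<in> keys f" for m
    using assms that by (simp add: homogeneous_piece_def mon_scale mult_ac)
  then show ?thesis unfolding tpoly_eval_mon sum_distrib_left by (rule sum.cong[OF refl])
qed

lemma homogeneous_piece_0: "0 \<in> homogeneous_piece k"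
  by (simp add: homogeneous_piece_def)

lemma homogeneous_piece_add:
  "f \<in> homogeneous_piece k \<Longrightarrow> g \<in> homogeneous_piece k \<Longrightarrow> f + g \<in> homogeneous_piece k"
  using Poly_Mapping.keys_add[of f g] by (auto simp: homogeneous_piece_def)

lemma homogeneous_piece_sum:
  "(\<And>i. i \<in> A \<Longrightarrow> F i \<in> homogeneous_piece k) \<Longrightarrow> (\<Sum>i\<in>A. F i) \<in> homogeneous_piece k"
  by (induction A rule: infinite_finite_induct) (auto intro: homogeneous_piece_add homogeneous_piece_0)

lemma tpoly_pderiv_homogeneous:
  assumes "f \<in> homogeneous_piece (Suc k)"
  shows "tpoly_pderiv i f \<in> homogeneous_piece k"
  unfolding tpoly_pderiv_def
proof (rule homogeneous_piece_sum)
  fix m assume m: "m \<in> keys f"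
  show "Poly_Mapping.single (m - Poly_Mapping.single i 1)
          (of_nat (lookup m i) * lookup f m) \<in> homogeneous_piece k"
  proof (cases "lookup m i = 0")
    case False
    have "(\<Sum>j\<in>UNIV. lookup m j) = Suc k" using assms m by (auto simp: homogeneous_piece_def)
    then have "Suc (\<Sum>j\<in>UNIV. lookup (m - Poly_Mapping.single i 1) j) = Suc k"
      using False by (simp add: sum.remove[of UNIV i] lookup_minus lookup_single when_def)
    then show ?thesis by (auto simp: homogeneous_piece_def)
  qed (simp add: homogeneous_piece_0)
qed

lemma tpoly_euler:
  assumes "f \<in> homogeneous_piece k"
  shows "cdot (tgrad f v) v = of_nat k * ev f v"
proof -
  have "of_nat (lookup m i) * (mon (m - Poly_Mapping.single i 1) v * v $ i) =
     of_nat (lookup m i) * mon m v" for m i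
  proof (cases "lookup m i = 0")
    case False
    then have "m = (m - Poly_Mapping.single i 1) + Poly_Mapping.single i 1"
      by (intro poly_mapping_eqI) (auto simp: lookup_add lookup_minus lookup_single when_def)
    then have "mon m v = mon ((m - Poly_Mapping.single i 1) + Poly_Mapping.single i 1) v"
      by (rule arg_cong)
    then have "mon m v = mon (m - Poly_Mapping.single i 1) v * v $ i"
      unfolding mon_add mon_single by simp
    then show ?thesis by simp
  qed simp
  note * = this
  have "cdot (tgrad f v) v = (\<Sum>i\<in>UNIV. \<Sum>m\<in>keys f.
      lookup f m * (of_nat (lookup m i) * mon m v))"
    unfolding cdot_def tgrad_def vec_lambda_beta tpoly_eval_pderiv sum_distrib_right mult.assoc * ..
  also have "\<dots> = (\<Sum>m\<in>keys f. lookup f m * (of_nat (\<Sum>i\<in>UNIV. lookup m i) * mon m v))"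
    by (subst sum.swap) (simp add: sum_distrib_left sum_distrib_right)
  also have "\<dots> = (\<Sum>m\<in>keys f. lookup f m * (of_nat k * mon m v))"
    using assms by (intro sum.cong) (auto simp: homogeneous_piece_def)
  finally show ?thesis by (simp add: tpoly_eval_mon sum_distrib_left mult_ac)
qed

lemma homogeneous_piece_0_const:
  assumes "f \<in> homogeneous_piece 0"
  shows "ev f v = ev f 0"
  using tpoly_eval_homogeneous[OF assms, of 0 v] by simp

section \<open>Components of a conic-line arrangement\<close>

text \<open>The order is the lexicographic one on exponent vectors. It is a monoid order, which makes the
  leading exponent additive.\<close>

definition lead_exponent :: "tpoly \<Rightarrow> 3 \<Rightarrow>\<^sub>0 nat" where
  "lead_exponent f = Max (keys f)"

lemma lead_exponent_in_keys: "f \<noteq> 0 \<Longrightarrow> lead_exponent f \<in> keys f"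
  unfolding lead_exponent_def by (rule Max_in) auto

lemma le_lead_exponent: "m \<in> keys f \<Longrightarrow> m \<le> lead_exponent f"
  unfolding lead_exponent_def by (rule Max_ge) auto

lemma lead_exponent_mult:
  assumes "f \<noteq> 0" "g \<noteq> 0"
  shows "lead_exponent (f * g) = lead_exponent f + lead_exponent g"
proof -
  let ?a = "lead_exponent f" and ?b = "lead_exponent g"
  have eq: "m = ?a \<and> n = ?b"
    if "m \<in> keys f" "n \<in> keys g" "m + n = ?a + ?b" for m n
  proof -
    have "m \<le> ?a" "n \<le> ?b" using le_lead_exponent that by auto
    with that(3) show ?thesis
      by (metis add_le_less_mono add_less_le_mono less_irrefl order_le_less)
  qed
  have "f * g = (\<Sum>m\<in>keys f. Poly_Mapping.single m (lookup f m)) *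
      (\<Sum>n\<in>keys g. Poly_Mapping.single n (lookup g n))"
    by (rule arg_cong2[OF tpoly_as_sum tpoly_as_sum])
  also have "\<dots> = (\<Sum>m\<in>keys f. \<Sum>n\<in>keys g.
       Poly_Mapping.single (m + n) (lookup f m * lookup g n))"
    by (simp add: sum_product mult_single)
  finally have "lookup (f * g) (?a + ?b) = (\<Sum>m\<in>keys f. \<Sum>n\<in>keys g.
       (if m + n = ?a + ?b then lookup f m * lookup g n else 0))"
    by (simp add: lookup_sum lookup_single when_def)
  also have "\<dots> = (\<Sum>m\<in>keys f. \<Sum>n\<in>keys g.
       (if n = ?b then if m = ?a then lookup f m * lookup g n else 0 else 0))"
    using eq by (intro sum.cong refl) auto
  also have "\<dots> = lookup f ?a * lookup g ?b"
    using lead_exponent_in_keys assms by simp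
  finally have "?a + ?b \<in> keys (f * g)"
    using lead_exponent_in_keys[OF assms(1)] lead_exponent_in_keys[OF assms(2)] by (simp add: in_keys_iff)
  moreover have "m \<le> ?a + ?b" if "m \<in> keys (f * g)" for m
    using Poly_Mapping.keys_mult[of f g] that le_lead_exponent by (force intro: add_mono)
  ultimately show ?thesis
    unfolding lead_exponent_def[of "f * g"] by (intro Max_eqI) auto
qed

lemma exponent_nonneg: "(0::3 \<Rightarrow>\<^sub>0 nat) \<le> m"
proof -
  have "\<not> m < 0" by (simp add: less_poly_mapping.rep_eq less_fun_def)
  then show ?thesis by simp
qed

lemma tpoly_unit_if_lead_exponent_0:
  assumes "f \<noteq> 0" "lead_exponent f = 0"
  shows "f dvd 1"
proof -
  have "m = 0" if "m \<in> keys f" for m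
    using le_lead_exponent[OF that] exponent_nonneg[of m] assms(2) by simp
  then have keys: "keys f = {0}" using lead_exponent_in_keys[OF assms(1)] assms(2) by auto
  define c where "c = lookup f 0"
  have "f = (\<Sum>m\<in>{0}. Poly_Mapping.single m (lookup f m))"
    using tpoly_as_sum[of f] unfolding keys .
  then have f: "f = Poly_Mapping.single 0 c" by (simp add: c_def)
  have "c \<noteq> 0" using keys by (auto simp: in_keys_iff c_def)
  then have "1 = f * Poly_Mapping.single 0 (1 / c)" by (simp add: f mult_single)
  then show ?thesis by (rule dvdI)
qed

text \<open>The total degree of the lexicographically leading monomial is additive and vanishes only for
  units, so splitting off proper factors has to stop.\<close>

lemma tpoly_irreducible_factorization:
  fixes f :: tpoly
  assumes "f \<noteq> 0"
  shows "\<exists>u gs. u dvd 1 \<and> (\<forall>g\<in>set gs. irreducible g) \<and> f = u * prod_list gs"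
  using assms
proof (induction "\<Sum>i\<in>UNIV. lookup (lead_exponent f) i" arbitrary: f rule: less_induct)
  case less
  let ?s = "\<lambda>f. \<Sum>i\<in>UNIV. lookup (lead_exponent f) i"
  have pos: "0 < ?s a" if "a \<noteq> 0" "\<not> a dvd 1" for a
  proof (rule ccontr)
    assume "\<not> 0 < ?s a"
    then have "lead_exponent a = 0" by (intro poly_mapping_eqI) auto
    then show False using tpoly_unit_if_lead_exponent_0 that by blast
  qed
  consider "f dvd 1" | "irreducible f" | "\<not> f dvd 1" "\<not> irreducible f" by blast
  then show ?case
  proof cases
    case 1
    then show ?thesis by (intro exI[of _ f] exI[of _ "[]"]) auto
  next
    case 2
    then show ?thesis by (intro exI[of _ 1] exI[of _ "[f]"]) auto
  next
    case 3
    then obtain a b where ab: "f = a * b" "\<not> a dvd 1" "\<not> b dvd 1"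
      using less.prems unfolding irreducible_def by blast
    then have nz: "a \<noteq> 0" "b \<noteq> 0" using less.prems by auto
    have "?s f = ?s a + ?s b" using nz by (simp add: ab(1) lead_exponent_mult lookup_add sum.distrib)
    then have "?s a < ?s f" "?s b < ?s f" using pos[OF nz(1) ab(2)] pos[OF nz(2) ab(3)] by auto
    from less.hyps[OF this(1) nz(1)] less.hyps[OF this(2) nz(2)]
    obtain u gs v hs where "u dvd 1" "\<forall>g\<in>set gs. irreducible g" "a = u * prod_list gs"
      "v dvd 1" "\<forall>g\<in>set hs. irreducible g" "b = v * prod_list hs"
      by blast
    then show ?thesis using ab
      by (intro exI[of _ "u * v"] exI[of _ "gs @ hs"]) (auto simp: mult_ac intro: mult_dvd_mono[of _ 1 _ 1, simplified])
  qed
qed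

text \<open>Since \<open>f\<close> is squarefree, no two factors of an irreducible factorization are proportional. By the injectivity of
  evaluation this can be said in terms of their values.\<close>

lemma conic_line_arrangement_components:
  assumes "conic_line_arrangement d f"
  obtains u :: tpoly and n :: nat and g :: "nat \<Rightarrow> tpoly" where
    "\<And>v. ev u v \<noteq> 0"
    "\<And>v. ev f v = ev u v * (\<Prod>i<n. ev (g i) v)"
    "\<And>i. i < n \<Longrightarrow> is_line (g i) \<or> is_smooth_conic (g i)"
    "\<And>i k \<kappa>. i < n \<Longrightarrow> k < n \<Longrightarrow> i \<noteq> k \<Longrightarrow> \<exists>v. ev (g i) v \<noteq> \<kappa> * ev (g k) v"
proof -
  have "f \<noteq> 0" "squarefree f" using assms by (auto simp: conic_line_arrangement_def reduced_plane_curve_def)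
  then obtain u gs where f: "u dvd 1" "\<forall>g\<in>set gs. irreducible g" "f = u * prod_list gs"
    using tpoly_irreducible_factorization by blast
  define g where "g i = gs ! i" for i
  let ?n = "length gs"
  have "prod_list hs = (\<Prod>i<length hs. hs ! i)" for hs :: "tpoly list"
    by (induction hs rule: rev_induct) (auto simp: nth_append mult.commute intro!: prod.cong)
  then have feq: "f = u * (\<Prod>i<?n. g i)" using f(3) by (simp add: g_def)
  show thesis
  proof
    fix v
    obtain w where "1 = u * w" using f(1) by (auto elim: dvdE)
    then have "1 = ev u v * ev w v" by (metis tpoly_eval_mult tpoly_eval_1)
    then show "ev u v \<noteq> 0" by auto
    show "ev f v = ev u v * (\<Prod>i<?n. ev (g i) v)"
      by (subst feq) simp
  next
    fix i assume i: "i < ?n"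
    have "g i dvd f" unfolding feq using i by (intro dvd_mult dvd_prodI) auto
    then show "is_line (g i) \<or> is_smooth_conic (g i)"
      using assms f i by (auto simp: conic_line_arrangement_def g_def)
  next
    fix i k \<kappa> assume ik: "i < ?n" "k < ?n" "i \<noteq> k"
    show "\<exists>v. ev (g i) v \<noteq> \<kappa> * ev (g k) v"
    proof (rule ccontr)
      assume "\<nexists>v. ev (g i) v \<noteq> \<kappa> * ev (g k) v"
      then have "ev (g i - Poly_Mapping.single 0 \<kappa> * g k) v = 0" for v by simp
      then have eq: "g i = Poly_Mapping.single 0 \<kappa> * g k" using tpoly_eval_eq_0D by fastforce
      have "(\<Prod>i<?n. g i) = g i * (g k * (\<Prod>i\<in>{..<?n} - {i} - {k}. g i))"
        using ik by (simp add: prod.remove[of "{..<?n}" i] prod.remove[of "{..<?n} - {i}" k])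
      then have "f = (g k)\<^sup>2 * (u * (Poly_Mapping.single 0 \<kappa> * (\<Prod>i\<in>{..<?n} - {i} - {k}. g i)))"
        unfolding feq power2_eq_square by (simp only: eq mult_ac)
      then have "(g k)\<^sup>2 dvd f" by (rule dvdI)
      then have "g k dvd 1" using \<open>squarefree f\<close> by (auto simp: squarefree_def)
      moreover have "irreducible (g k)" using f(2) ik by (auto simp: g_def)
      ultimately show False by (auto simp: irreducible_def)
    qed
  qed
qed

section \<open>The divergence theorem for complex vector fields\<close>

text \<open>Difference quotients of an integrable function have integral \<open>0\<close> because Lebesgue measure is invariant under
  translations; the compact support provides a dominating function for the limit.\<close>

lemma integral_directional_derivative_eq_0:
  fixes h :: "'a::euclidean_space \<Rightarrow> 'b::euclidean_space"
  assumes C: "compact C" and U: "open U" "C \<subseteq> U"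
    and 0: "\<And>x. x \<notin> C \<Longrightarrow> h x = 0"
    and der: "\<And>x. x \<in> U \<Longrightarrow> (h has_derivative h' x) (at x)"
    and cont: "continuous_on U (\<lambda>x. h' x e)"
  shows "integrable lborel (\<lambda>x. indicator C x *\<^sub>R h' x e)"
    and "(LINT x|lborel. indicator C x *\<^sub>R h' x e) = 0"
proof -
  have "continuous_on C (\<lambda>x. h' x e)" using cont U(2) by (rule continuous_on_subset)
  then show "integrable lborel (\<lambda>x. indicator C x *\<^sub>R h' x e)"
    by (intro borel_integrable_compact C)
  define D where "D x = (if x \<in> C then h' x e else 0)" for x
  define H where "H x = (if x \<in> C then h' x else (\<lambda>_. 0))" for x
  have opC: "open (- C)" using C by (simp add: compact_imp_closed open_Compl)
  have out: "(h has_derivative (\<lambda>_. 0)) (at x)" if "x \<notin> C" for x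
  proof -
    have "((\<lambda>_. 0) has_derivative (\<lambda>_. 0)) (at x)" by simp
    then show ?thesis
      by (rule has_derivative_transform_within_open[OF _ opC]) (use that 0 in auto)
  qed
  have derH: "(h has_derivative H x) (at x)" for x
    using der out U(2) by (auto simp: H_def)
  have HD: "H x e = D x" for x by (simp add: H_def D_def)
  have "h' x e = D x" if "x \<in> U" for x
  proof (cases "x \<in> C")
    case False
    then have "h' x = (\<lambda>_. 0)" using has_derivative_unique[OF der[OF that] out] by simp
    then show ?thesis using False by (simp add: D_def)
  qed (simp add: D_def)
  then have "continuous_on U D" using cont by (simp cong: continuous_on_cong)
  moreover have "continuous_on (- C) D"
    by (rule continuous_on_eq[of _ "\<lambda>_. 0"]) (auto simp: D_def)
  ultimately have "continuous_on (U \<union> - C) D" using U opC by (intro continuous_on_open_Un)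
  moreover have "U \<union> - C = UNIV" using U(2) by auto
  ultimately have contD: "continuous_on UNIV D" by simp
  have "bounded (D ` C)"
    using C contD by (intro compact_imp_bounded compact_continuous_image) (auto intro: continuous_on_subset)
  then obtain B where B: "B > 0" "\<And>x. x \<in> C \<Longrightarrow> norm (D x) \<le> B" by (auto simp: bounded_pos)
  then have B': "norm (D x) \<le> B" for x by (cases "x \<in> C") (auto simp: D_def)
  have conth: "continuous_on S h" for S
    by (rule has_derivative_continuous_on[of _ _ H]) (use derH has_derivative_at_withinI in blast)
  have inth: "integrable lborel h"
  proof -
    have "(\<lambda>x. indicator C x *\<^sub>R h x) = h" using 0 by (auto simp: indicator_def)
    then show ?thesis using borel_integrable_compact[OF C conth] by simp
  qed
  define q where "q k x = real (Suc k) *\<^sub>R (h (x + e /\<^sub>R real (Suc k)) - h x)" for k x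
  have line: "((\<lambda>t. h (x + t *\<^sub>R e)) has_vector_derivative D (x + t *\<^sub>R e)) (at t within S)" for x t S
  proof -
    have "((\<lambda>t. h (x + t *\<^sub>R e)) has_derivative (\<lambda>s. H (x + t *\<^sub>R e) (s *\<^sub>R e))) (at t within S)"
      by (rule has_derivative_compose[of "\<lambda>t. x + t *\<^sub>R e", OF _ derH]) (auto intro!: derivative_eq_intros)
    moreover have "H (x + t *\<^sub>R e) (s *\<^sub>R e) = s *\<^sub>R D (x + t *\<^sub>R e)" for s
      using linear_scale[OF has_derivative_linear[OF derH[of "x + t *\<^sub>R e"]]] HD by simp
    ultimately show ?thesis by (simp add: has_vector_derivative_def)
  qed
  have lim: "(\<lambda>k. q k x) \<longlonglongrightarrow> D x" for x
  proof -
    have "((\<lambda>t. h (x + t *\<^sub>R e)) has_derivative (\<lambda>t. t *\<^sub>R D x)) (at 0)"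
      using line[of x 0 UNIV] by (simp add: has_vector_derivative_def)
    then have "(\<lambda>t. norm (h (x + t *\<^sub>R e) - h x - t *\<^sub>R D x) / norm t) \<midarrow>0\<rightarrow> 0"
      by (simp add: has_derivative_at)
    moreover have "filterlim (\<lambda>k. inverse (real (Suc k))) (at 0) sequentially"
      by (rule filterlim_atI[OF LIMSEQ_inverse_real_of_nat]) simp
    ultimately have "(\<lambda>k. norm (h (x + inverse (real (Suc k)) *\<^sub>R e) - h x - inverse (real (Suc k)) *\<^sub>R D x) /
        norm (inverse (real (Suc k)))) \<longlonglongrightarrow> 0"
      by (rule filterlim_compose)
    moreover have "norm (h (x + inverse (real (Suc k)) *\<^sub>R e) - h x - inverse (real (Suc k)) *\<^sub>R D x) /
        norm (inverse (real (Suc k))) = norm (q k x - D x)" for k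
    proof -
      have "q k x - D x = real (Suc k) *\<^sub>R (h (x + inverse (real (Suc k)) *\<^sub>R e) - h x - inverse (real (Suc k)) *\<^sub>R D x)"
        by (simp add: q_def scaleR_diff_right del: of_nat_Suc)
      then show ?thesis by (simp add: divide_inverse mult.commute del: of_nat_Suc)
    qed
    ultimately have "(\<lambda>k. norm (q k x - D x)) \<longlonglongrightarrow> 0" by simp
    then show ?thesis by (simp add: tendsto_norm_zero_iff LIM_zero_iff)
  qed
  have bound: "norm (q k x) \<le> B" for k x
  proof -
    have "norm (h (x + (1 / real (Suc k)) *\<^sub>R e) - h (x + 0 *\<^sub>R e)) \<le> B * norm (1 / real (Suc k) - 0)"
    proof (rule differentiable_bound[of "{0..1 / real (Suc k)}" _ "\<lambda>t s. s *\<^sub>R D (x + t *\<^sub>R e)"])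
      show "onorm (\<lambda>s. s *\<^sub>R D (x + t *\<^sub>R e)) \<le> B" for t
        using B'[of "x + t *\<^sub>R e"] by (intro onorm_le) (simp, subst mult.commute, rule mult_right_mono, auto)
    qed (use line in \<open>auto simp: has_vector_derivative_def\<close>)
    then have "norm (h (x + e /\<^sub>R real (Suc k)) - h x) \<le> B / real (Suc k)"
      by (simp add: divide_inverse mult.commute)
    then have "real (Suc k) * norm (h (x + e /\<^sub>R real (Suc k)) - h x) \<le> B"
      by (simp add: pos_le_divide_eq mult.commute del: of_nat_Suc)
    then show ?thesis by (simp add: q_def del: of_nat_Suc)
  qed
  obtain R where R: "\<And>x. x \<in> C \<Longrightarrow> norm x \<le> R"
    using compact_imp_bounded[OF C] by (auto simp: bounded_iff)
  define C' :: "'a set" where "C' = cball 0 (R + norm e)"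
  have q0: "q k x = 0" if "x \<notin> C'" for k x
  proof -
    have "norm (e /\<^sub>R real (Suc k)) \<le> norm e" by (simp add: divide_simps mult_le_cancel_left1)
    moreover have "R + norm e < norm x" using that by (simp add: C'_def)
    moreover have "norm x \<le> norm (x + e /\<^sub>R real (Suc k)) + norm (e /\<^sub>R real (Suc k))"
      using norm_triangle_ineq4[of "x + e /\<^sub>R real (Suc k)" "e /\<^sub>R real (Suc k)"] by simp
    ultimately have "R < norm x" "R < norm (x + e /\<^sub>R real (Suc k))"
      using norm_ge_zero[of e] by linarith+
    then have "x \<notin> C" "x + e /\<^sub>R real (Suc k) \<notin> C" using R by force+
    then show ?thesis using 0 by (simp add: q_def)
  qed
  have intq: "(LINT x|lborel. q k x) = 0" for k
  proof -
    let ?c = "e /\<^sub>R real (Suc k)"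
    have "(LINT x|lborel. h (?c + x)) = (LINT x|distr lborel borel ((+) ?c). h x)"
      using conth by (subst integral_distr) (auto intro: borel_measurable_continuous_onI)
    then have "(LINT x|lborel. h (?c + x)) = (LINT x|lborel. h x)" by (simp add: lborel_distr_plus)
    moreover have "integrable lborel (\<lambda>x. h (?c + x))"
    proof -
      have "integrable (distr lborel borel ((+) ?c)) h" using inth by (simp add: lborel_distr_plus)
      then show ?thesis
        by (subst (asm) integrable_distr_eq) (use conth in \<open>auto intro: borel_measurable_continuous_onI\<close>)
    qed
    ultimately show ?thesis using inth by (simp add: q_def add.commute)
  qed
  have "(\<lambda>k. LINT x|lborel. q k x) \<longlonglongrightarrow> (LINT x|lborel. D x)"
  proof (rule integral_dominated_convergence[where w = "\<lambda>x. indicator C' x *\<^sub>R B"])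
    show "D \<in> borel_measurable lborel" using contD by (simp add: borel_measurable_continuous_onI)
    show "q k \<in> borel_measurable lborel" for k
      unfolding q_def using conth
      by (auto intro!: borel_measurable_continuous_onI continuous_intros continuous_on_compose2[OF conth])
    show "integrable lborel (\<lambda>x. indicator C' x *\<^sub>R B)"
      by (rule borel_integrable_compact) (auto simp: C'_def)
    show "AE x in lborel. (\<lambda>k. q k x) \<longlonglongrightarrow> D x" using lim by simp
    show "AE x in lborel. norm (q k x) \<le> indicator C' x *\<^sub>R B" for k
      using bound q0 by (auto simp: indicator_def)
  qed
  then have "(LINT x|lborel. D x) = 0" using intq by (simp add: LIMSEQ_const_iff)
  moreover have "(\<lambda>x. indicator C x *\<^sub>R h' x e) = D" by (auto simp: D_def indicator_def)
  ultimately show "(LINT x|lborel. indicator C x *\<^sub>R h' x e) = 0" by simp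
qed

text \<open>Wirtinger calculus on \<open>\<complex>\<^sup>3\<close>: \<open>a\<close> collects the derivatives by \<open>z\<^sub>i\<close>, and \<open>b\<close> those by the conjugates.\<close>

definition vcnj :: "complex ^ 3 \<Rightarrow> complex ^ 3" where
  "vcnj v = (\<chi> i. cnj (v $ i))"

definition wirt :: "(complex ^ 3 \<Rightarrow> complex) \<Rightarrow> complex ^ 3 \<Rightarrow> complex ^ 3 \<Rightarrow> complex ^ 3 \<Rightarrow> bool" where
  "wirt h x a b \<longleftrightarrow> (h has_derivative (\<lambda>v. cdot a v + cdot b (vcnj v))) (at x)"

lemma vcnj_nth [simp]: "vcnj v $ i = cnj (v $ i)"
  by (simp add: vcnj_def)

lemma cdot_simps [simp]:
  "cdot 0 v = 0" "cdot v 0 = 0"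
  "cdot (a + b) v = cdot a v + cdot b v"
  "cdot a (v + w) = cdot a v + cdot a w"
  "cdot (a - b) v = cdot a v - cdot b v"
  "cdot a (v - w) = cdot a v - cdot a w"
  "cdot (c *s a) v = c * cdot a v"
  "cdot a (c *s v) = c * cdot a v"
  by (simp_all add: cdot_def algebra_simps sum.distrib sum_subtractf sum_distrib_left)

lemma cdot_axis [simp]: "cdot a (axis i c) = a $ i * c" "cdot (axis i c) v = c * v $ i"
proof -
  have "cdot a (axis i c) = (\<Sum>j\<in>UNIV. if j = i then a $ i * c else 0)" for a c
    unfolding cdot_def by (rule sum.cong) (auto simp: axis_def)
  then show "cdot a (axis i c) = a $ i * c" for a c by simp
  then show "cdot (axis i c) v = c * v $ i" by (simp add: cdot_def mult.commute)
qed

lemma cdot_commute: "cdot a b = cdot b a"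
  by (simp add: cdot_def mult.commute)

lemma cnj_cdot: "cnj (cdot a v) = cdot (vcnj a) (vcnj v)"
  by (simp add: cdot_def)

lemma vcnj_vcnj [simp]: "vcnj (vcnj v) = v"
  by (simp add: vec_eq_iff)

lemma wirt_tpoly: "wirt (ev f) x (tgrad f x) 0"
  using tpoly_eval_has_derivative by (simp add: wirt_def)

lemma wirt_cnj: "wirt h x a b \<Longrightarrow> wirt (\<lambda>x. cnj (h x)) x (vcnj b) (vcnj a)"
  unfolding wirt_def
  by (drule has_derivative_cnj) (simp add: cnj_cdot add.commute)

lemma wirt_nth: "wirt (\<lambda>x. x $ i) x (axis i 1) 0"
  unfolding wirt_def by (auto intro!: bounded_linear_imp_has_derivative bounded_linear_vec_nth)

lemma wirt_add: "wirt h x a b \<Longrightarrow> wirt k x c d \<Longrightarrow> wirt (\<lambda>x. h x + k x) x (a + c) (b + d)"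
  unfolding wirt_def by (drule (1) has_derivative_add) (simp add: algebra_simps)

lemma wirt_const: "wirt (\<lambda>x. c) x 0 0"
  by (simp add: wirt_def)

lemma wirt_sum:
  "(\<And>i. i \<in> I \<Longrightarrow> wirt (h i) x (a i) (b i)) \<Longrightarrow> wirt (\<lambda>x. \<Sum>i\<in>I. h i x) x (\<Sum>i\<in>I. a i) (\<Sum>i\<in>I. b i)"
proof (induction I rule: infinite_finite_induct)
  case (insert i I)
  then show ?case using wirt_add[of "h i" x "a i" "b i" "\<lambda>x. \<Sum>i\<in>I. h i x"] by simp
qed (simp_all add: wirt_const)

lemma wirt_mult:
  "wirt h x a b \<Longrightarrow> wirt k x c d \<Longrightarrow>
    wirt (\<lambda>x. h x * k x) x (k x *s a + h x *s c) (k x *s b + h x *s d)"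
  unfolding wirt_def by (drule (1) has_derivative_mult) (simp add: algebra_simps)

lemma wirt_compose_real:
  assumes u: "wirt (\<lambda>x. of_real (u x)) x a b" and p: "(p has_real_derivative p') (at (u x))"
  shows "wirt (\<lambda>x. of_real (p (u x))) x (of_real p' *s a) (of_real p' *s b)"
proof -
  have "((\<lambda>x. Re (of_real (u x))) has_derivative (\<lambda>v. Re (cdot a v + cdot b (vcnj v)))) (at x)"
    using u unfolding wirt_def by (rule has_derivative_Re)
  then have ud: "(u has_derivative (\<lambda>v. Re (cdot a v + cdot b (vcnj v)))) (at x)" by simp
  have "((\<lambda>x. Im (of_real (u x))) has_derivative (\<lambda>v. Im (cdot a v + cdot b (vcnj v)))) (at x)"
    using u unfolding wirt_def by (rule has_derivative_Im)
  then have "((\<lambda>x. 0) has_derivative (\<lambda>v. Im (cdot a v + cdot b (vcnj v)))) (at x)" by simp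
  then have Im0: "(\<lambda>v. Im (cdot a v + cdot b (vcnj v))) = (\<lambda>v. 0)"
    using has_derivative_unique has_derivative_const by blast
  have "((\<lambda>x. p (u x)) has_derivative (\<lambda>v. p' * Re (cdot a v + cdot b (vcnj v)))) (at x)"
    using has_derivative_compose[OF ud p[unfolded has_field_derivative_def]] .
  then have "((\<lambda>x. complex_of_real (p (u x))) has_derivative (\<lambda>v. of_real (p' * Re (cdot a v + cdot b (vcnj v))))) (at x)"
    by (rule has_derivative_of_real)
  moreover have "complex_of_real (p' * Re (cdot a v + cdot b (vcnj v))) =
      cdot (of_real p' *s a) v + cdot (of_real p' *s b) (vcnj v)" for v
    using fun_cong[OF Im0, of v] by (simp add: complex_eq_iff distrib_left[symmetric])
  ultimately show ?thesis by (simp add: wirt_def)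
qed

lemma continuous_on_cdot [continuous_intros]:
  "continuous_on S a \<Longrightarrow> continuous_on S b \<Longrightarrow> continuous_on S (\<lambda>x. cdot (a x) (b x))"
  unfolding cdot_def by (intro continuous_intros continuous_on_component)

lemma continuous_on_vcnj [continuous_intros]:
  "continuous_on S a \<Longrightarrow> continuous_on S (\<lambda>x. vcnj (a x))"
  unfolding vcnj_def by (intro continuous_on_vec_lambda continuous_intros continuous_on_component)

lemma continuous_on_vscale [continuous_intros]:
  "continuous_on S c \<Longrightarrow> continuous_on S a \<Longrightarrow> continuous_on S (\<lambda>x. (c x :: complex) *s (a x :: complex ^ 3))"
  unfolding vector_scalar_mult_def by (intro continuous_on_vec_lambda continuous_intros continuous_on_component)

text \<open>The derivative by \<open>z\<^sub>i\<close> is a complex combination of the two real derivatives in the direction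
  of the \<open>i\<close>-th coordinate axis.\<close>

lemma integral_wirtinger_derivative_eq_0:
  fixes h :: "complex ^ 3 \<Rightarrow> complex"
  assumes C: "compact C" and U: "open U" "C \<subseteq> U"
    and 0: "\<And>x. x \<notin> C \<Longrightarrow> h x = 0"
    and der: "\<And>x. x \<in> U \<Longrightarrow> wirt h x (a x) (b x)"
    and cont: "continuous_on U a" "continuous_on U b"
  shows "integrable lborel (\<lambda>x. indicator C x *\<^sub>R a x $ i)" (is ?I)
    and "(LINT x|lborel. indicator C x *\<^sub>R a x $ i) = 0" (is ?Z)
proof -
  let ?D = "\<lambda>x v. cdot (a x) v + cdot (b x) (vcnj v)"
  have D: "(h has_derivative ?D x) (at x)" if "x \<in> U" for x
    using der[OF that] by (simp add: wirt_def)
  have c: "continuous_on U (\<lambda>x. ?D x e)" for e by (intro continuous_intros cont)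
  note i1 = integral_directional_derivative_eq_0[where e = "axis i 1", OF C U 0 D c]
  note i2 = integral_directional_derivative_eq_0[where e = "axis i \<i>", OF C U 0 D c]
  have z1: "(LINT x|lborel. indicator C x *\<^sub>R ?D x (axis i 1)) = 0" using i1(2) .
  have z2: "(LINT x|lborel. indicator C x *\<^sub>R ?D x (axis i \<i>)) = 0" using i2(2) .
  have vc: "vcnj (axis i z) = axis i (cnj z)" for z by (simp add: vec_eq_iff axis_def)
  have eq: "indicator C x *\<^sub>R a x $ i =
      (1/2) * (indicator C x *\<^sub>R ?D x (axis i 1)) - (\<i>/2) * (indicator C x *\<^sub>R ?D x (axis i \<i>))" for x
    by (simp add: vc indicator_def field_simps)
  show ?I unfolding eq
    by (intro Bochner_Integration.integrable_diff integrable_mult_right i1 i2)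
  have "(LINT x|lborel. indicator C x *\<^sub>R a x $ i) =
    (LINT x|lborel. (1/2) * (indicator C x *\<^sub>R ?D x (axis i 1))) - (LINT x|lborel. (\<i>/2) * (indicator C x *\<^sub>R ?D x (axis i \<i>)))"
    unfolding eq by (intro Bochner_Integration.integral_diff integrable_mult_right i1 i2)
  also have "\<dots> = 0"
    unfolding integral_mult_right_zero z1 z2 by simp
  finally show ?Z .
qed

lemma integral_divergence_eq_0:
  fixes K :: "complex ^ 3 \<Rightarrow> complex" and \<theta> :: "tpoly ^ 3"
  assumes C: "compact C" and U: "open U" "C \<subseteq> U"
    and 0: "\<And>x. x \<notin> C \<Longrightarrow> K x = 0"
    and der: "\<And>x. x \<in> U \<Longrightarrow> wirt K x (a x) (b x)"
    and cont: "continuous_on U a" "continuous_on U b"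
  shows "(LINT x|lborel. indicator C x *\<^sub>R
     (cdot (a x) (\<chi> i. ev (\<theta> $ i) x) + K x * ev (\<Sum>i\<in>UNIV. tpoly_pderiv i (\<theta> $ i)) x)) = 0"
proof -
  have contK: "continuous_on U K"
    by (rule has_derivative_continuous_on[of _ _ "\<lambda>x v. cdot (a x) v + cdot (b x) (vcnj v)"])
       (use der[unfolded wirt_def] has_derivative_at_withinI in blast)
  define A where "A i x = ev (\<theta> $ i) x *s a x + K x *s tgrad (\<theta> $ i) x"
    for i :: "3" and x
  define B where "B i x = ev (\<theta> $ i) x *s b x + K x *s 0" for i :: "3" and x
  have w: "wirt (\<lambda>x. K x * ev (\<theta> $ i) x) x (A i x) (B i x)" if "x \<in> U" for x i
    unfolding A_def B_def by (intro wirt_mult der that wirt_tpoly)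
  have c: "continuous_on U (A i)" "continuous_on U (B i)" for i
    unfolding A_def B_def by (intro continuous_intros cont contK)+
  have K0: "K x * ev (\<theta> $ i) x = 0" if "x \<notin> C" for x i using 0[OF that] by simp
  note I = integral_wirtinger_derivative_eq_0[OF C U K0 w c]
  have "(LINT x|lborel. (\<Sum>i\<in>UNIV. indicator C x *\<^sub>R A i x $ i)) = (\<Sum>i\<in>UNIV. LINT x|lborel. indicator C x *\<^sub>R A i x $ i)"
    by (intro Bochner_Integration.integral_sum I(1)) auto
  also have "\<dots> = 0" using I(2) by simp
  finally show ?thesis
    by (simp add: A_def cdot_def tgrad_def sum.distrib algebra_simps sum_distrib_left scaleR_sum_right[symmetric])
qed

section \<open>Functions homogeneous of degree \<open>-6\<close> on \<open>\<complex>\<^sup>3\<close>\<close>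

text \<open>Radii are measured on a logarithmic scale, and the intervals are half-open, so that consecutive annuli tile
  \<open>\<complex>\<^sup>3\<close> without its origin.\<close>

definition annulus :: "real \<Rightarrow> real \<Rightarrow> (complex ^ 3) set" where
  "annulus a b = {x. exp a \<le> (norm x)\<^sup>2 \<and> (norm x)\<^sup>2 < exp b}"

lemma annulus_borel [measurable]: "annulus a b \<in> sets borel"
  unfolding annulus_def by measurable

lemma nn_integral_scale:
  fixes F :: "complex ^ 3 \<Rightarrow> ennreal"
  assumes [measurable]: "F \<in> borel_measurable borel" and c: "c > 0"
  shows "(\<integral>\<^sup>+x. F x \<partial>lborel) = (\<integral>\<^sup>+x. ennreal (c ^ 6) * F (c *\<^sub>R x) \<partial>lborel)"
proof -
  have "DIM(complex ^ 3) = 6" by simp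
  then have "lborel = density (distr lborel borel (\<lambda>x::complex^3. 0 + c *\<^sub>R x)) (\<lambda>_. ennreal (\<bar>c\<bar> ^ 6))"
    using lborel_affine[of c "0 :: complex ^ 3"] c by simp
  then have "(\<integral>\<^sup>+x. F x \<partial>lborel) =
      (\<integral>\<^sup>+x. F x \<partial>density (distr lborel borel (\<lambda>x::complex^3. 0 + c *\<^sub>R x)) (\<lambda>_. ennreal (\<bar>c\<bar> ^ 6)))"
    by (rule arg_cong)
  also have "\<dots> = (\<integral>\<^sup>+x. ennreal (c ^ 6) * F (c *\<^sub>R x) \<partial>lborel)"
    using c by (simp add: nn_integral_density nn_integral_distr)
  finally show ?thesis .
qed

text \<open>The degree \<open>- 6\<close> compensates exactly for the scaling of Lebesgue measure on \<open>\<complex>\<^sup>3\<close>, which has real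
  dimension \<open>6\<close>.\<close>

lemma nn_integral_annulus_shift:
  fixes Q :: "complex ^ 3 \<Rightarrow> real"
  assumes [measurable]: "Q \<in> borel_measurable borel"
    and hom: "\<And>c x. c > 0 \<Longrightarrow> x \<noteq> 0 \<Longrightarrow> Q (c *\<^sub>R x) = Q x / c ^ 6"
  shows "(\<integral>\<^sup>+x\<in>annulus (a + t) (b + t). ennreal (Q x) \<partial>lborel) =
    (\<integral>\<^sup>+x\<in>annulus a b. ennreal (Q x) \<partial>lborel)"
proof -
  define c where "c = exp (t / 2)"
  have c: "c > 0" "c\<^sup>2 = exp t" by (simp_all add: c_def power2_eq_square flip: exp_add)
  have "ennreal (c ^ 6) * (ennreal (Q (c *\<^sub>R x)) * indicator (annulus (a + t) (b + t)) (c *\<^sub>R x)) =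
      ennreal (Q x) * indicator (annulus a b) x" for x
  proof (cases "x \<in> annulus a b")
    case True
    then have "x \<noteq> 0" by (auto simp: annulus_def)
    moreover have "c *\<^sub>R x \<in> annulus (a + t) (b + t)"
      using True by (simp add: annulus_def power_mult_distrib c(2) exp_add mult.commute)
    ultimately show ?thesis
      using True c(1) hom[OF c(1), of x] by (simp flip: ennreal_mult')
  next
    case False
    then have "c *\<^sub>R x \<notin> annulus (a + t) (b + t)"
      by (simp add: annulus_def power_mult_distrib c(2) exp_add mult.commute)
    then show ?thesis using False by simp
  qed
  then show ?thesis
    by (subst nn_integral_scale[OF _ c(1)]) simp_all
qed

lemma nn_integral_annulus:
  fixes Q :: "complex ^ 3 \<Rightarrow> real"
  assumes [measurable]: "Q \<in> borel_measurable borel"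
    and hom: "\<And>c x. c > 0 \<Longrightarrow> x \<noteq> 0 \<Longrightarrow> Q (c *\<^sub>R x) = Q x / c ^ 6"
  shows "(\<integral>\<^sup>+x\<in>annulus a (a + real n). ennreal (Q x) \<partial>lborel) =
    of_nat n * (\<integral>\<^sup>+x\<in>annulus 0 1. ennreal (Q x) \<partial>lborel)"
proof (induction n)
  case 0
  have "annulus a a = {}" by (auto simp: annulus_def)
  then show ?case by simp
next
  case (Suc n)
  let ?b = "a + real n"
  have "a \<le> ?b" by simp
  then have "exp a \<le> exp ?b" "exp ?b \<le> exp (1 + ?b)" by simp_all
  note le = this
  have ind: "indicator (annulus a (a + real (Suc n))) x =
      indicator (annulus a ?b) x + (indicator (annulus (0 + ?b) (1 + ?b)) x :: ennreal)" for x
    by (auto simp: annulus_def indicator_def add_ac not_less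
        dest: order_trans[OF le(1)] order_trans[OF le(2)] less_le_trans[OF _ le(2)])
  have "(\<integral>\<^sup>+x\<in>annulus a (a + real (Suc n)). ennreal (Q x) \<partial>lborel) =
    (\<integral>\<^sup>+x\<in>annulus a ?b. ennreal (Q x) \<partial>lborel) + (\<integral>\<^sup>+x\<in>annulus (0 + ?b) (1 + ?b). ennreal (Q x) \<partial>lborel)"
    unfolding ind distrib_left by (rule nn_integral_add) measurable
  also have "\<dots> = of_nat (Suc n) * (\<integral>\<^sup>+x\<in>annulus 0 1. ennreal (Q x) \<partial>lborel)"
  proof -
    have "(\<integral>\<^sup>+x\<in>annulus (0 + ?b) (1 + ?b). ennreal (Q x) \<partial>lborel) = (\<integral>\<^sup>+x\<in>annulus 0 1. ennreal (Q x) \<partial>lborel)"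
      by (rule nn_integral_annulus_shift[OF assms])
    then show ?thesis unfolding Suc by (simp add: distrib_right add.commute)
  qed
  finally show ?case .
qed

section \<open>Syzygies of small degree\<close>

lemma of_real_norm_sq: "complex_of_real ((norm x)\<^sup>2) = cdot x (vcnj x)" for x :: "complex ^ 3"
  by (simp add: norm_vec_def L2_set_def sum_nonneg cdot_def flip: complex_norm_square)

lemma vcnj_simps [simp]:
  "vcnj (a + b) = vcnj a + vcnj b" "vcnj (a - b) = vcnj a - vcnj b" "vcnj (c *s a) = cnj c *s vcnj a"
  "vcnj 0 = 0"
  by (simp_all add: vec_eq_iff)

lemma wirt_norm_sq: "wirt (\<lambda>x. of_real ((norm x)\<^sup>2)) x (vcnj x) x"
proof -
  have "wirt (\<lambda>x. \<Sum>i\<in>UNIV. x $ i * cnj (x $ i)) x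
     (\<Sum>i\<in>UNIV. cnj (x $ i) *s axis i 1 + x $ i *s vcnj 0) (\<Sum>i\<in>UNIV. cnj (x $ i) *s 0 + x $ i *s vcnj (axis i 1))"
    by (intro wirt_sum wirt_mult wirt_cnj wirt_nth)
  moreover have "(\<Sum>i\<in>UNIV. cnj (x $ i) *s axis i 1 + x $ i *s vcnj 0) = vcnj x"
    "(\<Sum>i\<in>UNIV. cnj (x $ i) *s 0 + x $ i *s vcnj (axis i 1)) = x"
    by (simp_all add: vec_eq_iff axis_def if_distrib cong: if_cong)
  ultimately show ?thesis unfolding of_real_norm_sq cdot_def by simp
qed

text \<open>Lagrange's identity, which contains the Cauchy-Schwarz inequality and its equality case.\<close>

lemma lagrange_identity:
  fixes a x :: "complex ^ 3"
  assumes "x \<noteq> 0"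
  shows "(norm x)\<^sup>2 * (norm a)\<^sup>2 - (cmod (cdot a (vcnj x)))\<^sup>2 =
     (norm x)\<^sup>2 * (norm (a - (cdot a (vcnj x) / of_real ((norm x)\<^sup>2)) *s x))\<^sup>2"
proof -
  define n c where "n = cdot x (vcnj x)" and "c = cdot a (vcnj x)"
  have n: "n = of_real ((norm x)\<^sup>2)" by (simp only: n_def of_real_norm_sq)
  then have n0: "n \<noteq> 0" "cnj n = n" using assms by auto
  have cc: "cdot x (vcnj a) = cnj c" by (simp add: c_def cnj_cdot cdot_commute)
  have "complex_of_real ((norm x)\<^sup>2 * (norm (a - (c / n) *s x))\<^sup>2) =
      n * cdot (a - (c / n) *s x) (vcnj (a - (c / n) *s x))"
    by (simp only: of_real_mult of_real_norm_sq n_def)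
  also have "\<dots> = n * cdot a (vcnj a) - c * cnj c"
    using n0 by (simp add: cc n_def[symmetric] c_def[symmetric] field_simps)
  also have "\<dots> = of_real ((norm x)\<^sup>2 * (norm a)\<^sup>2 - (cmod c)\<^sup>2)"
    by (simp only: of_real_mult of_real_diff n[symmetric] of_real_norm_sq[of a] complex_norm_square)
  finally show ?thesis unfolding of_real_eq_iff c_def n by simp
qed

text \<open>The hypotheses exclude a nonzero \<open>\<theta>\<close>; the locale collects them for the proof of this fact.\<close>

locale syzygy =
  fixes f :: tpoly and \<theta> :: "tpoly ^ 3" and d r :: nat and s :: real
  assumes f_hom: "f \<in> homogeneous_piece d" and d: "d \<ge> 1"
    and \<theta>_hom: "\<And>i. \<theta> $ i \<in> homogeneous_piece r"
    and \<theta>_AR: "\<theta> \<in> AR f"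
    and slope: "s * d > r + 2"
    and f_AE: "AE x in lborel. ev f x \<noteq> 0"
    and integrable_weight: "\<And>A B. 0 < A \<Longrightarrow>
      integrable lborel (\<lambda>x. indicator {x. A \<le> (norm x)\<^sup>2 \<and> (norm x)\<^sup>2 \<le> B} x *\<^sub>R (cmod (ev f x))\<^sup>2 powr (- s))"
begin

definition \<epsilon> :: real where "\<epsilon> = s * d - (r + 2)"

definition th :: "complex ^ 3 \<Rightarrow> complex ^ 3" where
  "th x = (\<chi> i. ev (\<theta> $ i) x)"

definition dv :: tpoly where
  "dv = (\<Sum>i\<in>UNIV. tpoly_pderiv i (\<theta> $ i))"

definition tN :: "complex ^ 3 \<Rightarrow> complex" where
  "tN x = cdot (th x) (vcnj x)"

text \<open>With \<open>N = \<bar>x\<bar>\<^sup>2\<close> this is \<open>N G\<close>, where \<open>G\<close> is the twisted divergence of \<open>\<theta>\<close>, that is, \<open>W G\<close> is the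
  divergence of \<open>W \<theta>\<close> for the weight \<open>W = \<bar>f\<bar> ^ (- 2 s) N ^ \<epsilon>\<close>.\<close>

definition H :: "complex ^ 3 \<Rightarrow> complex" where
  "H x = of_real ((norm x)\<^sup>2) * ev dv x + of_real \<epsilon> * tN x"

text \<open>Up to the weight \<open>w\<close> and a power of \<open>N\<close> the integrand of the final identity; the bracket is the Cauchy-Schwarz defect of \<open>\<theta>\<close>
  and the radial field.\<close>

definition P :: "complex ^ 3 \<Rightarrow> real" where
  "P x = (cmod (H x))\<^sup>2 + \<epsilon> * ((norm x)\<^sup>2 * (norm (th x))\<^sup>2 - (cmod (tN x))\<^sup>2)"

definition w :: "complex ^ 3 \<Rightarrow> real" where
  "w x = (cmod (ev f x))\<^sup>2 powr (- s)"

lemma s_pos: "s > 0"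
proof (rule ccontr)
  assume "\<not> s > 0"
  then have "s * d \<le> 0" by (simp add: mult_nonpos_nonneg)
  then show False using slope by simp
qed

lemma \<epsilon>_pos: "\<epsilon> > 0" using slope by (simp add: \<epsilon>_def)

lemma cdot_tgrad_th: "cdot (tgrad f x) (th x) = 0"
proof -
  have "ev (\<Sum>i\<in>UNIV. \<theta> $ i * tpoly_pderiv i f) x = 0" using \<theta>_AR by (simp add: AR_def)
  then show ?thesis by (simp add: cdot_def tgrad_def th_def mult.commute)
qed

lemma wirt_tN: "wirt tN x (\<Sum>i\<in>UNIV. cnj (x $ i) *s tgrad (\<theta> $ i) x) (th x)"
proof -
  have "wirt (\<lambda>x. \<Sum>i\<in>UNIV. ev (\<theta> $ i) x * cnj (x $ i)) x
     (\<Sum>i\<in>UNIV. cnj (x $ i) *s tgrad (\<theta> $ i) x + ev (\<theta> $ i) x *s vcnj 0)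
     (\<Sum>i\<in>UNIV. cnj (x $ i) *s 0 + ev (\<theta> $ i) x *s vcnj (axis i 1))"
    by (intro wirt_sum wirt_mult wirt_cnj wirt_nth wirt_tpoly)
  moreover have "(\<Sum>i\<in>UNIV. cnj (x $ i) *s 0 + ev (\<theta> $ i) x *s vcnj (axis i 1)) = th x"
    by (simp add: vec_eq_iff axis_def if_distrib th_def cong: if_cong)
  ultimately show ?thesis unfolding tN_def[abs_def] cdot_def by (simp add: th_def)
qed

text \<open>The derivatives of \<open>H\<close> by the coordinates; those by their conjugates are simple enough to be written out.\<close>

definition aH :: "complex ^ 3 \<Rightarrow> complex ^ 3" where
  "aH x = ev dv x *s vcnj x + of_real ((norm x)\<^sup>2) *s tgrad dv x +
     of_real \<epsilon> *s (\<Sum>i\<in>UNIV. cnj (x $ i) *s tgrad (\<theta> $ i) x)"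

lemma wirt_H: "wirt H x (aH x) (ev dv x *s x + of_real \<epsilon> *s th x)"
proof -
  have "wirt (\<lambda>x. of_real ((norm x)\<^sup>2) * ev dv x + of_real \<epsilon> * tN x) x
    ((ev dv x *s vcnj x + of_real ((norm x)\<^sup>2) *s tgrad dv x) +
       (tN x *s 0 + of_real \<epsilon> *s (\<Sum>i\<in>UNIV. cnj (x $ i) *s tgrad (\<theta> $ i) x)))
    ((ev dv x *s x + of_real ((norm x)\<^sup>2) *s 0) + (tN x *s 0 + of_real \<epsilon> *s th x))"
    by (intro wirt_add wirt_mult wirt_norm_sq wirt_tpoly wirt_tN wirt_const)
  then show ?thesis by (simp add: H_def[abs_def] aH_def)
qed

lemma continuous_th [continuous_intros]: "continuous_on S th"
  unfolding th_def by (intro continuous_on_vec_lambda continuous_intros)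

lemma continuous_tN [continuous_intros]: "continuous_on S tN"
  unfolding tN_def by (intro continuous_intros)

lemma continuous_H [continuous_intros]: "continuous_on S H"
  unfolding H_def by (intro continuous_intros)

lemma continuous_P [continuous_intros]: "continuous_on S P"
  unfolding P_def by (intro continuous_intros)

lemma continuous_aH: "continuous_on S aH"
  unfolding aH_def by (intro continuous_intros continuous_on_component)

definition shell :: "real \<Rightarrow> real \<Rightarrow> (complex ^ 3) set" where
  "shell A B = {x. A \<le> (norm x)\<^sup>2 \<and> (norm x)\<^sup>2 \<le> B}"

lemma compact_shell: "compact (shell A B)"
proof -
  have "shell A B \<subseteq> cball 0 (sqrt B)" by (auto simp: shell_def intro: real_le_rsqrt)
  then have "bounded (shell A B)" using bounded_cball bounded_subset by blast
  moreover have "closed (shell A B)" unfolding shell_def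
    by (intro closed_Collect_conj closed_Collect_le continuous_intros)
  ultimately show ?thesis by (simp add: compact_eq_bounded_closed)
qed

text \<open>The divergence of \<open>\<phi> (\<bar>x\<bar>\<^sup>2) cnj H \<theta>\<close>, for a function \<open>\<phi>\<close> with derivative \<open>\<phi>'\<close>.\<close>

definition integrand :: "(real \<Rightarrow> real) \<Rightarrow> (real \<Rightarrow> real) \<Rightarrow> complex ^ 3 \<Rightarrow> complex" where
  "integrand \<phi> \<phi>' x = of_real (\<phi>' ((norm x)\<^sup>2)) * tN x * cnj (H x) +
     of_real (\<phi> ((norm x)\<^sup>2)) * (cnj (ev dv x) * tN x + of_real (\<epsilon> * (norm (th x))\<^sup>2) + cnj (H x) * ev dv x)"

text \<open>The weight \<open>\<bar>f\<bar> ^ (- 2 s)\<close> is singular along the curve. Adding \<open>\<delta>\<close> to \<open>\<bar>f\<bar>\<^sup>2\<close> makes it smooth and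
  costs nothing, because \<open>\<theta>\<close> kills both \<open>f\<close> and its conjugate, hence every function of \<open>\<bar>f\<bar>\<^sup>2\<close>.\<close>

lemma regularized_identity:
  assumes \<delta>: "\<delta> > 0" and A: "0 < A"
    and \<phi>: "\<And>t. t > 0 \<Longrightarrow> (\<phi> has_real_derivative \<phi>' t) (at t)"
    and \<phi>': "continuous_on {0<..} \<phi>'"
    and supp: "\<And>t. 0 \<le> t \<Longrightarrow> t < A \<or> B < t \<Longrightarrow> \<phi> t = 0"
  shows "(LINT x|lborel. indicator (shell A B) x *\<^sub>R
     (of_real (((cmod (ev f x))\<^sup>2 + \<delta>) powr (- s)) * integrand \<phi> \<phi>' x)) = 0"
proof -
  define wd where "wd x = ((cmod (ev f x))\<^sup>2 + \<delta>) powr (- s)" for x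
  define wd' where "wd' x = (- s) * ((cmod (ev f x))\<^sup>2 + \<delta>) powr (- s - 1)" for x
  define K where "K x = of_real (\<phi> ((norm x)\<^sup>2)) * of_real (wd x) * cnj (H x)" for x
  define a where "a x = cnj (H x) *s (of_real (wd x) *s (of_real (\<phi>' ((norm x)\<^sup>2)) *s vcnj x) +
       of_real (\<phi> ((norm x)\<^sup>2)) *s (of_real (wd' x) *s (cnj (ev f x) *s tgrad f x))) +
     (of_real (\<phi> ((norm x)\<^sup>2)) * of_real (wd x)) *s vcnj (ev dv x *s x + of_real \<epsilon> *s th x)" for x
  define b where "b x = cnj (H x) *s (of_real (wd x) *s (of_real (\<phi>' ((norm x)\<^sup>2)) *s x) +
       of_real (\<phi> ((norm x)\<^sup>2)) *s (of_real (wd' x) *s (ev f x *s vcnj (tgrad f x)))) +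
     (of_real (\<phi> ((norm x)\<^sup>2)) * of_real (wd x)) *s vcnj (aH x)" for x
  have pos: "(cmod (ev f x))\<^sup>2 + \<delta> > 0" for x using \<delta> by (simp add: add_nonneg_pos)
  have wd: "wirt (\<lambda>x. of_real (wd x)) x (of_real (wd' x) *s (cnj (ev f x) *s tgrad f x))
      (of_real (wd' x) *s (ev f x *s vcnj (tgrad f x)))" for x
  proof -
    have "wirt (\<lambda>x. ev f x * cnj (ev f x)) x
      (cnj (ev f x) *s tgrad f x + ev f x *s vcnj 0)
      (cnj (ev f x) *s 0 + ev f x *s vcnj (tgrad f x))"
      by (intro wirt_mult wirt_cnj wirt_tpoly)
    then have "wirt (\<lambda>x. of_real ((cmod (ev f x))\<^sup>2)) x (cnj (ev f x) *s tgrad f x)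
       (ev f x *s vcnj (tgrad f x))"
      unfolding complex_norm_square by simp
    moreover have "((\<lambda>t. (t + \<delta>) powr (- s)) has_real_derivative wd' x) (at ((cmod (ev f x))\<^sup>2))"
      unfolding wd'_def using pos[of x] by (auto intro!: derivative_eq_intros)
    ultimately show ?thesis unfolding wd_def by (rule wirt_compose_real)
  qed
  have K: "wirt K x (a x) (b x)" if "x \<in> - {0}" for x
  proof -
    have x: "(norm x)\<^sup>2 > 0" using that by simp
    have h: "wirt (\<lambda>x. of_real (\<phi> ((norm x)\<^sup>2))) x (of_real (\<phi>' ((norm x)\<^sup>2)) *s vcnj x) (of_real (\<phi>' ((norm x)\<^sup>2)) *s x)"
      by (rule wirt_compose_real[OF wirt_norm_sq \<phi>[OF x]])
    show ?thesis unfolding K_def[abs_def] a_def b_def by (intro wirt_mult h wd wirt_cnj wirt_H)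
  qed
  have c\<phi>: "continuous_on {0<..} \<phi>"
    using \<phi> by (intro DERIV_continuous_on) (auto intro: has_field_derivative_at_within)
  have c: "continuous_on (- {0::complex^3}) (\<lambda>x. complex_of_real (g ((norm x)\<^sup>2)))" if "continuous_on {0<..} g" for g
    by (intro continuous_intros continuous_on_compose2[OF that]) auto
  have cw: "continuous_on S (\<lambda>x. complex_of_real (wd x))" "continuous_on S (\<lambda>x. complex_of_real (wd' x))" for S
    unfolding wd_def wd'_def using pos by (auto intro!: continuous_intros simp: less_imp_neq[THEN not_sym])
  have ca: "continuous_on (- {0}) a" "continuous_on (- {0}) b"
    unfolding a_def b_def by (intro continuous_intros c c\<phi> \<phi>' cw continuous_aH)+
  \<comment> \<open>\<open>\<phi>\<close> may be singular at \<open>0\<close>, where the cutoff vanishes.\<close>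
  have sub: "shell A B \<subseteq> - {0}" using A by (auto simp: shell_def)
  have out: "K x = 0" if "x \<notin> shell A B" for x
    using supp[of "(norm x)\<^sup>2"] that by (auto simp: K_def shell_def)
  have "(LINT x|lborel. indicator (shell A B) x *\<^sub>R
     (cdot (a x) (\<chi> i. ev (\<theta> $ i) x) + K x * ev (\<Sum>i\<in>UNIV. tpoly_pderiv i (\<theta> $ i)) x)) = 0"
    by (rule integral_divergence_eq_0[OF compact_shell _ sub out K ca]) auto
  moreover have "cdot (a x) (\<chi> i. ev (\<theta> $ i) x) + K x * ev (\<Sum>i\<in>UNIV. tpoly_pderiv i (\<theta> $ i)) x =
      of_real (wd x) * integrand \<phi> \<phi>' x" for x
  proof -
    have "cdot (vcnj x) (th x) = tN x" "cdot (vcnj (th x)) (th x) = of_real ((norm (th x))\<^sup>2)"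
      by (simp_all only: tN_def of_real_norm_sq cdot_commute)
    then have "cdot (a x) (th x) + K x * ev dv x = of_real (wd x) * integrand \<phi> \<phi>' x"
      by (simp add: a_def K_def integrand_def cdot_tgrad_th algebra_simps)
    then show ?thesis by (simp only: th_def dv_def)
  qed
  ultimately show ?thesis by (simp add: wd_def)
qed

lemma w_nonneg: "w x \<ge> 0" by (simp add: w_def)

lemma tpoly_eval_measurable [measurable]: "ev p \<in> borel_measurable borel"
  by (intro borel_measurable_continuous_onI continuous_on_tpoly_eval continuous_on_id)

lemma w_measurable [measurable]: "w \<in> borel_measurable borel"
  unfolding w_def by measurable

lemma shell_measurable [measurable]: "shell A B \<in> sets borel"
  using compact_shell by (simp add: borel_compact)

lemma integrable_weighted:
  fixes g :: "complex ^ 3 \<Rightarrow> 'b::euclidean_space"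
  assumes A: "0 < A" and g: "continuous_on (shell A B) g"
  shows "integrable lborel (\<lambda>x. indicator (shell A B) x *\<^sub>R (w x *\<^sub>R g x))"
proof -
  have "bounded (g ` shell A B)" by (intro compact_imp_bounded compact_continuous_image g compact_shell)
  then obtain M where M: "M > 0" "\<And>x. x \<in> shell A B \<Longrightarrow> norm (g x) \<le> M" by (auto simp: bounded_pos)
  have gm: "(\<lambda>x. indicator (shell A B) x *\<^sub>R g x) \<in> borel_measurable borel"
    by (rule borel_measurable_continuous_on_indicator[OF shell_measurable g])
  have "(\<lambda>x. w x *\<^sub>R (indicator (shell A B) x *\<^sub>R g x)) \<in> borel_measurable borel"
    by (intro borel_measurable_scaleR w_measurable gm)
  then have m: "(\<lambda>x. indicator (shell A B) x *\<^sub>R (w x *\<^sub>R g x)) \<in> borel_measurable lborel"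
    by (simp add: mult.commute)
  have "integrable lborel (\<lambda>x. M * (indicator (shell A B) x *\<^sub>R w x))"
    using integrable_weight[OF A, of B] by (simp add: shell_def w_def)
  then show ?thesis
  proof (rule Bochner_Integration.integrable_bound[OF _ m], intro AE_I2)
    fix x
    show "norm (indicator (shell A B) x *\<^sub>R (w x *\<^sub>R g x)) \<le> norm (M * (indicator (shell A B) x *\<^sub>R w x))"
      using M(1) mult_left_mono[OF M(2), of x "w x"] w_nonneg[of x]
      by (cases "x \<in> shell A B") (auto simp: mult.commute)
  qed
qed

text \<open>The regularized weights increase to \<open>w\<close> as \<open>\<delta>\<close> tends to \<open>0\<close>, and \<open>w\<close> is integrable on shells, so dominated
  convergence applies.\<close>

lemma weighted_identity:
  assumes A: "0 < A"
    and \<phi>: "\<And>t. t > 0 \<Longrightarrow> (\<phi> has_real_derivative \<phi>' t) (at t)"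
    and \<phi>': "continuous_on {0<..} \<phi>'"
    and supp: "\<And>t. 0 \<le> t \<Longrightarrow> t < A \<or> B < t \<Longrightarrow> \<phi> t = 0"
  shows "(LINT x|lborel. indicator (shell A B) x *\<^sub>R (w x *\<^sub>R integrand \<phi> \<phi>' x)) = 0"
proof -
  have sub: "shell A B \<subseteq> - {0}" using A by (auto simp: shell_def)
  have c: "continuous_on (shell A B) (\<lambda>x. complex_of_real (g ((norm x)\<^sup>2)))" if "continuous_on {0<..} g" for g
    using sub by (intro continuous_intros continuous_on_compose2[OF that]) auto
  have c\<phi>: "continuous_on {0<..} \<phi>"
    using \<phi> by (intro DERIV_continuous_on) (auto intro: has_field_derivative_at_within)
  have g: "continuous_on (shell A B) (integrand \<phi> \<phi>')"
    unfolding integrand_def by (intro continuous_intros c c\<phi> \<phi>')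
  define \<delta> where "\<delta> k = inverse (real (Suc k))" for k
  have \<delta>: "\<delta> k > 0" for k by (simp add: \<delta>_def)
  have \<delta>0: "\<delta> \<longlonglongrightarrow> 0" unfolding \<delta>_def by (rule LIMSEQ_inverse_real_of_nat)
  define wd where "wd k x = ((cmod (ev f x))\<^sup>2 + \<delta> k) powr (- s)" for k x
  have wdm [measurable]: "wd k \<in> borel_measurable borel" for k unfolding wd_def by measurable
  have gm [measurable]: "(\<lambda>x. indicator (shell A B) x *\<^sub>R integrand \<phi> \<phi>' x) \<in> borel_measurable borel"
    by (rule borel_measurable_continuous_on_indicator[OF shell_measurable g])
  have "(\<lambda>k. LINT x|lborel. wd k x *\<^sub>R (indicator (shell A B) x *\<^sub>R integrand \<phi> \<phi>' x)) \<longlonglongrightarrow>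
     (LINT x|lborel. w x *\<^sub>R (indicator (shell A B) x *\<^sub>R integrand \<phi> \<phi>' x))"
  proof (rule integral_dominated_convergence)
    show "integrable lborel (\<lambda>x. norm (indicator (shell A B) x *\<^sub>R (w x *\<^sub>R integrand \<phi> \<phi>' x)))"
      by (intro integrable_norm integrable_weighted A g)
    show "AE x in lborel. (\<lambda>k. wd k x *\<^sub>R (indicator (shell A B) x *\<^sub>R integrand \<phi> \<phi>' x)) \<longlonglongrightarrow>
        w x *\<^sub>R (indicator (shell A B) x *\<^sub>R integrand \<phi> \<phi>' x)"
      using f_AE
    proof eventually_elim
      case (elim x)
      have "(\<lambda>k. (cmod (ev f x))\<^sup>2 + \<delta> k) \<longlonglongrightarrow> (cmod (ev f x))\<^sup>2 + 0"
        by (intro tendsto_intros \<delta>0)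
      then have "(\<lambda>k. wd k x) \<longlonglongrightarrow> w x"
        unfolding wd_def w_def using elim by (intro tendsto_powr tendsto_const) auto
      then show ?case by (intro tendsto_scaleR tendsto_const)
    qed
    show "AE x in lborel. norm (wd k x *\<^sub>R (indicator (shell A B) x *\<^sub>R integrand \<phi> \<phi>' x)) \<le>
        norm (indicator (shell A B) x *\<^sub>R (w x *\<^sub>R integrand \<phi> \<phi>' x))" for k
      using f_AE
    proof eventually_elim
      case (elim x)
      have "wd k x \<le> w x" unfolding wd_def w_def
        using elim s_pos \<delta>[of k] by (intro powr_mono2') auto
      moreover have "wd k x \<ge> 0" by (simp add: wd_def)
      ultimately show ?case by (auto simp: indicator_def intro!: mult_right_mono)
    qed
  qed measurable
  moreover have "(LINT x|lborel. wd k x *\<^sub>R (indicator (shell A B) x *\<^sub>R integrand \<phi> \<phi>' x)) = 0" for k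
    using regularized_identity[OF \<delta> A \<phi> \<phi>' supp] by (simp add: wd_def scaleR_conv_of_real mult_ac)
  ultimately have "(LINT x|lborel. w x *\<^sub>R (indicator (shell A B) x *\<^sub>R integrand \<phi> \<phi>' x)) = 0"
    by (simp add: LIMSEQ_const_iff)
  then show ?thesis by (simp add: scaleR_conv_of_real mult_ac)
qed

lemma P_eq: "x \<noteq> 0 \<Longrightarrow> P x = (cmod (H x))\<^sup>2 +
    \<epsilon> * ((norm x)\<^sup>2 * (norm (th x - (tN x / of_real ((norm x)\<^sup>2)) *s x))\<^sup>2)"
  unfolding P_def tN_def by (subst lagrange_identity) auto

lemma P_nonneg: "P x \<ge> 0"
proof (cases "x = 0")
  case False
  then show ?thesis using \<epsilon>_pos by (simp add: P_eq)
qed (simp add: P_def tN_def)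

text \<open>The power \<open>\<epsilon> - 1\<close> of \<open>\<bar>x\<bar>\<^sup>2\<close> combines the factor \<open>N ^ \<epsilon>\<close> of the weight with the denominator of
  \<open>G = H / N\<close>. It is the choice that completes the square and leaves the nonnegative function \<open>P\<close>.\<close>

lemma integrand_eq:
  assumes x: "x \<noteq> 0"
    and \<phi>: "\<And>t. t > 0 \<Longrightarrow> \<phi> t = \<psi> t * t powr (\<epsilon> - 1)"
    and \<phi>': "\<And>t. t > 0 \<Longrightarrow> \<phi>' t = \<psi>' t * t powr (\<epsilon> - 1) + \<psi> t * ((\<epsilon> - 1) * t powr (\<epsilon> - 2))"
  shows "integrand \<phi> \<phi>' x = of_real ((norm x)\<^sup>2 powr (\<epsilon> - 2)) *
     (of_real (\<psi> ((norm x)\<^sup>2) * P x) + of_real ((norm x)\<^sup>2 * \<psi>' ((norm x)\<^sup>2)) * (tN x * cnj (H x)))"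
proof -
  define n :: real where "n = (norm x)\<^sup>2"
  have n: "n > 0" using x by (simp add: n_def)
  have pw: "n powr (\<epsilon> - 1) = n * n powr (\<epsilon> - 2)"
    using n by (simp add: powr_diff power2_eq_square)
  have "of_real (P x) = H x * cnj (H x) + of_real \<epsilon> * (of_real n * of_real ((norm (th x))\<^sup>2) - tN x * cnj (tN x))"
    unfolding P_def n_def by (simp only: of_real_add of_real_mult of_real_diff complex_norm_square)
  moreover have "H x = of_real n * ev dv x + of_real \<epsilon> * tN x" by (simp add: H_def n_def)
  moreover define B where "B = cnj (ev dv x) * tN x + of_real (\<epsilon> * (norm (th x))\<^sup>2) + cnj (H x) * ev dv x"
  ultimately have P: "of_real (P x) = of_real (\<epsilon> - 1) * (tN x * cnj (H x)) + of_real n * B"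
    by (simp add: algebra_simps)
  define p where "p = n powr (\<epsilon> - 2)"
  have "integrand \<phi> \<phi>' x = of_real (\<phi>' n) * (tN x * cnj (H x)) + of_real (\<phi> n) * B"
    by (simp add: integrand_def B_def n_def)
  moreover have "\<phi> n = \<psi> n * (n * p)" "\<phi>' n = \<psi>' n * (n * p) + \<psi> n * ((\<epsilon> - 1) * p)"
    by (simp_all only: \<phi>[OF n] \<phi>'[OF n] pw p_def)
  ultimately have "integrand \<phi> \<phi>' x =
      of_real p * (of_real (\<psi> n) * of_real (P x) + of_real (n * \<psi>' n) * (tN x * cnj (H x)))"
    unfolding P by (simp add: algebra_simps)
  then show ?thesis by (simp only: n_def p_def of_real_mult)
qed

end

text \<open>A cutoff that varies slowly on the logarithmic scale.\<close>

definition cutoff :: "real \<Rightarrow> real \<Rightarrow> real" where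
  "cutoff n t = (max 0 (1 - (ln t / n)\<^sup>2))\<^sup>2"

definition cutoff' :: "real \<Rightarrow> real \<Rightarrow> real" where
  "cutoff' n t = 2 * max 0 (1 - (ln t / n)\<^sup>2) * (- (2 * (ln t / n) * (1 / t / n)))"

lemma square_pos_part_has_derivative:
  "((\<lambda>u. (max 0 u)\<^sup>2) has_real_derivative 2 * max 0 u) (at (u::real))"
proof -
  consider "u > 0" | "u < 0" | "u = 0" by linarith
  then show ?thesis
  proof cases
    case 1
    have "((\<lambda>u. u\<^sup>2) has_real_derivative 2 * max 0 u) (at u)"
      using 1 by (auto intro!: derivative_eq_intros)
    then show ?thesis
      by (rule has_field_derivative_transform_within_open[of _ _ _ "{0<..}"]) (use 1 in auto)
  next
    case 2
    have "((\<lambda>u. 0) has_real_derivative 2 * max 0 u) (at u)" using 2 by simp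
    then show ?thesis
      by (rule has_field_derivative_transform_within_open[of _ _ _ "{..<0}"]) (use 2 in auto)
  next
    case 3
    have "((\<lambda>h. ((max 0 (0 + h))\<^sup>2 - (max 0 0)\<^sup>2) / h) \<longlongrightarrow> (0::real)) (at 0)"
    proof (rule Lim_null_comparison)
      show "\<forall>\<^sub>F h in at 0. norm (((max 0 (0 + h))\<^sup>2 - (max 0 0)\<^sup>2) / h) \<le> \<bar>h\<bar>"
        by (intro always_eventually) (auto simp: max_def power2_eq_square abs_mult)
      show "((\<lambda>h::real. \<bar>h\<bar>) \<longlongrightarrow> 0) (at 0)" by (auto intro!: tendsto_eq_intros)
    qed
    then show ?thesis using 3 by (simp add: DERIV_def)
  qed
qed

lemma cutoff_has_derivative:
  assumes "n > 0" "t > 0"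
  shows "(cutoff n has_real_derivative cutoff' n t) (at t)"
proof -
  have "((\<lambda>t. 1 - (ln t / n)\<^sup>2) has_real_derivative - (2 * (ln t / n) * (1 / t / n))) (at t)"
    using assms by (auto intro!: derivative_eq_intros simp: field_simps power2_eq_square)
  from DERIV_chain2[OF square_pos_part_has_derivative this]
  show ?thesis by (simp add: cutoff_def[abs_def] cutoff'_def)
qed

lemma continuous_on_cutoff': "n > 0 \<Longrightarrow> continuous_on {0<..} (cutoff' n)"
  unfolding cutoff'_def by (auto intro!: continuous_intros)

lemma cutoff_nonneg: "cutoff n t \<ge> 0" by (simp add: cutoff_def)

lemma cutoff_eq_0:
  assumes "n > 0" "t > 0" "t < exp (- n) \<or> exp n < t"
  shows "cutoff n t = 0"
proof -
  have "n < \<bar>ln t\<bar>"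
    using assms ln_less_cancel_iff[of t "exp (- n)"] ln_less_cancel_iff[of "exp n" t] by auto
  then have "1 < \<bar>ln t / n\<bar>" using assms by (simp add: field_simps)
  then have "1 < \<bar>ln t / n\<bar>\<^sup>2" by (rule one_less_power) simp
  then have "1 < (ln t / n)\<^sup>2" by (simp only: power2_abs)
  then show ?thesis by (simp add: cutoff_def)
qed

lemma cutoff_ge:
  assumes "n > 0" "exp (- n / 2) \<le> t" "t \<le> exp (n / 2)"
  shows "9 / 16 \<le> cutoff n t"
proof -
  have t: "t > 0" using assms(2) exp_gt_zero less_le_trans by blast
  have "- n / 2 \<le> ln t" "ln t \<le> n / 2"
    using assms t ln_le_cancel_iff[of "exp (- n / 2)" t] ln_le_cancel_iff[of t "exp (n / 2)"] by simp_all
  then have "\<bar>ln t / n\<bar> \<le> 1 / 2" using assms by (auto simp: field_simps abs_le_iff)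
  then have "\<bar>ln t / n\<bar>\<^sup>2 \<le> (1 / 2)\<^sup>2" by (rule power_mono) simp
  then have "(ln t / n)\<^sup>2 \<le> (1 / 2)\<^sup>2" by (simp only: power2_abs)
  then have "(ln t / n)\<^sup>2 \<le> 1 / 4" by (simp add: power2_eq_square)
  then have "3 / 4 \<le> max 0 (1 - (ln t / n)\<^sup>2)" by linarith
  then have "(3 / 4)\<^sup>2 \<le> cutoff n t" unfolding cutoff_def by (rule power_mono) simp
  then show ?thesis by (simp add: power2_eq_square)
qed

lemma cutoff'_bound:
  assumes "n > 0" "exp (- n) \<le> t" "t \<le> exp n"
  shows "\<bar>t * cutoff' n t\<bar> \<le> 4 / n"
proof -
  have t: "t > 0" using assms(2) exp_gt_zero less_le_trans by blast
  have "- n \<le> ln t" "ln t \<le> n"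
    using assms t ln_le_cancel_iff[of "exp (- n)" t] ln_le_cancel_iff[of t "exp n"] by simp_all
  then have 1: "\<bar>ln t / n\<bar> \<le> 1" using assms by (auto simp: field_simps abs_le_iff)
  have "\<bar>t * cutoff' n t\<bar> = max 0 (1 - (ln t / n)\<^sup>2) * \<bar>ln t / n\<bar> * (4 / n)"
    using t assms(1) by (simp add: cutoff'_def abs_mult field_simps)
  also have "\<dots> \<le> 1 * 1 * (4 / n)"
    using 1 assms(1) by (intro mult_mono) auto
  finally show ?thesis by simp
qed

context syzygy
begin

definition Q :: "complex ^ 3 \<Rightarrow> real" where
  "Q x = w x * (norm x)\<^sup>2 powr (\<epsilon> - 2) * P x"

definition R :: "complex ^ 3 \<Rightarrow> real" where
  "R x = w x * (norm x)\<^sup>2 powr (\<epsilon> - 2) * (cmod (tN x) * cmod (H x))"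

lemma continuous_norm_powr [continuous_intros]:
  assumes "0 < A" shows "continuous_on (shell A B) (\<lambda>x. (norm x)\<^sup>2 powr e)"
  using assms by (auto intro!: continuous_intros simp: shell_def)

lemma Q_nonneg: "Q x \<ge> 0" using w_nonneg P_nonneg by (simp add: Q_def)
lemma R_nonneg: "R x \<ge> 0" using w_nonneg by (simp add: R_def)

lemma integrable_R: "0 < A \<Longrightarrow> integrable lborel (\<lambda>x. indicator (shell A B) x *\<^sub>R R x)"
  using integrable_weighted[of A B "\<lambda>x. (norm x)\<^sup>2 powr (\<epsilon> - 2) * (cmod (tN x) * cmod (H x))"]
  by (simp add: R_def mult.assoc continuous_intros)

text \<open>The cutoff is differentiated once, and this costs a factor \<open>4 / n\<close> that makes up for the \<open>2 n\<close> annuli on which it lives.\<close>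

lemma cutoff_inequality:
  assumes n: "n > 0"
  shows "integrable lborel (\<lambda>x. indicator (shell (exp (- n)) (exp n)) x *\<^sub>R (cutoff n ((norm x)\<^sup>2) * Q x))"
    and "(LINT x|lborel. indicator (shell (exp (- n)) (exp n)) x *\<^sub>R (cutoff n ((norm x)\<^sup>2) * Q x)) \<le>
      4 / n * (LINT x|lborel. indicator (shell (exp (- n)) (exp n)) x *\<^sub>R R x)"
proof -
  let ?C = "shell (exp (- n)) (exp n)"
  have A: "0 < exp (- n)" by simp
  have sub: "?C \<subseteq> - {0}" using A by (auto simp: shell_def not_le)
  have c: "continuous_on ?C (\<lambda>x. g ((norm x)\<^sup>2))" if "continuous_on {0<..} g" for g :: "real \<Rightarrow> real"
    using sub by (intro continuous_intros continuous_on_compose2[OF that]) auto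
  have cc: "continuous_on {0<..} (cutoff n)"
    using cutoff_has_derivative[OF n] by (intro DERIV_continuous_on) (auto intro: has_field_derivative_at_within)
  have "continuous_on ?C (\<lambda>x. (norm x)\<^sup>2 powr (\<epsilon> - 2) * (cutoff n ((norm x)\<^sup>2) * P x))"
    by (intro continuous_intros c cc A)
  from integrable_weighted[OF A this]
  show I: "integrable lborel (\<lambda>x. indicator ?C x *\<^sub>R (cutoff n ((norm x)\<^sup>2) * Q x))"
    by (simp add: Q_def mult_ac)
  define J where "J x = of_real ((norm x)\<^sup>2 powr (\<epsilon> - 2) * ((norm x)\<^sup>2 * cutoff' n ((norm x)\<^sup>2))) * (tN x * cnj (H x))" for x
  have "continuous_on ?C J" unfolding J_def
    by (intro continuous_intros c continuous_on_cutoff' n A)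
  from integrable_weighted[OF A this]
  have J: "integrable lborel (\<lambda>x. indicator ?C x *\<^sub>R (w x *\<^sub>R J x))" .
  define \<phi> where "\<phi> t = cutoff n t * t powr (\<epsilon> - 1)" for t
  define \<phi>' where "\<phi>' t = cutoff' n t * t powr (\<epsilon> - 1) + cutoff n t * ((\<epsilon> - 1) * t powr (\<epsilon> - 2))" for t
  have "(LINT x|lborel. indicator ?C x *\<^sub>R (w x *\<^sub>R integrand \<phi> \<phi>' x)) = 0"
  proof (rule weighted_identity[OF A])
    show "(\<phi> has_real_derivative \<phi>' t) (at t)" if "t > 0" for t
    proof -
      have "((\<lambda>t. t powr (\<epsilon> - 1)) has_real_derivative (\<epsilon> - 1) * t powr (\<epsilon> - 1 - 1)) (at t)"
        using that by (rule has_real_derivative_powr)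
      from DERIV_mult[OF cutoff_has_derivative[OF n that] this]
      show ?thesis by (simp add: \<phi>_def[abs_def] \<phi>'_def mult_ac add.commute)
    qed
    show "continuous_on {0<..} \<phi>'" unfolding \<phi>'_def
      by (auto intro!: continuous_intros continuous_on_cutoff' n cc)
    show "\<phi> t = 0" if "0 \<le> t" "t < exp (- n) \<or> exp n < t" for t
      using that cutoff_eq_0[OF n, of t] by (cases "t = 0") (auto simp: \<phi>_def)
  qed
  moreover have "indicator ?C x *\<^sub>R (w x *\<^sub>R integrand \<phi> \<phi>' x) =
      of_real (indicator ?C x *\<^sub>R (cutoff n ((norm x)\<^sup>2) * Q x)) + indicator ?C x *\<^sub>R (w x *\<^sub>R J x)" for x
  proof (cases "x \<in> ?C")
    case True
    then have "x \<noteq> 0" using sub by auto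
    then have "integrand \<phi> \<phi>' x = of_real ((norm x)\<^sup>2 powr (\<epsilon> - 2)) *
     (of_real (cutoff n ((norm x)\<^sup>2) * P x) + of_real ((norm x)\<^sup>2 * cutoff' n ((norm x)\<^sup>2)) * (tN x * cnj (H x)))"
      by (rule integrand_eq) (simp_all add: \<phi>_def \<phi>'_def)
    then show ?thesis using True by (simp add: J_def Q_def scaleR_conv_of_real algebra_simps)
  qed simp
  ultimately have "(LINT x|lborel. complex_of_real (indicator ?C x *\<^sub>R (cutoff n ((norm x)\<^sup>2) * Q x)) + indicator ?C x *\<^sub>R (w x *\<^sub>R J x)) = 0"
    by simp
  then have "(LINT x|lborel. complex_of_real (indicator ?C x *\<^sub>R (cutoff n ((norm x)\<^sup>2) * Q x))) =
     - (LINT x|lborel. indicator ?C x *\<^sub>R (w x *\<^sub>R J x))"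
    unfolding Bochner_Integration.integral_add[OF integrable_of_real[OF I] J]
    by (simp only: eq_neg_iff_add_eq_0)
  then have "complex_of_real (LINT x|lborel. indicator ?C x *\<^sub>R (cutoff n ((norm x)\<^sup>2) * Q x)) =
     - (LINT x|lborel. indicator ?C x *\<^sub>R (w x *\<^sub>R J x))"
    by (subst (asm) integral_complex_of_real)
  then have "(LINT x|lborel. indicator ?C x *\<^sub>R (cutoff n ((norm x)\<^sup>2) * Q x)) \<le>
     norm (LINT x|lborel. indicator ?C x *\<^sub>R (w x *\<^sub>R J x))"
  proof -
    have le: "a \<le> norm z" if "complex_of_real a = - z" for a z
    proof -
      have "\<bar>a\<bar> = norm z" using arg_cong[OF that, of norm] by simp
      then show ?thesis by simp
    qed
    show ?thesis by (rule le) fact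
  qed
  also have "\<dots> \<le> (LINT x|lborel. norm (indicator ?C x *\<^sub>R (w x *\<^sub>R J x)))"
    by (rule integral_norm_bound)
  also have "\<dots> \<le> (LINT x|lborel. 4 / n * (indicator ?C x *\<^sub>R R x))"
  proof (rule integral_mono[OF integrable_norm[OF J]])
    show "integrable lborel (\<lambda>x. 4 / n * (indicator ?C x *\<^sub>R R x))"
      by (intro integrable_mult_right integrable_R A)
    show "norm (indicator ?C x *\<^sub>R (w x *\<^sub>R J x)) \<le> 4 / n * (indicator ?C x *\<^sub>R R x)" for x
    proof (cases "x \<in> ?C")
      case True
      then have "\<bar>(norm x)\<^sup>2 * cutoff' n ((norm x)\<^sup>2)\<bar> \<le> 4 / n"
        by (intro cutoff'_bound n) (auto simp: shell_def)
      from mult_right_mono[OF this R_nonneg[of x]]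
      show ?thesis using True w_nonneg[of x]
        by (simp add: J_def R_def norm_mult norm_power abs_mult mult_ac)
    qed simp
  qed
  finally show "(LINT x|lborel. indicator ?C x *\<^sub>R (cutoff n ((norm x)\<^sup>2) * Q x)) \<le>
      4 / n * (LINT x|lborel. indicator ?C x *\<^sub>R R x)"
    by simp
qed

end

lemma AE_zero_imp_zero_on_open:
  fixes g :: "'a::euclidean_space \<Rightarrow> 'b::real_normed_vector"
  assumes ae: "AE x in lborel. x \<in> S \<longrightarrow> g x = 0" and S: "open S" and g: "continuous_on S g" and x: "x \<in> S"
  shows "g x = 0"
proof (rule ccontr)
  assume "g x \<noteq> 0"
  define T where "T = S \<inter> g -` (- {0})"
  have "open T" unfolding T_def by (intro continuous_open_preimage g S) auto
  moreover have "x \<in> T" using \<open>g x \<noteq> 0\<close> x by (simp add: T_def)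
  ultimately have "\<not> negligible T" using open_not_negligible by blast
  moreover have "AE x in lebesgue. x \<notin> T"
    using ae by (rule AE_completion[THEN eventually_mono]) (auto simp: T_def)
  then have "negligible T"
    unfolding negligible_iff_null_sets by (subst AE_iff_null_sets) (use \<open>open T\<close> in auto)
  ultimately show False by blast
qed

lemma scaleR_vscale: "c *\<^sub>R x = complex_of_real c *s x" for x :: "complex ^ 3"
  unfolding vec_eq_iff by (simp, simp only: scaleR_conv_of_real, simp)

context syzygy
begin

lemma th_scale: "c > 0 \<Longrightarrow> th (c *\<^sub>R x) = of_real (c ^ r) *s th x"
  using tpoly_eval_homogeneous[OF \<theta>_hom, of _ "of_real c"]
  by (simp add: vec_eq_iff th_def scaleR_vscale)

lemma dv_scale: "c > 0 \<Longrightarrow> of_real c * ev dv (c *\<^sub>R x) = of_real (c ^ r) * ev dv x"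
proof (cases r)
  case 0
  have "ev (tpoly_pderiv i (\<theta> $ i)) x = 0" for i x
    unfolding tpoly_eval_pderiv using \<theta>_hom[of i] 0 by (intro sum.neutral) (auto simp: homogeneous_piece_def)
  then show ?thesis by (simp add: dv_def)
next
  case (Suc k)
  have "dv \<in> homogeneous_piece k" unfolding dv_def
    using \<theta>_hom Suc by (intro homogeneous_piece_sum tpoly_pderiv_homogeneous) auto
  then have "ev dv (of_real c *s x) = of_real c ^ k * ev dv x" by (rule tpoly_eval_homogeneous)
  then show ?thesis by (simp add: Suc scaleR_vscale)
qed

lemma tN_scale: "c > 0 \<Longrightarrow> tN (c *\<^sub>R x) = of_real (c ^ (r + 1)) * tN x"
proof -
  assume c: "c > 0"
  have "vcnj (c *\<^sub>R x) = of_real c *s vcnj x" by (simp add: scaleR_vscale)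
  then show ?thesis using c by (simp add: tN_def th_scale)
qed

lemma H_scale: "c > 0 \<Longrightarrow> H (c *\<^sub>R x) = of_real (c ^ (r + 1)) * H x"
  using dv_scale[of c x] by (simp add: H_def tN_scale power_mult_distrib power2_eq_square algebra_simps)

lemma P_scale: "c > 0 \<Longrightarrow> P (c *\<^sub>R x) = c ^ (2 * r + 2) * P x"
proof -
  assume c: "c > 0"
  have "norm (th (c *\<^sub>R x)) = c ^ r * norm (th x)"
  proof -
    have "th (c *\<^sub>R x) = (c ^ r) *\<^sub>R th x"
      using th_scale[OF c] by (simp add: scaleR_vscale)
    then show ?thesis using c by simp
  qed
  then show ?thesis using c
    by (simp add: P_def H_scale tN_scale norm_mult norm_power power_mult_distrib power_add power_mult power2_eq_square algebra_simps)
qed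

lemma w_scale: "c > 0 \<Longrightarrow> w (c *\<^sub>R x) * (norm (c *\<^sub>R x))\<^sup>2 powr (\<epsilon> - 2) = c powr (- 2 * real r - 8) * (w x * (norm x)\<^sup>2 powr (\<epsilon> - 2))"
proof -
  assume c: "c > 0"
  have "ev f (of_real c *s x) = of_real c ^ d * ev f x" by (rule tpoly_eval_homogeneous[OF f_hom])
  then have "cmod (ev f (c *\<^sub>R x)) = c ^ d * cmod (ev f x)"
    using c by (simp add: scaleR_vscale norm_mult norm_power)
  then have "w (c *\<^sub>R x) = ((c ^ d)\<^sup>2) powr (- s) * w x"
    by (simp add: w_def power_mult_distrib powr_mult)
  also have "(c ^ d)\<^sup>2 = c powr (2 * d)" using c by (simp add: powr_realpow power_mult mult.commute flip: power_mult of_nat_mult)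
  finally have "w (c *\<^sub>R x) = c powr (- 2 * real d * s) * w x" by (simp add: powr_powr)
  moreover have "(norm (c *\<^sub>R x))\<^sup>2 powr (\<epsilon> - 2) = c powr (2 * \<epsilon> - 4) * (norm x)\<^sup>2 powr (\<epsilon> - 2)"
  proof -
    have "(norm (c *\<^sub>R x))\<^sup>2 = c powr 2 * (norm x)\<^sup>2" using c by (simp add: power_mult_distrib)
    then have "(norm (c *\<^sub>R x))\<^sup>2 powr (\<epsilon> - 2) = c powr (2 * (\<epsilon> - 2)) * (norm x)\<^sup>2 powr (\<epsilon> - 2)"
      by (simp only: powr_mult powr_powr zero_le_power2 powr_ge_zero)
    moreover have "2 * (\<epsilon> - 2) = 2 * \<epsilon> - 4" by simp
    ultimately show ?thesis by (simp only:)
  qed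
  moreover have "c powr (- 2 * real d * s) * c powr (2 * \<epsilon> - 4) = c powr (- 2 * real r - 8)"
  proof -
    have "- 2 * real d * s + (2 * \<epsilon> - 4) = - 2 * real r - 8" by (simp add: \<epsilon>_def algebra_simps)
    then show ?thesis by (simp only: powr_add[symmetric])
  qed
  ultimately show ?thesis by simp
qed

lemma QR_scale:
  assumes "c > 0"
  shows "Q (c *\<^sub>R x) = Q x / c ^ 6" "R (c *\<^sub>R x) = R x / c ^ 6"
proof -
  have e: "c powr (- 2 * real r - 8) * c ^ (2 * r + 2) = 1 / c ^ 6"
  proof -
    have "c powr (- 2 * real r - 8) * c powr (real (2 * r + 2)) = c powr (- 6)" by (simp flip: powr_add)
    moreover have "c powr (real (2 * r + 2)) = c ^ (2 * r + 2)"
      by (rule powr_realpow[OF assms])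
    moreover have "c powr (- 6) = 1 / c ^ 6" using assms by (simp add: powr_minus divide_inverse)
    ultimately show ?thesis by (simp only:)
  qed
  have "Q (c *\<^sub>R x) = (c powr (- 2 * real r - 8) * c ^ (2 * r + 2)) * Q x"
    unfolding Q_def w_scale[OF assms] P_scale[OF assms] by (simp add: mult_ac)
  then show "Q (c *\<^sub>R x) = Q x / c ^ 6" unfolding e by simp
  have "cmod (tN (c *\<^sub>R x)) * cmod (H (c *\<^sub>R x)) = c ^ (2 * r + 2) * (cmod (tN x) * cmod (H x))"
    using assms by (simp add: tN_scale H_scale norm_mult norm_power power_add power_mult power2_eq_square algebra_simps)
  then have "R (c *\<^sub>R x) = (c powr (- 2 * real r - 8) * c ^ (2 * r + 2)) * R x"
    unfolding R_def w_scale[OF assms] by (simp add: mult_ac)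
  then show "R (c *\<^sub>R x) = R x / c ^ 6" unfolding e by simp
qed

lemma QR_measurable [measurable]: "Q \<in> borel_measurable borel" "R \<in> borel_measurable borel"
proof -
  have [measurable]: "P \<in> borel_measurable borel" "tN \<in> borel_measurable borel" "H \<in> borel_measurable borel"
    by (intro borel_measurable_continuous_onI continuous_intros)+
  show "Q \<in> borel_measurable borel" "R \<in> borel_measurable borel" unfolding Q_def R_def by measurable
qed

text \<open>On \<open>2 k\<close> annuli the cutoff is at least \<open>9 / 16\<close>, so the left hand side of the cutoff inequality grows linearly
  in \<open>k\<close>, whereas the right hand side is bounded: \<open>4 / n\<close> times about \<open>2 n\<close> equal contributions.\<close>

lemma Q_AE_0: "AE x in lborel. x \<in> annulus 0 1 \<longrightarrow> Q x = 0"
proof -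
  \<comment> \<open>Contributions of one annulus to the two sides.\<close>
  define q where "q = (\<integral>\<^sup>+x\<in>annulus 0 1. ennreal (Q x) \<partial>lborel)"
  define \<rho> where "\<rho> = (\<integral>\<^sup>+x\<in>annulus 0 1. ennreal (R x) \<partial>lborel)"
  have "\<rho> \<le> (\<integral>\<^sup>+x. ennreal (indicator (shell 1 (exp 1)) x *\<^sub>R R x) \<partial>lborel)"
    unfolding \<rho>_def by (intro nn_integral_mono) (auto simp: annulus_def shell_def indicator_def)
  also have "\<dots> < \<infinity>"
    using integrable_R[of 1 "exp 1"] R_nonneg by (simp add: nn_integral_eq_integral)
  finally obtain \<rho>' where \<rho>': "\<rho> = ennreal \<rho>'" "\<rho>' \<ge> 0" by (cases \<rho>) auto
  have main: "of_nat k * q \<le> ennreal (10 * \<rho>')" if k: "k \<ge> 1" for k :: nat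
  proof -
    let ?n = "real (2 * k)"
    have n: "?n > 0" using k by simp
    let ?C = "shell (exp (- ?n)) (exp ?n)"
    have "ennreal (9 / 16) * (of_nat (2 * k) * q) = ennreal (9/16) * (\<integral>\<^sup>+x\<in>annulus (- real k) (- real k + real (2 * k)). ennreal (Q x) \<partial>lborel)"
      unfolding q_def by (subst nn_integral_annulus) (auto simp: QR_scale)
    also have "\<dots> = (\<integral>\<^sup>+x\<in>annulus (- real k) (- real k + real (2 * k)). ennreal (9/16 * Q x) \<partial>lborel)"
      by (subst nn_integral_cmult[symmetric]) (simp_all add: ennreal_mult' mult.assoc del: times_divide_eq_left)
    also have "\<dots> \<le> (\<integral>\<^sup>+x. ennreal (indicator ?C x *\<^sub>R (cutoff ?n ((norm x)\<^sup>2) * Q x)) \<partial>lborel)"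
    proof (rule nn_integral_mono)
      fix x
      show "ennreal (9/16 * Q x) * indicator (annulus (- real k) (- real k + real (2 * k))) x \<le>
         ennreal (indicator ?C x *\<^sub>R (cutoff ?n ((norm x)\<^sup>2) * Q x))"
      proof (cases "x \<in> annulus (- real k) (- real k + real (2 * k))")
        case True
        then have h: "exp (- real k) \<le> (norm x)\<^sup>2" "(norm x)\<^sup>2 \<le> exp (real k)" by (auto simp: annulus_def)
        have "exp (- ?n) \<le> exp (- real k)" "exp (real k) \<le> exp ?n" by auto
        from order_trans[OF this(1) h(1)] order_trans[OF h(2) this(2)] have "x \<in> ?C" by (simp add: shell_def)
        moreover have "9 / 16 \<le> cutoff ?n ((norm x)\<^sup>2)"
          using h n by (intro cutoff_ge) auto
        from mult_right_mono[OF this Q_nonneg[of x]]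
        have "ennreal (9 / 16 * Q x) \<le> ennreal (cutoff ?n ((norm x)\<^sup>2) * Q x)" by (rule ennreal_leI)
        ultimately show ?thesis using True by simp
      qed simp
    qed
    also have "\<dots> = ennreal (LINT x|lborel. indicator ?C x *\<^sub>R (cutoff ?n ((norm x)\<^sup>2) * Q x))"
      using cutoff_inequality(1)[OF n] Q_nonneg cutoff_nonneg by (intro nn_integral_eq_integral) auto
    also have "\<dots> \<le> ennreal (4 / ?n * (LINT x|lborel. indicator ?C x *\<^sub>R R x))"
      by (rule ennreal_leI[OF cutoff_inequality(2)[OF n]])
    also have "\<dots> = ennreal (4 / ?n) * (\<integral>\<^sup>+x. ennreal (indicator ?C x *\<^sub>R R x) \<partial>lborel)"
    proof -
      have "(\<integral>\<^sup>+x. ennreal (indicator ?C x *\<^sub>R R x) \<partial>lborel) = ennreal (LINT x|lborel. indicator ?C x *\<^sub>R R x)"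
        using R_nonneg by (intro nn_integral_eq_integral integrable_R) auto
      moreover have "0 \<le> 4 / ?n" by simp
      ultimately show ?thesis by (simp only: ennreal_mult')
    qed
    also have "\<dots> \<le> ennreal (4 / ?n) * (\<integral>\<^sup>+x\<in>annulus (- ?n) (- ?n + real (4 * k + 1)). ennreal (R x) \<partial>lborel)"
    proof (intro mult_left_mono nn_integral_mono)
      fix x
      have "exp ?n < exp (- ?n + real (4 * k + 1))" by simp
      from le_less_trans[OF _ this]
      have "x \<in> ?C \<Longrightarrow> x \<in> annulus (- ?n) (- ?n + real (4 * k + 1))" unfolding shell_def annulus_def by blast
      then show "ennreal (indicator ?C x *\<^sub>R R x) \<le> ennreal (R x) * indicator (annulus (- ?n) (- ?n + real (4 * k + 1))) x"
        by (cases "x \<in> ?C") auto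
    qed simp
    also have "\<dots> = ennreal (4 / ?n) * (of_nat (4 * k + 1) * \<rho>)"
      unfolding \<rho>_def by (subst nn_integral_annulus) (auto simp: QR_scale)
    also have "\<dots> = ennreal (4 / ?n * real (4 * k + 1) * \<rho>')"
    proof -
      have "0 \<le> 4 / ?n" "0 \<le> real (4 * k + 1)" by simp_all
      then show ?thesis unfolding \<rho>'(1) ennreal_of_nat_eq_real_of_nat
        by (simp only: ennreal_mult' mult.assoc)
    qed
    also have "\<dots> \<le> ennreal (10 * \<rho>')"
      using k \<rho>' by (intro ennreal_leI mult_right_mono) (auto simp: field_simps)
    finally have "ennreal (9 / 16) * (of_nat (2 * k) * q) \<le> ennreal (10 * \<rho>')" .
    moreover have "ennreal (9 / 16) * (of_nat (2 * k) * q) = ennreal (9 / 8) * (of_nat k * q)"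
      by (simp add: ennreal_of_nat_eq_real_of_nat flip: ennreal_mult' mult.assoc) 
    moreover have "of_nat k * q \<le> ennreal (9 / 8) * (of_nat k * q)"
      using mult_right_mono[of 1 "ennreal (9/8)" "of_nat k * q"] by simp
    ultimately show ?thesis by simp
  qed
  have "q \<le> ennreal (10 * \<rho>')" using main[of 1] by simp
  then obtain q' where q': "q = ennreal q'" "q' \<ge> 0" by (cases q) (auto simp: top_unique)
  have "real k * q' \<le> 10 * \<rho>'" for k
  proof (cases "k = 0")
    case False
    then have "ennreal (real k * q') \<le> ennreal (10 * \<rho>')"
      using main[of k] q' by (simp add: ennreal_mult' ennreal_of_nat_eq_real_of_nat)
    then show ?thesis using \<rho>'(2) by (simp add: ennreal_le_iff)
  qed (use \<rho>' in auto)
  then have "q' \<le> 0" using reals_Archimedean3[of q'] by (metis linorder_not_less)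
  then have "q = 0" using q' by simp
  then have "AE x in lborel. ennreal (Q x) * indicator (annulus 0 1) x = 0"
    unfolding q_def by (subst (asm) nn_integral_0_iff_AE) auto
  then show ?thesis by eventually_elim (use Q_nonneg in \<open>auto simp: ennreal_eq_0_iff order_antisym\<close>)
qed

text \<open>Where \<open>Q\<close> vanishes, \<open>\<theta> = c x\<close> pointwise, and then \<open>0 = \<theta> f = c d f\<close> by Euler's identity.\<close>

theorem \<theta>_eq_0: "\<theta> = 0"
proof -
  have "AE x in lborel. x \<in> annulus 0 1 \<longrightarrow> th x = 0"
    using Q_AE_0 f_AE
  proof eventually_elim
    case (elim x)
    show ?case
    proof
      assume x: "x \<in> annulus 0 1"
      then have x0: "x \<noteq> 0" by (auto simp: annulus_def)
      then have "P x = 0" using elim x by (simp add: Q_def w_def)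
      define c where "c = tN x / of_real ((norm x)\<^sup>2)"
      have "\<epsilon> * ((norm x)\<^sup>2 * (norm (th x - c *s x))\<^sup>2) = 0"
        using \<open>P x = 0\<close> \<epsilon>_pos x0 by (simp add: P_eq c_def add_nonneg_eq_0_iff)
      then have thx: "th x = c *s x" using \<epsilon>_pos x0 by simp
      have "of_nat d * c * ev f x = cdot (tgrad f x) (th x)"
        by (simp add: thx tpoly_euler[OF f_hom])
      then have "c = 0" using elim d by (simp add: cdot_tgrad_th)
      then show "th x = 0" using thx by simp
    qed
  qed
  then have ae: "AE x in lborel. x \<in> {x. 1 < (norm x)\<^sup>2 \<and> (norm x)\<^sup>2 < exp 1} \<longrightarrow> th x = 0"
    by eventually_elim (auto simp: annulus_def)
  have op: "open {x::complex^3. 1 < (norm x)\<^sup>2 \<and> (norm x)\<^sup>2 < exp 1}"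
    by (intro open_Collect_conj open_Collect_less continuous_intros)
  have z: "th x = 0" if "1 < (norm x)\<^sup>2" "(norm x)\<^sup>2 < exp 1" for x
    using AE_zero_imp_zero_on_open[OF ae op continuous_th] that by simp
  have e2: "2 < exp (1::real)" 
  proof -
    have "(1 + 1 / 2)\<^sup>2 \<le> (exp (1 / 2 :: real))\<^sup>2" by (intro power_mono exp_ge_add_one_self) simp
    moreover have "(exp (1 / 2 :: real))\<^sup>2 = exp 1" by (simp add: power2_eq_square flip: exp_add)
    ultimately show ?thesis by (simp add: power2_eq_square)
  qed
  have th0: "th x = 0" if "x \<noteq> 0" for x
  proof -
    define c where "c = sqrt 2 / norm x"
    have c: "c > 0" using that by (simp add: c_def)
    have "(norm (c *\<^sub>R x))\<^sup>2 = 2" using that by (simp add: c_def)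
    then have "th (c *\<^sub>R x) = 0" using z e2 by simp
    then show ?thesis using th_scale[OF c, of x] c by simp
  qed
  have "ev (\<theta> $ i) x = 0" for i x
  proof (cases "x = 0")
    case False
    then show ?thesis using th0[of x] by (simp add: th_def vec_eq_iff)
  next
    case True
    have "th (axis 1 1) = 0" by (rule th0) (simp add: axis_eq_0_iff)
    then have "ev (\<theta> $ i) (axis 1 1) = 0" by (simp add: th_def vec_eq_iff)
    then show ?thesis using tpoly_eval_homogeneous[OF \<theta>_hom, of i 0 "axis 1 1"] True by simp
  qed
  then have "\<theta> $ i = 0" for i by (rule tpoly_eval_eq_0D)
  then show ?thesis by (simp add: vec_eq_iff)
qed

end

section \<open>Integrals over \<open>\<complex>\<^sup>3\<close> by averaging over complex lines\<close>

lemma vec_scale_measurable [measurable]: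
  "(\<lambda>(t, x). x + t *s (e :: complex ^ 3)) \<in> borel_measurable (lborel \<Otimes>\<^sub>M lborel)"
proof -
  have "continuous_on UNIV (\<lambda>z. snd z + fst z *s e)"
    by (intro continuous_intros)
  then have "(\<lambda>z::complex \<times> (complex ^ 3). snd z + fst z *s e) \<in> borel_measurable borel"
    by (rule borel_measurable_continuous_onI)
  moreover have "sets (lborel \<Otimes>\<^sub>M lborel) = sets (borel \<Otimes>\<^sub>M borel :: (complex \<times> (complex ^ 3)) measure)"
    by (rule sets_pair_measure_cong) simp_all
  then have "sets (lborel \<Otimes>\<^sub>M lborel) = sets (borel :: (complex \<times> (complex ^ 3)) measure)"
    unfolding borel_prod .
  ultimately show ?thesis by (simp add: case_prod_beta cong: measurable_cong_sets)
qed

text \<open>Every translate of \<open>w\<close> has the same integral. Averaging over the translates by \<open>t e\<close> with \<open>t\<close> in a disc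
  reduces estimates of the integral to estimates along the complex lines in direction \<open>e\<close>, without a change of
  coordinates.\<close>

lemma nn_integral_average_translates:
  fixes w :: "complex ^ 3 \<Rightarrow> ennreal"
  assumes [measurable]: "w \<in> borel_measurable borel" "D \<in> sets borel"
  shows "emeasure lborel D * (\<integral>\<^sup>+x. w x \<partial>lborel) =
     (\<integral>\<^sup>+x. (\<integral>\<^sup>+t\<in>D. w (x + t *s e) \<partial>lborel) \<partial>lborel)"
proof -
  have m: "(\<lambda>(t, x). w (x + t *s e) * indicator D t) \<in> borel_measurable (lborel \<Otimes>\<^sub>M lborel)"
  proof -
    have "(\<lambda>z. w ((\<lambda>(t, x). x + t *s e) z) * indicator D (fst z)) \<in> borel_measurable (lborel \<Otimes>\<^sub>M lborel)"
      by (rule borel_measurable_times_ennreal[OF measurable_compose[OF vec_scale_measurable assms(1)]]) measurable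
    then show ?thesis by (simp add: case_prod_beta)
  qed
  have "(\<integral>\<^sup>+x. (\<integral>\<^sup>+t. w (x + t *s e) * indicator D t \<partial>lborel) \<partial>lborel) =
     (\<integral>\<^sup>+t. (\<integral>\<^sup>+x. w (x + t *s e) * indicator D t \<partial>lborel) \<partial>lborel)"
    using lborel_pair.Fubini[OF m] by simp
  also have "\<dots> = (\<integral>\<^sup>+t. (\<integral>\<^sup>+x. w x \<partial>lborel) * indicator D t \<partial>lborel)"
  proof (rule nn_integral_cong)
    fix t :: complex
    have "(\<integral>\<^sup>+x. w x \<partial>lborel) = (\<integral>\<^sup>+x. w x \<partial>distr lborel borel ((+) (t *s e)))"
      by (simp add: lborel_distr_plus)
    also have "\<dots> = (\<integral>\<^sup>+x. w (x + t *s e) \<partial>lborel)"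
      by (simp add: nn_integral_distr add.commute)
    finally show "(\<integral>\<^sup>+x. w (x + t *s e) * indicator D t \<partial>lborel) = (\<integral>\<^sup>+x. w x \<partial>lborel) * indicator D t"
      by (simp add: indicator_def)
  qed
  also have "\<dots> = emeasure lborel D * (\<integral>\<^sup>+x. w x \<partial>lborel)"
    by (simp add: nn_integral_cmult_indicator mult.commute[of "emeasure lborel D"])
  finally show ?thesis by simp
qed

lemma emeasure_disc: "0 < emeasure lborel (cball (0::complex) 1)" "emeasure lborel (cball (0::complex) 1) < \<infinity>"
  by (simp_all add: emeasure_cball unit_ball_vol_pos)

lemma exists_dyadic:
  assumes "0 < t" "t < (1::real)"
  obtains k where "(1/2) ^ Suc k \<le> t" "t < (1/2) ^ k"
proof -
  obtain n where "(1/2) ^ n < t" using real_arch_pow_inv[of t "1/2"] assms by auto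
  then have ex: "(1/2) ^ n \<le> t" by simp
  define m where "m = (LEAST n. (1/2) ^ n \<le> t)"
  have m: "(1/2) ^ m \<le> t" unfolding m_def by (rule LeastI[of _ n]) (rule ex)
  then have "m \<noteq> 0" using assms by (cases m) auto
  then obtain k where k: "m = Suc k" by (cases m) auto
  have "\<not> (1/2) ^ k \<le> t" using not_less_Least[of k "\<lambda>n. (1/2) ^ n \<le> t"] k by (simp add: m_def)
  then show thesis using m k by (intro that[of k]) auto
qed

text \<open>Summation over dyadic annuli: the one of radius \<open>2 ^ (- k)\<close> contributes a multiple of \<open>4 ^ (k (a - 1))\<close>.\<close>

lemma nn_integral_disc_powr:
  assumes a: "0 \<le> a" "a < 1"
  shows "(\<integral>\<^sup>+t\<in>ball 0 1. ennreal (cmod t powr (- 2 * a)) \<partial>lborel) < \<infinity>"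
proof -
  define V where "V = unit_ball_vol (real DIM(complex))"
  define T where "T k t = ennreal (((1/2) ^ Suc k) powr (- 2 * a)) * indicator (ball 0 ((1/2) ^ k)) t" for k and t :: complex
  have "ennreal (cmod t powr (- 2 * a)) * indicator (ball 0 1) t \<le> suminf (\<lambda>k. T k t)" for t
  proof (cases "t \<noteq> 0 \<and> cmod t < 1")
    case True
    then obtain k where k: "(1/2) ^ Suc k \<le> cmod t" "cmod t < (1/2) ^ k" using exists_dyadic[of "cmod t"] by auto
    have "cmod t powr (- 2 * a) \<le> ((1/2) ^ Suc k) powr (- 2 * a)"
      using k a by (intro powr_mono2') auto
    then have "ennreal (cmod t powr (- 2 * a)) * indicator (ball 0 1) t \<le> T k t"
      using True k by (simp add: T_def ennreal_leI)
    also have "\<dots> = (\<Sum>j\<in>{k}. T j t)" by simp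
    also have "\<dots> \<le> suminf (\<lambda>k. T k t)" by (rule sum_le_suminf) auto
    finally show ?thesis .
  qed (auto simp: indicator_def)
  then have "(\<integral>\<^sup>+t\<in>ball 0 1. ennreal (cmod t powr (- 2 * a)) \<partial>lborel) \<le> (\<integral>\<^sup>+t. suminf (\<lambda>k. T k t) \<partial>lborel)"
    by (rule nn_integral_mono)
  also have "\<dots> = suminf (\<lambda>k. \<integral>\<^sup>+t. T k t \<partial>lborel)" 
  proof (rule nn_integral_suminf)
    fix k
    have "ball 0 ((1/2) ^ k) \<in> sets (lborel :: complex measure)" by simp
    then show "T k \<in> borel_measurable lborel" unfolding T_def[abs_def]
      by (intro borel_measurable_times_ennreal borel_measurable_const borel_measurable_indicator)
  qed
  also have "\<dots> = suminf (\<lambda>k. ennreal ((4 powr a * V) * (4 powr (a - 1)) ^ k))"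
  proof (intro suminf_cong)
    fix k
    have "(\<integral>\<^sup>+t. T k t \<partial>lborel) = ennreal (((1/2) ^ Suc k) powr (- 2 * a)) * ennreal (V * ((1/2) ^ k)\<^sup>2)"
      unfolding T_def by (simp add: nn_integral_cmult_indicator emeasure_ball V_def)
    also have "\<dots> = ennreal (((1/2) ^ Suc k) powr (- 2 * a) * (V * ((1/2) ^ k)\<^sup>2))"
      by (simp add: ennreal_mult')
    also have "((1/2::real) ^ Suc k) powr (- 2 * a) = 4 powr a * (4 powr a) ^ k"
    proof -
      have "((1/2::real) ^ Suc k) powr (- 2 * a) = ((1/2) powr (- 2 * a)) ^ Suc k"
      proof -
        have "((1/2::real) ^ Suc k) powr (- 2 * a) = ((1/2) powr real (Suc k)) powr (- 2 * a)"
          by (subst powr_realpow) simp_all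
        also have "\<dots> = (1/2) powr (- 2 * a * real (Suc k))" by (simp only: powr_powr mult.commute[of "real (Suc k)"])
        also have "\<dots> = ((1/2) powr (- 2 * a)) ^ Suc k" by (subst powr_power) (simp_all add: mult_ac)
        finally show ?thesis .
      qed
      also have "(1/2::real) powr (- 2 * a) = 4 powr a"
      proof -
        have "(1/2::real) powr (- 2 * a) = (2 powr (- 1)) powr (- 2 * a)" by (simp add: powr_minus)
        also have "\<dots> = (2 powr 2) powr a" by (simp only: powr_powr) simp
        finally show ?thesis by simp
      qed
      finally show ?thesis by simp
    qed
    also have "4 powr a * (4 powr a) ^ k * (V * ((1/2) ^ k)\<^sup>2) = (4 powr a * V) * (4 powr (a - 1)) ^ k"
    proof -
      have "((1/2::real) ^ k)\<^sup>2 = (1/4) ^ k" by (simp add: power2_eq_square flip: power_mult_distrib)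
      then show ?thesis by (simp add: powr_diff power_divide)
    qed
    finally show "(\<integral>\<^sup>+t. T k t \<partial>lborel) = ennreal ((4 powr a * V) * (4 powr (a - 1)) ^ k)" .
  qed
  also have "\<dots> < \<infinity>"
  proof -
    have "(4::real) powr (a - 1) < 4 powr 0" using a by (intro powr_less_mono) auto
    then have "summable (\<lambda>k. (4 powr a * V) * ((4::real) powr (a - 1)) ^ k)"
      by (intro summable_mult summable_geometric) auto
    then show ?thesis by (subst suminf_ennreal2) (auto simp: V_def)
  qed
  finally show ?thesis .
qed

lemma nn_integral_disc_powr_uniform:
  assumes a: "0 \<le> a" "a < 1"
  obtains K where "K < \<infinity>"
    "\<And>z. (\<integral>\<^sup>+t\<in>cball 0 1. ennreal (cmod (t - z) powr (- 2 * a)) \<partial>lborel) \<le> K"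
proof
  let ?J = "\<integral>\<^sup>+t\<in>ball 0 1. ennreal (cmod t powr (- 2 * a)) \<partial>lborel"
  have [measurable]: "ball (0::complex) 1 \<in> sets borel" "cball (0::complex) 1 \<in> sets borel" by simp_all
  let ?K = "?J + emeasure lborel (cball (0::complex) 1)"
  show "?K < \<infinity>" using nn_integral_disc_powr[OF a] emeasure_disc(2) by simp
  fix z :: complex
  have "(\<integral>\<^sup>+t\<in>cball 0 1. ennreal (cmod (t - z) powr (- 2 * a)) \<partial>lborel) \<le>
     (\<integral>\<^sup>+t. ennreal (cmod (t - z) powr (- 2 * a)) * indicator (ball 0 1) (t - z) + indicator (cball 0 1) t \<partial>lborel)"
  proof (rule nn_integral_mono)
    fix t
    have "cmod (t - z) powr (- 2 * a) \<le> 1" if "cmod (t - z) \<ge> 1"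
      using powr_mono2'[of "- 2 * a" 1 "cmod (t - z)"] that a by simp
    then show "ennreal (cmod (t - z) powr (- 2 * a)) * indicator (cball 0 1) t \<le>
       ennreal (cmod (t - z) powr (- 2 * a)) * indicator (ball 0 1) (t - z) + indicator (cball 0 1) t"
      by (auto simp: indicator_def not_less)
  qed
  also have "\<dots> = (\<integral>\<^sup>+t. ennreal (cmod (t - z) powr (- 2 * a)) * indicator (ball 0 1) (t - z) \<partial>lborel) + emeasure lborel (cball (0::complex) 1)"
    by (subst nn_integral_add) auto
  also have "(\<integral>\<^sup>+t. ennreal (cmod (t - z) powr (- 2 * a)) * indicator (ball 0 1) (t - z) \<partial>lborel) = ?J"
  proof -
    have "?J = (\<integral>\<^sup>+t. ennreal (cmod t powr (- 2 * a)) * indicator (ball 0 1) t \<partial>distr lborel borel ((+) (- z)))"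
      by (simp add: lborel_distr_plus)
    also have "\<dots> = (\<integral>\<^sup>+t. ennreal (cmod (t - z) powr (- 2 * a)) * indicator (ball 0 1) (t - z) \<partial>lborel)"
      by (subst nn_integral_distr) auto
    finally show ?thesis ..
  qed
  finally show "(\<integral>\<^sup>+t\<in>cball 0 1. ennreal (cmod (t - z) powr (- 2 * a)) \<partial>lborel) \<le> ?K" .
qed

lemma tpoly_eval_on_line:
  "\<exists>q. \<forall>t. poly q t = ev f (x + t *s e)"
proof -
  define q where "q = (\<Sum>m\<in>keys f. [:lookup f m:] * (\<Prod>i\<in>UNIV. [:x $ i, e $ i:] ^ lookup m i))"
  have "poly q t = ev f (x + t *s e)" for t
    by (simp add: q_def tpoly_eval_def poly_sum poly_prod)
  then show ?thesis by blast
qed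

text \<open>If \<open>p e \<noteq> 0\<close>, then \<open>p\<close> restricts to a nonzero polynomial on every line in direction \<open>e\<close>, since its top
  coefficient there is \<open>p e\<close>. So the zero set meets these lines in finite sets.\<close>

lemma AE_tpoly_eval_nonzero:
  assumes p: "p \<in> homogeneous_piece k" "p \<noteq> 0"
  shows "AE x in lborel. ev p x \<noteq> 0"
proof -
  obtain e where e: "ev p e \<noteq> 0" using tpoly_eval_eq_0D p(2) by blast
  define Z where "Z = {x. ev p x = 0}"
  have [measurable]: "ev p \<in> borel_measurable borel"
    by (intro borel_measurable_continuous_onI continuous_intros)
  have Z [measurable]: "Z \<in> sets borel" unfolding Z_def by measurable
  have "(\<integral>\<^sup>+t\<in>cball 0 1. indicator Z (x + t *s e) \<partial>lborel) = 0" for x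
  proof -
    obtain q where q: "\<And>t. poly q t = ev p (x + t *s e)" using tpoly_eval_on_line by metis
    have "q \<noteq> 0"
    proof
      assume "q = 0"
      have "ev p (inverse (of_nat (Suc n)) *s x + e) = 0" for n
      proof -
        have "inverse (of_nat (Suc n)) *s (x + of_nat (Suc n) *s e) = inverse (of_nat (Suc n)) *s x + e"
          by (simp add: vec_eq_iff field_simps del: of_nat_Suc)
        then show ?thesis
          using q[of "of_nat (Suc n)"] \<open>q = 0\<close> tpoly_eval_homogeneous[OF p(1), of "inverse (of_nat (Suc n))" "x + of_nat (Suc n) *s e"]
          by simp
      qed
      moreover have "(\<lambda>n. ev p (inverse (of_nat (Suc n)) *s x + e)) \<longlonglongrightarrow> ev p (0 *s x + e)"
      proof -
        have c: "continuous_on UNIV (\<lambda>c. ev p (c *s x + e))" by (intro continuous_intros)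
        have "(\<lambda>n. complex_of_real (inverse (real (Suc n)))) \<longlonglongrightarrow> of_real 0"
          by (intro tendsto_of_real LIMSEQ_inverse_real_of_nat)
        then have "(\<lambda>n. inverse (complex_of_nat (Suc n))) \<longlonglongrightarrow> 0" by simp
        from continuous_on_tendsto_compose[OF c this] show ?thesis by simp
      qed
      ultimately show False using e by (simp add: LIMSEQ_const_iff)
    qed
    then have "finite {t. poly q t = 0}" by (rule poly_roots_finite)
    then have "{t. poly q t = 0} \<in> null_sets lborel" by (rule finite_imp_null_set_lborel)
    then have "AE t in lborel. t \<notin> {t. poly q t = 0}" by (rule AE_not_in)
    then have "AE t in lborel. indicator Z (x + t *s e) * indicator (cball 0 1) t = (0::ennreal)"
      by eventually_elim (simp add: Z_def q)
    then have "(\<integral>\<^sup>+t. indicator Z (x + t *s e) * indicator (cball 0 1) t \<partial>lborel) = (\<integral>\<^sup>+t. 0 \<partial>(lborel :: complex measure))"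
      by (rule nn_integral_cong_AE)
    then show ?thesis by simp
  qed
  then have "emeasure lborel (cball (0::complex) 1) * (\<integral>\<^sup>+x. indicator Z x \<partial>lborel) = 0"
    by (subst nn_integral_average_translates[of _ _ e]) auto
  then have "emeasure lborel Z = 0" using emeasure_disc(1) by auto
  then have "Z \<in> null_sets lborel" by (simp add: null_sets_def)
  then show ?thesis using AE_not_in by (force simp: Z_def)
qed

lemma norm_vscale: "norm (t *s u) = cmod t * norm u" for u :: "complex ^ 3"
proof -
  have "(\<Sum>i\<in>UNIV. (cmod (t * u $ i))\<^sup>2) = (cmod t)\<^sup>2 * (\<Sum>i\<in>UNIV. (cmod (u $ i))\<^sup>2)"
    by (simp add: norm_mult power_mult_distrib sum_distrib_left)
  then show ?thesis by (simp add: norm_vec_def L2_set_def real_sqrt_mult)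
qed

lemma nn_integral_linear_form_powr:
  assumes b: "0 \<le> b" "b < 1" and \<eta>: "\<eta> \<noteq> 0"
  shows "(\<integral>\<^sup>+x\<in>cball p \<rho>. ennreal (cmod (cdot \<eta> x) powr (- 2 * b)) \<partial>lborel) < \<infinity>"
proof -
  obtain i where i: "\<eta> $ i \<noteq> 0" using \<eta> by (auto simp: vec_eq_iff)
  define u where "u = axis i (1 / \<eta> $ i)"
  have u: "cdot \<eta> u = 1" using i by (simp add: u_def)
  obtain K where K: "K < \<infinity>" "\<And>z. (\<integral>\<^sup>+t\<in>cball 0 1. ennreal (cmod (t - z) powr (- 2 * b)) \<partial>lborel) \<le> K"
    using nn_integral_disc_powr_uniform[OF b] by blast
  have [measurable]: "(\<lambda>x. cdot \<eta> x) \<in> borel_measurable borel"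
    by (intro borel_measurable_continuous_onI continuous_intros)
  define W where "W x = ennreal (cmod (cdot \<eta> x) powr (- 2 * b)) * indicator (cball p \<rho>) x" for x
  have [measurable]: "cball p \<rho> \<in> sets borel" by simp
  have [measurable]: "W \<in> borel_measurable borel" unfolding W_def by measurable
  have "emeasure lborel (cball (0::complex) 1) * (\<integral>\<^sup>+x. W x \<partial>lborel) =
      (\<integral>\<^sup>+x. (\<integral>\<^sup>+t\<in>cball 0 1. W (x + t *s u) \<partial>lborel) \<partial>lborel)"
    by (rule nn_integral_average_translates) auto
  also have "\<dots> \<le> (\<integral>\<^sup>+x. K * indicator (cball p (\<rho> + norm u)) x \<partial>lborel)"
  proof (rule nn_integral_mono)
    fix x
    show "(\<integral>\<^sup>+t\<in>cball 0 1. W (x + t *s u) \<partial>lborel) \<le> K * indicator (cball p (\<rho> + norm u)) x"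
    proof (cases "x \<in> cball p (\<rho> + norm u)")
      case True
      have "(\<integral>\<^sup>+t\<in>cball 0 1. W (x + t *s u) \<partial>lborel) \<le>
         (\<integral>\<^sup>+t\<in>cball 0 1. ennreal (cmod (t - (- cdot \<eta> x)) powr (- 2 * b)) \<partial>lborel)"
        by (intro nn_integral_mono) (auto simp: W_def u indicator_def add.commute)
      also have "\<dots> \<le> K" by (rule K)
      finally show ?thesis using True by simp
    next
      case False
      have *: "W (x + t *s u) * indicator (cball 0 1) t = 0" for t
      proof (cases "t \<in> cball 0 1")
        case True
        have "norm (t *s u) = cmod t * norm u" by (rule norm_vscale)
        also have "\<dots> \<le> norm u" using True by (simp add: mult_left_le_one_le)
        finally have "x + t *s u \<notin> cball p \<rho>"
          using False dist_triangle[of p x "x + t *s u"] by (auto simp: dist_norm norm_minus_commute)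
        then show ?thesis by (simp add: W_def)
      qed simp
      show ?thesis unfolding * by simp
    qed
  qed
  also have "\<dots> = K * emeasure lborel (cball p (\<rho> + norm u))" by (simp add: nn_integral_cmult_indicator)
  also have "\<dots> < \<infinity>"
  proof -
    have "emeasure lborel (cball p (\<rho> + norm u)) < \<infinity>" by (rule emeasure_bounded_finite) simp
    then show ?thesis using K(1) by (simp add: ennreal_mult_less_top)
  qed
  finally show ?thesis
    using emeasure_disc by (auto simp: W_def ennreal_mult_less_top)
qed

text \<open>Along the direction \<open>e\<close> the linear form is constant and \<open>g\<close> stays away from its minimum at least linearly, so that
  the inner integral is at most that of a power of \<open>\<bar>t - t0\<bar>\<close>, uniformly in the line. What remains is a power of the linear form.\<close>

lemma nn_integral_line_powr:
  fixes g :: "complex ^ 3 \<Rightarrow> complex"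
  assumes a: "0 \<le> a" "a < 1" and b: "0 \<le> b" "b < 1" and c: "c > 0"
    and g: "continuous_on UNIV g"
    and line: "\<And>x t t'. x + t *s e \<in> cball p \<rho> \<Longrightarrow> x + t' *s e \<in> cball p \<rho> \<Longrightarrow>
       c * cmod (t - t') \<le> cmod (g (x + t *s e) - g (x + t' *s e))"
    and \<eta>: "\<eta> \<noteq> 0" "cdot \<eta> e = 0"
  shows "(\<integral>\<^sup>+x\<in>cball p \<rho>. ennreal (cmod (g x) powr (- 2 * a) * cmod (cdot \<eta> x) powr (- 2 * b)) \<partial>lborel) < \<infinity>"
proof -
  obtain K where K: "K < \<infinity>" "\<And>z. (\<integral>\<^sup>+t\<in>cball 0 1. ennreal (cmod (t - z) powr (- 2 * a)) \<partial>lborel) \<le> K"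
    using nn_integral_disc_powr_uniform[OF a] by blast
  have [measurable]: "(\<lambda>x. cdot \<eta> x) \<in> borel_measurable borel" "g \<in> borel_measurable borel"
    by (intro borel_measurable_continuous_onI continuous_intros g)+
  have [measurable]: "cball p \<rho> \<in> sets borel" "cball p (\<rho> + norm e) \<in> sets borel" "cball (0::complex) 1 \<in> sets borel"
    by simp_all
  define M where "M = (c / 2) powr (- 2 * a)"
  define Y where "Y x = cmod (cdot \<eta> x) powr (- 2 * b)" for x
  have [measurable]: "Y \<in> borel_measurable borel" unfolding Y_def by measurable
  define W where "W x = ennreal (cmod (g x) powr (- 2 * a) * Y x) * indicator (cball p \<rho>) x" for x
  have [measurable]: "W \<in> borel_measurable borel" unfolding W_def by measurable
  have "emeasure lborel (cball (0::complex) 1) * (\<integral>\<^sup>+x. W x \<partial>lborel) =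
      (\<integral>\<^sup>+x. (\<integral>\<^sup>+t\<in>cball 0 1. W (x + t *s e) \<partial>lborel) \<partial>lborel)"
    by (rule nn_integral_average_translates) auto
  also have "\<dots> \<le> (\<integral>\<^sup>+x. (ennreal M * K) * (ennreal (Y x) * indicator (cball p (\<rho> + norm e)) x) \<partial>lborel)"
  proof (rule nn_integral_mono)
    fix x
    define T where "T = {t \<in> cball 0 1. x + t *s e \<in> cball p \<rho>}"
    have Y: "Y (x + t *s e) = Y x" for t by (simp add: Y_def \<eta>)
    show "(\<integral>\<^sup>+t\<in>cball 0 1. W (x + t *s e) \<partial>lborel) \<le> (ennreal M * K) * (ennreal (Y x) * indicator (cball p (\<rho> + norm e)) x)"
    proof (cases "T = {}")
      case True
      then have *: "W (x + t *s e) * indicator (cball 0 1) t = 0" for t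
        by (auto simp: W_def T_def indicator_def)
      show ?thesis unfolding * by simp
    next
      case False
      have contg: "continuous_on S (\<lambda>t. cmod (g (x + t *s e)))" for S
        by (intro continuous_intros continuous_on_compose2[OF g]) auto
      have "T = cball 0 1 \<inter> (\<lambda>t. x + t *s e) -` cball p \<rho>" by (auto simp: T_def)
      moreover have "closed ((\<lambda>t. x + t *s e) -` cball p \<rho>)"
        by (intro closed_vimage continuous_intros) auto
      ultimately have "compact T" by (simp add: compact_Int_closed)
      then obtain t0 where t0: "t0 \<in> T" "\<And>t. t \<in> T \<Longrightarrow> cmod (g (x + t0 *s e)) \<le> cmod (g (x + t *s e))"
        using continuous_attains_inf[OF _ False contg] by blast
      have x: "x \<in> cball p (\<rho> + norm e)"
      proof -
        have "norm (t0 *s e) \<le> norm e" using t0(1) by (simp add: norm_vscale T_def mult_left_le_one_le)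
        then show ?thesis using t0(1) dist_triangle[of p x "x + t0 *s e"] by (simp add: T_def dist_norm)
      qed
      have "{t0} \<in> null_sets lborel" by (rule finite_imp_null_set_lborel) simp
      then have "AE t in lborel. t \<notin> {t0}" by (rule AE_not_in)
      then have "(\<integral>\<^sup>+t\<in>cball 0 1. W (x + t *s e) \<partial>lborel) \<le>
         (\<integral>\<^sup>+t. (ennreal M * ennreal (Y x)) * (ennreal (cmod (t - t0) powr (- 2 * a)) * indicator (cball 0 1) t) \<partial>lborel)"
      proof (intro nn_integral_mono_AE, eventually_elim)
        case (elim t)
        show ?case
        proof (cases "t \<in> T")
          case True
          have "c * cmod (t - t0) \<le> cmod (g (x + t *s e) - g (x + t0 *s e))"
            using line True t0(1) by (simp add: T_def)
          also have "\<dots> \<le> cmod (g (x + t *s e)) + cmod (g (x + t0 *s e))" by (rule norm_triangle_ineq4)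
          also have "\<dots> \<le> 2 * cmod (g (x + t *s e))" using t0(2)[OF True] by simp
          finally have "(c / 2) * cmod (t - t0) \<le> cmod (g (x + t *s e))" by simp
          then have "cmod (g (x + t *s e)) powr (- 2 * a) \<le> ((c / 2) * cmod (t - t0)) powr (- 2 * a)"
            using elim c a by (intro powr_mono2') auto
          also have "\<dots> = M * cmod (t - t0) powr (- 2 * a)" unfolding M_def by (rule powr_mult)
          finally have "cmod (g (x + t *s e)) powr (- 2 * a) * Y x \<le> M * cmod (t - t0) powr (- 2 * a) * Y x"
            by (rule mult_right_mono) (simp add: Y_def)
          then have "ennreal (cmod (g (x + t *s e)) powr (- 2 * a) * Y x) \<le> ennreal (M * Y x * cmod (t - t0) powr (- 2 * a))"
            by (intro ennreal_leI) (simp add: mult_ac)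
          moreover have "ennreal (M * Y x * cmod (t - t0) powr (- 2 * a)) = (ennreal M * ennreal (Y x)) * ennreal (cmod (t - t0) powr (- 2 * a))"
          proof -
            have "0 \<le> M" "0 \<le> Y x" by (simp_all add: M_def Y_def)
            then show ?thesis by (simp only: ennreal_mult' mult_nonneg_nonneg)
          qed
          ultimately show ?thesis using True by (simp add: W_def Y T_def)
        next
          case False
          then have "W (x + t *s e) * indicator (cball 0 1) t = 0" by (auto simp: W_def T_def indicator_def)
          then show ?thesis by (simp only: zero_le)
        qed
      qed
      also have "\<dots> = (ennreal M * ennreal (Y x)) * (\<integral>\<^sup>+t\<in>cball 0 1. ennreal (cmod (t - t0) powr (- 2 * a)) \<partial>lborel)"
        by (rule nn_integral_cmult) measurable
      also have "\<dots> \<le> (ennreal M * ennreal (Y x)) * K" by (intro mult_left_mono K) simp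
      finally show ?thesis using x by (simp add: mult_ac)
    qed
  qed
  also have "\<dots> = (ennreal M * K) * (\<integral>\<^sup>+x\<in>cball p (\<rho> + norm e). ennreal (Y x) \<partial>lborel)"
    by (rule nn_integral_cmult) measurable
  also have "\<dots> < \<infinity>"
    using nn_integral_linear_form_powr[OF b \<eta>(1), of p "\<rho> + norm e"] K(1)
    by (auto simp: Y_def ennreal_mult_less_top)
  finally show ?thesis
    using emeasure_disc by (auto simp: W_def Y_def ennreal_mult_less_top)
qed

section \<open>Contact of lines and conics\<close>

text \<open>The complex bilinear cross product; it vanishes exactly for linearly dependent vectors.\<close>

definition ccross :: "complex ^ 3 \<Rightarrow> complex ^ 3 \<Rightarrow> complex ^ 3" where
  "ccross a b = vector [a $ 2 * b $ 3 - a $ 3 * b $ 2, a $ 3 * b $ 1 - a $ 1 * b $ 3, a $ 1 * b $ 2 - a $ 2 * b $ 1]"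

lemma ccross_nth [simp]:
  "ccross a b $ 1 = a $ 2 * b $ 3 - a $ 3 * b $ 2"
  "ccross a b $ 2 = a $ 3 * b $ 1 - a $ 1 * b $ 3"
  "ccross a b $ 3 = a $ 1 * b $ 2 - a $ 2 * b $ 1"
  by (simp_all add: ccross_def)

lemma cdot_3: "cdot a b = a $ 1 * b $ 1 + a $ 2 * b $ 2 + a $ 3 * b $ 3"
  by (simp add: cdot_def sum_3)

lemma ccross_0D:
  assumes "ccross a b = 0" "b \<noteq> 0"
  shows "\<exists>\<kappa>. a = \<kappa> *s b"
proof -
  have e: "a $ 2 * b $ 3 = a $ 3 * b $ 2" "a $ 3 * b $ 1 = a $ 1 * b $ 3" "a $ 1 * b $ 2 = a $ 2 * b $ 1"
    using assms(1) by (simp_all add: vec_eq_iff forall_3)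
  consider "b $ 1 \<noteq> 0" | "b $ 2 \<noteq> 0" | "b $ 3 \<noteq> 0"
    using assms(2) by (auto simp: vec_eq_iff forall_3)
  then show ?thesis
  proof cases
    case 1
    then have "a = (a $ 1 / b $ 1) *s b" using e by (simp add: vec_eq_iff forall_3 field_simps)
    then show ?thesis ..
  next
    case 2
    then have "a = (a $ 2 / b $ 2) *s b" using e by (simp add: vec_eq_iff forall_3 field_simps)
    then show ?thesis ..
  next
    case 3
    then have "a = (a $ 3 / b $ 3) *s b" using e by (simp add: vec_eq_iff forall_3 field_simps)
    then show ?thesis ..
  qed
qed

lemma cmod_cdot_le: "cmod (cdot a v) \<le> norm a * norm v"
proof -
  have "cmod (cdot a v) \<le> (\<Sum>i\<in>UNIV. \<bar>cmod (a $ i)\<bar> * \<bar>cmod (v $ i)\<bar>)"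
    unfolding cdot_def by (rule order_trans[OF norm_sum]) (simp add: norm_mult)
  also have "\<dots> \<le> L2_set (\<lambda>i. cmod (a $ i)) UNIV * L2_set (\<lambda>i. cmod (v $ i)) UNIV"
    by (rule L2_set_mult_ineq)
  finally show ?thesis by (simp add: norm_vec_def)
qed

text \<open>Two independent linear forms \<open>m, n\<close> that vanish at \<open>p\<close> are, together with the position along \<open>p\<close>,
  linear coordinates of \<open>\<complex>\<^sup>3\<close>.\<close>

lemma coordinates_at_point:
  assumes c: "ccross m n \<noteq> 0" and p: "p \<noteq> 0" and mp: "cdot m p = 0" "cdot n p = 0"
  obtains l u v where "cdot l p = 1" "\<And>x. x = cdot l x *s p + cdot m x *s u + cdot n x *s v"
    "cdot m u = 1" "cdot n u = 0" "cdot m v = 0" "cdot n v = 1"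
proof -
  define k where "k = vcnj (ccross m n)"
  define D where "D = cdot k (ccross m n)"
  have "D = of_real ((norm (ccross m n))\<^sup>2)"
    by (simp only: D_def k_def of_real_norm_sq cdot_commute)
  then have D: "D \<noteq> 0" using c by simp
  have id: "D *s x = cdot k x *s ccross m n + cdot m x *s ccross n k + cdot n x *s ccross k m" for x
    unfolding D_def vec_eq_iff forall_3 by (simp add: cdot_3 algebra_simps)
  have "D *s p = cdot k p *s ccross m n" using id[of p] mp by simp
  moreover have "D *s p \<noteq> 0" using D p by simp
  ultimately have kp: "cdot k p \<noteq> 0" by auto
  have cr: "ccross m n = (D / cdot k p) *s p"
  proof -
    have "(1 / cdot k p) *s (cdot k p *s ccross m n) = (1 / cdot k p) *s (D *s p)"
      using \<open>D *s p = cdot k p *s ccross m n\<close> by simp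
    then show ?thesis using kp by simp
  qed
  show thesis
  proof
    show "cdot ((1 / cdot k p) *s k) p = 1" using kp by simp
    fix x
    have "(1 / D) *s (D *s x) = (1 / D) *s (cdot k x *s ccross m n + cdot m x *s ccross n k + cdot n x *s ccross k m)"
      by (simp only: id)
    then show "x = cdot ((1 / cdot k p) *s k) x *s p + cdot m x *s ((1 / D) *s ccross n k) + cdot n x *s ((1 / D) *s ccross k m)"
      using D kp by (simp add: cr vector_add_ldistrib vec_eq_iff field_simps)
  next
    have t: "cdot m (ccross n k) = D" "cdot n (ccross k m) = D" "cdot n (ccross n k) = 0" "cdot m (ccross k m) = 0"
      by (simp_all add: D_def cdot_3 algebra_simps)
    show "cdot m ((1 / D) *s ccross n k) = 1" "cdot n ((1 / D) *s ccross n k) = 0"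
      "cdot m ((1 / D) *s ccross k m) = 0" "cdot n ((1 / D) *s ccross k m) = 1"
      using D by (simp_all add: t)
  qed
qed

lemma tpoly_strictly_differentiable:
  assumes "\<omega> > 0"
  obtains \<rho> where "\<rho> > 0"
    "\<And>x y. x \<in> cball p \<rho> \<Longrightarrow> y \<in> cball p \<rho> \<Longrightarrow>
      cmod (ev g x - ev g y - cdot (tgrad g p) (x - y)) \<le> \<omega> * norm (x - y)"
proof -
  have "isCont (tgrad g) p"
    using continuous_on_tgrad[OF continuous_on_id, of UNIV g] by (simp add: continuous_on_eq_continuous_at)
  then obtain \<delta> where \<delta>: "\<delta> > 0" "\<And>x. dist x p < \<delta> \<Longrightarrow> dist (tgrad g x) (tgrad g p) < \<omega>"
    using assms by (auto simp: continuous_at_eps_delta)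
  define h where "h x = ev g x - cdot (tgrad g p) x" for x
  have lin: "bounded_linear (cdot a)" for a
  proof (rule bounded_linear_intro[where K = "norm a"])
    show "cdot a (r *\<^sub>R x) = r *\<^sub>R cdot a x" for r x
      by (simp only: scaleR_vscale cdot_simps scaleR_conv_of_real[of r "cdot a x"])
    show "cmod (cdot a x) \<le> norm x * norm a" for x using cmod_cdot_le[of a x] by (simp only: mult.commute)
  qed simp
  have der: "(h has_derivative cdot (tgrad g x - tgrad g p)) (at x within S)" for x S
  proof -
    have "(h has_derivative (\<lambda>v. cdot (tgrad g x) v - cdot (tgrad g p) v)) (at x)"
      unfolding h_def[abs_def]
      by (intro has_derivative_diff tpoly_eval_has_derivative bounded_linear_imp_has_derivative lin)
    then show ?thesis by (subst cdot_simps(5)[abs_def]) (rule has_derivative_at_withinI)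
  qed
  show thesis
  proof
    show "\<delta> / 2 > 0" using \<delta> by simp
    fix x y assume xy: "x \<in> cball p (\<delta> / 2)" "y \<in> cball p (\<delta> / 2)"
    have "cmod (h x - h y) \<le> \<omega> * norm (x - y)"
    proof (rule differentiable_bound[OF convex_cball der _ xy])
      fix z assume "z \<in> cball p (\<delta> / 2)"
      then have "dist z p < \<delta>" using \<delta>(1) by (simp add: dist_commute)
      then have n: "norm (tgrad g z - tgrad g p) \<le> \<omega>" using \<delta>(2)[of z] by (simp add: dist_norm)
      show "onorm (cdot (tgrad g z - tgrad g p)) \<le> \<omega>"
        by (rule onorm_le) (rule order_trans[OF cmod_cdot_le mult_right_mono[OF n norm_ge_zero]])
    qed
    then show "cmod (ev g x - ev g y - cdot (tgrad g p) (x - y)) \<le> \<omega> * norm (x - y)"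
      by (simp add: h_def algebra_simps)
  qed
qed

text \<open>If the branches of two curves through \<open>p\<close> are transversal, their equations generate all linear forms
  that vanish at \<open>p\<close>.\<close>

lemma transversal_estimate:
  assumes g: "g \<in> homogeneous_piece j" "ev g p = 0" and h: "h \<in> homogeneous_piece k" "ev h p = 0"
    and c: "ccross (tgrad g p) (tgrad h p) \<noteq> 0" and p: "p \<noteq> 0" and \<eta>: "cdot \<eta> p = 0"
  shows "\<exists>C. \<forall>\<^sub>F x in nhds p. cmod (cdot \<eta> x) \<le> C * (cmod (ev g x) + cmod (ev h x))"
proof -
  let ?m = "tgrad g p" and ?n = "tgrad h p"
  have mp: "cdot ?m p = 0" "cdot ?n p = 0" using tpoly_euler[OF g(1), of p] tpoly_euler[OF h(1), of p] g(2) h(2) by auto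
  obtain l u v where l: "cdot l p = 1"
    and x: "\<And>x. x = cdot l x *s p + cdot ?m x *s u + cdot ?n x *s v"
    using coordinates_at_point[OF c p mp] by metis
  define K where "K = norm u + norm v + 1"
  have K: "K > 0" by (simp add: K_def add_nonneg_pos)
  define \<omega> where "\<omega> = 1 / (4 * K)"
  have \<omega>: "\<omega> > 0" using K by (simp add: \<omega>_def)
  obtain \<rho>1 where \<rho>1: "\<rho>1 > 0" "\<And>x y. x \<in> cball p \<rho>1 \<Longrightarrow> y \<in> cball p \<rho>1 \<Longrightarrow>
      cmod (ev g x - ev g y - cdot ?m (x - y)) \<le> \<omega> * norm (x - y)"
    using tpoly_strictly_differentiable[OF \<omega>] by metis
  obtain \<rho>2 where \<rho>2: "\<rho>2 > 0" "\<And>x y. x \<in> cball p \<rho>2 \<Longrightarrow> y \<in> cball p \<rho>2 \<Longrightarrow>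
      cmod (ev h x - ev h y - cdot ?n (x - y)) \<le> \<omega> * norm (x - y)"
    using tpoly_strictly_differentiable[OF \<omega>] by metis
  define C where "C = 2 * (cmod (cdot \<eta> u) + cmod (cdot \<eta> v))"
  have 1: "\<forall>\<^sub>F x in nhds p. x \<in> ball p (min \<rho>1 \<rho>2)"
    using \<rho>1 \<rho>2 by (intro eventually_nhds_in_open) auto
  have 2: "\<forall>\<^sub>F x in nhds p. cdot l x *s p \<in> ball p (min \<rho>1 \<rho>2)"
  proof -
    have "continuous_on UNIV (\<lambda>x. cdot l x *s p)" by (intro continuous_intros)
    then have "open ((\<lambda>x. cdot l x *s p) -` ball p (min \<rho>1 \<rho>2))" by (intro open_vimage) auto
    moreover have "p \<in> (\<lambda>x. cdot l x *s p) -` ball p (min \<rho>1 \<rho>2)" using l \<rho>1 \<rho>2 by simp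
    ultimately show ?thesis by (auto dest: eventually_nhds_in_open)
  qed
  from 1 2 have "\<forall>\<^sub>F x in nhds p. cmod (cdot \<eta> x) \<le> C * (cmod (ev g x) + cmod (ev h x))"
  proof eventually_elim
    case (elim x)
    define y where "y = cdot l x *s p"
    define a b where "a = cdot ?m x" and "b = cdot ?n x"
    have xy: "x - y = a *s u + b *s v" using x[of x] by (simp add: y_def a_def b_def algebra_simps)
    have y0: "ev g y = 0" "ev h y = 0"
      using tpoly_eval_homogeneous[OF g(1)] tpoly_eval_homogeneous[OF h(1)] g(2) h(2) by (simp_all add: y_def)
    have mxy: "cdot ?m (x - y) = a" "cdot ?n (x - y) = b" using mp by (simp_all add: y_def a_def b_def)
    have "norm (x - y) \<le> cmod a * norm u + cmod b * norm v"
      unfolding xy by (rule order_trans[OF norm_triangle_ineq]) (simp add: norm_vscale)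
    also have "\<dots> \<le> cmod a * K + cmod b * K" by (intro add_mono mult_left_mono) (auto simp: K_def)
    finally have "\<omega> * norm (x - y) \<le> \<omega> * (cmod a * K + cmod b * K)" using \<omega> by (intro mult_left_mono) auto
    also have "\<dots> = (cmod a + cmod b) / 4" using K by (simp add: \<omega>_def field_simps)
    finally have d: "\<omega> * norm (x - y) \<le> (cmod a + cmod b) / 4" .
    have "cmod (ev g x - a) \<le> (cmod a + cmod b) / 4"
      using \<rho>1(2)[of x y] elim d by (simp add: y0 mxy y_def[symmetric] del: cdot_simps)
    moreover have "cmod (ev h x - b) \<le> (cmod a + cmod b) / 4"
      using \<rho>2(2)[of x y] elim d by (simp add: y0 mxy y_def[symmetric] del: cdot_simps)
    ultimately have ab: "cmod a + cmod b \<le> 2 * (cmod (ev g x) + cmod (ev h x))"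
      using norm_triangle_ineq2[of a "ev g x"] norm_triangle_ineq2[of b "ev h x"]
      by (simp add: norm_minus_commute)
    have "cdot \<eta> x = a * cdot \<eta> u + b * cdot \<eta> v"
      by (subst x[of x]) (simp add: \<eta> a_def b_def)
    then have "cmod (cdot \<eta> x) \<le> cmod a * cmod (cdot \<eta> u) + cmod b * cmod (cdot \<eta> v)"
      by (simp add: norm_mult[symmetric] norm_triangle_ineq)
    also have "\<dots> \<le> (cmod a + cmod b) * (cmod (cdot \<eta> u) + cmod (cdot \<eta> v))"
      by (simp add: algebra_simps)
    also have "\<dots> \<le> (2 * (cmod (ev g x) + cmod (ev h x))) * (cmod (cdot \<eta> u) + cmod (cdot \<eta> v))"
      by (rule mult_right_mono[OF ab]) simp
    finally show ?case by (simp only: C_def mult_ac)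
  qed
  then show ?thesis by blast
qed

lemma line_eval:
  assumes "g \<in> homogeneous_piece 1"
  shows "tgrad g x = tgrad g 0" "ev g x = cdot (tgrad g 0) x"
proof -
  have "tpoly_pderiv i g \<in> homogeneous_piece 0" for i using tpoly_pderiv_homogeneous[of g 0] assms by simp
  then show *: "tgrad g x = tgrad g 0"
    unfolding tgrad_def vec_eq_iff vec_lambda_beta using homogeneous_piece_0_const by blast
  show "ev g x = cdot (tgrad g 0) x" using tpoly_euler[OF assms, of x] * by simp
qed

lemma conic_gradient_linear:
  assumes "g \<in> homogeneous_piece 2"
  shows "tgrad g (x + y) = tgrad g x + tgrad g y" "tgrad g (c *s x) = c *s tgrad g x"
proof -
  have "tpoly_pderiv i g \<in> homogeneous_piece 1" for i
    using tpoly_pderiv_homogeneous[of g 1] assms by (simp add: numeral_2_eq_2)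
  note l = line_eval(2)[OF this]
  have t: "tgrad g z $ i = cdot (tgrad (tpoly_pderiv i g) 0) z" for z i by (simp add: tgrad_def[of g] l)
  show "tgrad g (x + y) = tgrad g x + tgrad g y" "tgrad g (c *s x) = c *s tgrad g x"
    by (simp_all add: vec_eq_iff t)
qed

text \<open>This is the symmetry of the second derivatives, read off by differentiating Euler's formula \<open>2 g x = cdot (tgrad g x) x\<close>
  along a line.\<close>

lemma conic_gradient_symmetric:
  assumes g: "g \<in> homogeneous_piece 2"
  shows "cdot (tgrad g x) y = cdot (tgrad g y) x"
proof -
  have e: "ev g z = cdot (tgrad g z) z / 2" for z using tpoly_euler[OF g, of z] by simp
  have eq: "ev g (x + t *s y) =
      ev g x + t * ((cdot (tgrad g x) y + cdot (tgrad g y) x) / 2) + t\<^sup>2 * ev g y" for t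
    unfolding e by (simp add: conic_gradient_linear[OF g] field_simps power2_eq_square)
  have "((\<lambda>t. ev g (x + t *s y)) has_derivative (\<lambda>h. cdot (tgrad g (x + 0 *s y)) (0 + h *s y))) (at 0)"
  proof (rule has_derivative_compose[OF _ tpoly_eval_has_derivative])
    have bl: "bounded_linear (\<lambda>t. t *s y)"
      by (rule bounded_linear_intro[where K = "norm y"]) (auto simp: norm_vscale vec_eq_iff algebra_simps)
    show "((\<lambda>t. x + t *s y) has_derivative (\<lambda>h. 0 + h *s y)) (at 0)"
      by (intro has_derivative_add has_derivative_const bounded_linear_imp_has_derivative[OF bl])
  qed
  then have "((\<lambda>t. ev g (x + t *s y)) has_field_derivative cdot (tgrad g x) y) (at 0)"
  proof -
    have "(\<lambda>h. cdot (tgrad g (x + 0 *s y)) (0 + h *s y)) = (*) (cdot (tgrad g x) y)"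
      by (auto simp: mult.commute)
    then show ?thesis using \<open>(_ has_derivative _) (at 0)\<close> by (simp only: has_field_derivative_def)
  qed
  moreover have "((\<lambda>t. ev g (x + t *s y)) has_field_derivative (cdot (tgrad g x) y + cdot (tgrad g y) x) / 2) (at 0)"
    unfolding eq by (auto intro!: derivative_eq_intros)
  ultimately have "cdot (tgrad g x) y = (cdot (tgrad g x) y + cdot (tgrad g y) x) / 2"
    by (rule DERIV_unique)
  then show ?thesis by simp
qed

text \<open>The symmetric bilinear form of a conic, normalized so that the conic is its restriction to the diagonal.\<close>

definition polar :: "tpoly \<Rightarrow> complex ^ 3 \<Rightarrow> complex ^ 3 \<Rightarrow> complex" where
  "polar g x y = cdot (tgrad g x) y / 2"

lemma polar:
  assumes g: "g \<in> homogeneous_piece 2"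
  shows "polar g x y = polar g y x" "polar g x (y + z) = polar g x y + polar g x z"
    "polar g (x + y) z = polar g x z + polar g y z"
    "polar g x (c *s y) = c * polar g x y" "polar g (c *s x) y = c * polar g x y"
    "ev g x = polar g x x" "cdot (tgrad g x) y = 2 * polar g x y"
  using conic_gradient_symmetric[OF g, of x y] tpoly_euler[OF g, of x]
  by (simp_all add: polar_def conic_gradient_linear[OF g] add_divide_distrib)

lemma smooth_conic_polar_nondegenerate:
  assumes "is_smooth_conic g" "\<And>y. polar g x y = 0"
  shows "x = 0"
proof (rule ccontr)
  assume "x \<noteq> 0"
  have g: "g \<in> homogeneous_piece 2" using assms(1) by (simp add: is_smooth_conic_def)
  have "tgrad g x $ i = 0" for i using assms(2)[of "axis i 1"] by (simp add: polar_def)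
  moreover have "ev g x = 0" using polar(6)[OF g] assms(2) by simp
  ultimately have "singular_point g x" using \<open>x \<noteq> 0\<close> by (simp add: singular_point_def tgrad_def)
  then show False using assms(1) by (simp add: is_smooth_conic_def)
qed

lemma gradient_nonzero:
  assumes "is_line g \<or> is_smooth_conic g" "ev g p = 0" "p \<noteq> 0"
  shows "tgrad g p \<noteq> 0"
proof
  assume 0: "tgrad g p = 0"
  show False
  proof (cases "is_line g")
    case True
    then have g: "g \<in> homogeneous_piece 1" "g \<noteq> 0" by (auto simp: is_line_def)
    have "ev g x = 0" for x using line_eval[OF g(1)] 0 by (metis cdot_simps(1))
    then show False using tpoly_eval_eq_0D g(2) by blast
  next
    case False
    then have "singular_point g p" "is_smooth_conic g"
      using assms 0 by (auto simp: singular_point_def tgrad_def vec_eq_iff)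
    then show False by (simp add: is_smooth_conic_def)
  qed
qed

text \<open>The hypotheses are those satisfied, in suitable coordinates \<open>b\<close> and \<open>c\<close>, by two smooth conics
  \<open>g\<close> and \<open>\<kappa> g + R\<close> that touch at the origin: \<open>g = 0\<close> is the curve \<open>c = - A b\<^sup>2/U\<close>.\<close>

lemma contact_estimate:
  fixes A \<alpha> \<beta> \<gamma> :: complex
  assumes A: "A \<noteq> 0" and nz: "\<alpha> \<noteq> 0 \<or> \<beta> \<noteq> 0 \<or> \<gamma> \<noteq> 0"
  shows "\<exists>C>0. \<exists>\<rho>>0. \<forall>b c U g R. cmod b \<le> \<rho> \<longrightarrow> 1/2 \<le> cmod U \<longrightarrow> cmod U \<le> 2 \<longrightarrow>
     g = A * b\<^sup>2 + c * U \<longrightarrow> R = \<alpha> * b\<^sup>2 + \<beta> * b * c + \<gamma> * c\<^sup>2 \<longrightarrow> cmod b ^ 4 \<le> C * (cmod g + cmod R)"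
proof -
  define k K where "k = cmod A / 4" and "K = 3 * cmod A"
  have k: "k > 0" "K > 0" using A by (simp_all add: k_def K_def)
  have bounds: "k * cmod b ^ 2 \<le> cmod c \<and> cmod c \<le> K * cmod b ^ 2"
    if U: "1/2 \<le> cmod U" "cmod U \<le> 2" and g: "g = A * b\<^sup>2 + c * U" and small: "cmod g \<le> cmod A * cmod b ^ 2 / 2" for b c U g
  proof
    have n: "cmod (A * b\<^sup>2) = cmod A * cmod b ^ 2" by (simp add: norm_mult norm_power)
    have "cmod A * cmod b ^ 2 = cmod (g - c * U)" using n by (simp add: g)
    also have "\<dots> \<le> cmod g + cmod c * cmod U" by (metis norm_triangle_ineq4 norm_mult)
    also have "\<dots> \<le> cmod A * cmod b ^ 2 / 2 + cmod c * 2" using small U by (intro add_mono mult_left_mono) auto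
    finally show "k * cmod b ^ 2 \<le> cmod c" by (simp add: k_def)
    have "cmod c * (1/2) \<le> cmod c * cmod U" using U by (intro mult_left_mono) auto
    also have "\<dots> = cmod (g - A * b\<^sup>2)" by (simp add: g norm_mult)
    also have "\<dots> \<le> cmod A * cmod b ^ 2 / 2 + cmod A * cmod b ^ 2" using small norm_triangle_ineq4[of g "A * b\<^sup>2"] n by simp
    finally show "cmod c \<le> K * cmod b ^ 2" by (simp add: K_def)
  qed
  have "\<exists>c0>0. \<exists>\<rho>>0. \<forall>b c. cmod b \<le> \<rho> \<longrightarrow> k * cmod b ^ 2 \<le> cmod c \<longrightarrow> cmod c \<le> K * cmod b ^ 2 \<longrightarrow>
     c0 * cmod b ^ 4 \<le> cmod (\<alpha> * b\<^sup>2 + \<beta> * b * c + \<gamma> * c\<^sup>2)"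
  proof -
    define D where "D = cmod \<beta> * K + cmod \<gamma> * K\<^sup>2 + 1"
    have D: "D > 0" using k by (simp add: D_def add_nonneg_pos)
    consider "\<alpha> \<noteq> 0" | "\<alpha> = 0" "\<beta> \<noteq> 0" | "\<alpha> = 0" "\<beta> = 0" "\<gamma> \<noteq> 0" using nz by blast
    then show ?thesis
    proof cases
      case 1
      define \<rho> where "\<rho> = min 1 (cmod \<alpha> / (2 * D))"
      have \<rho>: "\<rho> > 0" using 1 D by (simp add: \<rho>_def)
      have "cmod \<alpha> / 2 * cmod b ^ 4 \<le> cmod (\<alpha> * b\<^sup>2 + \<beta> * b * c + \<gamma> * c\<^sup>2)"
        if b: "cmod b \<le> \<rho>" and c: "cmod c \<le> K * cmod b ^ 2" for b c
      proof -
        have b1: "cmod b \<le> 1" "cmod b * D \<le> cmod \<alpha> / 2" using b D by (auto simp: \<rho>_def field_simps)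
        have "cmod (\<beta> * b * c + \<gamma> * c\<^sup>2) \<le> cmod \<beta> * cmod b * cmod c + cmod \<gamma> * cmod c ^ 2"
          by (metis norm_triangle_ineq norm_mult norm_power)
        also have "\<dots> \<le> cmod \<beta> * cmod b * (K * cmod b ^ 2) + cmod \<gamma> * (K * cmod b ^ 2) ^ 2"
          using c by (intro add_mono mult_left_mono power_mono) auto
        also have "\<dots> = (cmod b * (cmod \<beta> * K + cmod \<gamma> * K\<^sup>2 * cmod b)) * cmod b ^ 2"
          by (simp add: power2_eq_square algebra_simps)
        also have "\<dots> \<le> (cmod b * D) * cmod b ^ 2"
          using b1(1) k by (intro mult_right_mono mult_left_mono) (auto simp: D_def mult_left_le intro: add_increasing2)
        also have "\<dots> \<le> cmod \<alpha> / 2 * cmod b ^ 2" using b1(2) by (intro mult_right_mono) auto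
        finally have "cmod (\<beta> * b * c + \<gamma> * c\<^sup>2) \<le> cmod \<alpha> / 2 * cmod b ^ 2" .
        moreover have "cmod \<alpha> * cmod b ^ 2 \<le> cmod (\<alpha> * b\<^sup>2 + \<beta> * b * c + \<gamma> * c\<^sup>2) + cmod (\<beta> * b * c + \<gamma> * c\<^sup>2)"
          using norm_triangle_ineq4[of "\<alpha> * b\<^sup>2 + \<beta> * b * c + \<gamma> * c\<^sup>2" "\<beta> * b * c + \<gamma> * c\<^sup>2"]
          by (simp add: norm_mult norm_power)
        moreover have "cmod \<alpha> / 2 * cmod b ^ 4 \<le> cmod \<alpha> / 2 * cmod b ^ 2"
          using b1(1) by (intro mult_left_mono power_decreasing) auto
        ultimately show ?thesis by simp
      qed
      then show ?thesis using 1 \<rho> by (intro exI[of _ "cmod \<alpha> / 2"] conjI exI[of _ \<rho>]) auto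
    next
      case 2
      define E where "E = cmod \<gamma> * K + 1"
      have E: "E > 0" using k by (simp add: E_def add_nonneg_pos)
      define \<rho> where "\<rho> = min 1 (cmod \<beta> / (2 * E))"
      have \<rho>: "\<rho> > 0" using 2 E by (simp add: \<rho>_def)
      have "(k * cmod \<beta> / 2) * cmod b ^ 4 \<le> cmod (\<alpha> * b\<^sup>2 + \<beta> * b * c + \<gamma> * c\<^sup>2)"
        if b: "cmod b \<le> \<rho>" and c: "k * cmod b ^ 2 \<le> cmod c" "cmod c \<le> K * cmod b ^ 2" for b c
      proof -
        have b1: "cmod b \<le> 1" "cmod b * E \<le> cmod \<beta> / 2" using b E by (auto simp: \<rho>_def field_simps)
        have "cmod (\<gamma> * c) \<le> cmod \<gamma> * (K * cmod b ^ 2)" using c by (simp add: norm_mult mult_left_mono)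
        also have "\<dots> = (cmod b * (cmod \<gamma> * K)) * cmod b" by (simp add: power2_eq_square)
        also have "\<dots> \<le> (cmod b * E) * cmod b" by (intro mult_right_mono mult_left_mono) (auto simp: E_def)
        also have "\<dots> \<le> cmod \<beta> / 2 * cmod b" using b1(2) by (intro mult_right_mono) auto
        finally have "cmod (\<gamma> * c) \<le> cmod \<beta> / 2 * cmod b" .
        moreover have "cmod \<beta> * cmod b \<le> cmod (\<beta> * b + \<gamma> * c) + cmod (\<gamma> * c)"
          using norm_triangle_ineq4[of "\<beta> * b + \<gamma> * c" "\<gamma> * c"] by (simp add: norm_mult)
        ultimately have "cmod \<beta> / 2 * cmod b \<le> cmod (\<beta> * b + \<gamma> * c)" by simp
        then have "(k * cmod b ^ 2) * (cmod \<beta> / 2 * cmod b) \<le> cmod c * cmod (\<beta> * b + \<gamma> * c)"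
          using c(1) k by (intro mult_mono) auto
        also have "\<dots> = cmod (\<alpha> * b\<^sup>2 + \<beta> * b * c + \<gamma> * c\<^sup>2)"
          using 2 by (simp add: norm_mult[symmetric] power2_eq_square algebra_simps)
        finally have "(k * cmod \<beta> / 2) * cmod b ^ 3 \<le> cmod (\<alpha> * b\<^sup>2 + \<beta> * b * c + \<gamma> * c\<^sup>2)"
          by (simp add: power2_eq_square power3_eq_cube mult_ac)
        moreover have "(k * cmod \<beta> / 2) * cmod b ^ 4 \<le> (k * cmod \<beta> / 2) * cmod b ^ 3"
          using b1(1) k by (intro mult_left_mono power_decreasing) auto
        ultimately show ?thesis by simp
      qed
      then show ?thesis using 2 \<rho> k by (intro exI[of _ "k * cmod \<beta> / 2"] conjI exI[of _ \<rho>]) auto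
    next
      case 3
      have "(cmod \<gamma> * k\<^sup>2) * cmod b ^ 4 \<le> cmod (\<alpha> * b\<^sup>2 + \<beta> * b * c + \<gamma> * c\<^sup>2)"
        if c: "k * cmod b ^ 2 \<le> cmod c" for b c
      proof -
        have "(k * cmod b ^ 2) ^ 2 \<le> cmod c ^ 2" using c k by (intro power_mono) auto
        then have "cmod \<gamma> * (k * cmod b ^ 2) ^ 2 \<le> cmod \<gamma> * cmod c ^ 2" by (intro mult_left_mono) auto
        then show ?thesis using 3 by (simp add: norm_mult norm_power power_mult_distrib flip: power_mult)
      qed
      then show ?thesis using 3 k by (intro exI[of _ "cmod \<gamma> * k\<^sup>2"] conjI exI[of _ 1]) auto
    qed
  qed
  then obtain c0 \<rho> where c0: "c0 > 0" "\<rho> > 0" and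
    low: "\<And>b c. cmod b \<le> \<rho> \<Longrightarrow> k * cmod b ^ 2 \<le> cmod c \<Longrightarrow> cmod c \<le> K * cmod b ^ 2 \<Longrightarrow>
     c0 * cmod b ^ 4 \<le> cmod (\<alpha> * b\<^sup>2 + \<beta> * b * c + \<gamma> * c\<^sup>2)"
    by blast
  define C where "C = 1 / c0 + 2 / cmod A"
  have C: "C > 0" using c0 A by (simp add: C_def add_pos_pos)
  have "cmod b ^ 4 \<le> C * (cmod g + cmod R)"
    if b: "cmod b \<le> min 1 \<rho>" and U: "1/2 \<le> cmod U" "cmod U \<le> 2"
      and g: "g = A * b\<^sup>2 + c * U" and R: "R = \<alpha> * b\<^sup>2 + \<beta> * b * c + \<gamma> * c\<^sup>2" for b c U g R
  proof (cases "cmod g \<le> cmod A * cmod b ^ 2 / 2")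
    case True
    have "c0 * cmod b ^ 4 \<le> cmod R"
      unfolding R using bounds[OF U g True] b by (intro low) auto
    then have "cmod b ^ 4 \<le> 1 / c0 * cmod R" using c0 by (simp add: field_simps)
    also have "\<dots> \<le> C * (cmod g + cmod R)" using c0 by (intro mult_mono) (auto simp: C_def)
    finally show ?thesis .
  next
    case False
    have "cmod b ^ 4 \<le> cmod b ^ 2" using b by (intro power_decreasing) auto
    also have "\<dots> \<le> 2 / cmod A * cmod g" using False A by (simp add: field_simps)
    also have "\<dots> \<le> C * (cmod g + cmod R)" using c0 by (intro mult_mono) (auto simp: C_def)
    finally show ?thesis .
  qed
  then show ?thesis using C c0 by (intro exI[of _ C] conjI exI[of _ "min 1 \<rho>"]) auto
qed

lemma eventually_cmod_less:
  fixes F :: "complex ^ 3 \<Rightarrow> complex"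
  assumes "continuous_on UNIV F" "cmod (F p) < r"
  shows "\<forall>\<^sub>F x in nhds p. cmod (F x) < r"
proof -
  have "open ((\<lambda>x. cmod (F x)) -` {..<r})"
    by (intro open_vimage continuous_intros assms)
  then have "\<forall>\<^sub>F x in nhds p. x \<in> (\<lambda>x. cmod (F x)) -` {..<r}"
    using assms(2) by (intro eventually_nhds_in_open) auto
  then show ?thesis by simp
qed

lemma polar_diff: "g \<in> homogeneous_piece 2 \<Longrightarrow> polar g (x - y) z = polar g x z - polar g y z"
  using polar(3)[of g x "(-1) *s y" z] polar(5)[of g "-1" y z] by simp

lemma line_eval_at: "g \<in> homogeneous_piece 1 \<Longrightarrow> ev g x = cdot (tgrad g p) x"
  using line_eval(1)[of g p] line_eval(2)[of g x] by simp

text \<open>A nondegenerate quadratic form in three variables has no totally isotropic plane, so it cannot vanish on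
  the span of \<open>p\<close> and the tangent direction \<open>v\<close>.\<close>

lemma conic_tangent_direction:
  assumes g: "is_smooth_conic g" "ev g p = 0"
    and x: "\<And>x. x = cdot l x *s p + cdot m x *s u + cdot n x *s v"
    and n: "cdot n p = 0" "cdot n v = 1" and pv: "polar g p v = 0" and pu: "polar g p u \<noteq> 0"
  shows "polar g v v \<noteq> 0"
proof
  assume vv: "polar g v v = 0"
  have h: "g \<in> homogeneous_piece 2" using g by (simp add: is_smooth_conic_def)
  have pp: "polar g p p = 0" using g(2) polar(6)[OF h] by simp
  define z where "z = polar g v u *s p + (- polar g p u) *s v"
  have "polar g z y = 0" for y
  proof -
    have "polar g z p = 0" "polar g z u = 0" "polar g z v = 0"
      using pp pv vv polar(1)[OF h, of v p] by (simp_all add: z_def polar_diff[OF h] polar(3)[OF h] polar(5)[OF h])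
    then show ?thesis by (subst x[of y]) (simp add: polar(2)[OF h] polar(4)[OF h])
  qed
  then have "z = 0" by (rule smooth_conic_polar_nondegenerate[OF g(1)])
  moreover have "cdot n z = - polar g p u" using n by (simp add: z_def)
  ultimately show False using pu by simp
qed

text \<open>In the coordinates \<open>b = \<eta> x\<close> and \<open>c = g x\<close> the conic is \<open>A b\<^sup>2 + c U\<close>, so the contact order is in fact two.\<close>

lemma contact_line_conic:
  assumes g: "is_line g" "ev g p = 0" and h: "is_smooth_conic h" "ev h p = 0"
    and p: "p \<noteq> 0" and \<eta>: "cdot \<eta> p = 0" and ind: "ccross (tgrad g p) \<eta> \<noteq> 0"
    and \<kappa>: "tgrad h p = \<kappa> *s tgrad g p"
  shows "\<exists>C. \<forall>\<^sub>F x in nhds p. cmod (cdot \<eta> x) ^ 4 \<le> C * (cmod (ev g x) + cmod (ev h x))"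
proof -
  let ?m = "tgrad g p" and ?B = "polar h"
  have g1: "g \<in> homogeneous_piece 1" and h2: "h \<in> homogeneous_piece 2"
    using g h by (auto simp: is_line_def is_smooth_conic_def)
  have gx: "ev g x = cdot ?m x" for x by (rule line_eval_at[OF g1])
  have \<kappa>0: "\<kappa> \<noteq> 0" using \<kappa> gradient_nonzero[of h p] h p by auto
  obtain l u v where l: "cdot l p = 1"
    and x: "\<And>x. x = cdot l x *s p + cdot ?m x *s u + cdot \<eta> x *s v"
    and d: "cdot ?m u = 1" "cdot ?m v = 0" "cdot \<eta> v = 1"
    using coordinates_at_point[OF ind p _ \<eta>] g(2) gx by metis
  have pu: "?B p u = \<kappa> / 2" "?B p v = 0" by (simp_all add: polar_def \<kappa> d)
  have pp: "?B p p = 0" using h(2) polar(6)[OF h2] by simp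
  have A: "?B v v \<noteq> 0"
    by (rule conic_tangent_direction[OF h x \<eta> d(3)]) (use pu \<kappa>0 in auto)
  define U where "U x = \<kappa> * cdot l x + 2 * cdot \<eta> x * ?B u v + cdot ?m x * ?B u u" for x
  have hx: "ev h x = ?B v v * (cdot \<eta> x)\<^sup>2 + cdot ?m x * U x" for x
  proof -
    have "ev h x = ?B (cdot l x *s p + cdot ?m x *s u + cdot \<eta> x *s v) (cdot l x *s p + cdot ?m x *s u + cdot \<eta> x *s v)"
      using x[of x] polar(6)[OF h2, of x] by simp
    also have "\<dots> = ?B v v * (cdot \<eta> x)\<^sup>2 + cdot ?m x * U x"
    proof -
      have "?B u p = \<kappa> / 2" "?B v p = 0" "?B v u = ?B u v"
        using pu polar(1)[OF h2, of u p] polar(1)[OF h2, of v p] polar(1)[OF h2, of v u] by simp_all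
      note q = this
      show ?thesis
        by (simp add: q polar(2-5)[OF h2] pp pu U_def power2_eq_square algebra_simps)
    qed
    finally show ?thesis .
  qed
  define M where "M = cmod (U p) + 1"
  have 1: "\<forall>\<^sub>F x in nhds p. cmod (U x) < M"
    unfolding M_def U_def by (rule eventually_cmod_less) (auto intro!: continuous_intros)
  have 2: "\<forall>\<^sub>F x in nhds p. cmod (cdot \<eta> x) < 1"
    using \<eta> by (intro eventually_cmod_less continuous_intros) auto
  define C where "C = max 1 M / cmod (?B v v)"
  from 1 2 have "\<forall>\<^sub>F x in nhds p. cmod (cdot \<eta> x) ^ 4 \<le> C * (cmod (ev g x) + cmod (ev h x))"
  proof eventually_elim
    case (elim x)
    have "cmod (?B v v) * cmod (cdot \<eta> x) ^ 2 = cmod (ev h x - cdot ?m x * U x)"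
      by (simp add: hx norm_mult norm_power)
    also have "\<dots> \<le> cmod (ev h x) + cmod (cdot ?m x) * cmod (U x)"
      by (metis norm_triangle_ineq4 norm_mult)
    also have "\<dots> \<le> max 1 M * cmod (ev h x) + max 1 M * cmod (cdot ?m x)"
    proof (rule add_mono)
      show "cmod (ev h x) \<le> max 1 M * cmod (ev h x)"
        using mult_right_mono[of 1 "max 1 M" "cmod (ev h x)"] by simp
      show "cmod (cdot ?m x) * cmod (U x) \<le> max 1 M * cmod (cdot ?m x)"
        using elim mult_right_mono[of "cmod (U x)" "max 1 M" "cmod (cdot ?m x)"] by (simp add: mult.commute)
    qed
    finally have "cmod (cdot \<eta> x) ^ 2 \<le> C * (cmod (ev g x) + cmod (ev h x))"
      using A by (simp add: C_def gx field_simps)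
    moreover have "cmod (cdot \<eta> x) ^ 4 \<le> cmod (cdot \<eta> x) ^ 2" using elim by (intro power_decreasing) auto
    ultimately show ?case by simp
  qed
  then show ?thesis by blast
qed

text \<open>After subtracting the multiple of \<open>g\<close> that removes the common linear term, \<open>h\<close> becomes a quadratic form in the
  local coordinates \<open>b\<close> and \<open>c\<close>, and \<open>contact_estimate\<close> applies.\<close>

lemma contact_conic_conic:
  assumes g: "is_smooth_conic g" "ev g p = 0" and h: "is_smooth_conic h" "ev h p = 0"
    and p: "p \<noteq> 0" and \<eta>: "cdot \<eta> p = 0" and ind: "ccross (tgrad g p) \<eta> \<noteq> 0"
    and \<kappa>: "tgrad h p = \<kappa> *s tgrad g p" and ne: "\<exists>v. ev h v \<noteq> \<kappa> * ev g v"
  shows "\<exists>C. \<forall>\<^sub>F x in nhds p. cmod (cdot \<eta> x) ^ 4 \<le> C * (cmod (ev g x) + cmod (ev h x))"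
proof -
  let ?m = "tgrad g p"
  have g2: "g \<in> homogeneous_piece 2" and h2: "h \<in> homogeneous_piece 2"
    using g h by (auto simp: is_smooth_conic_def)
  have mp: "cdot ?m p = 0" using tpoly_euler[OF g2, of p] g(2) by simp
  have \<kappa>0: "\<kappa> \<noteq> 0" using \<kappa> gradient_nonzero[of h p] h p by auto
  obtain l u v where l: "cdot l p = 1"
    and x: "\<And>x. x = cdot l x *s p + cdot ?m x *s u + cdot \<eta> x *s v"
    and d: "cdot ?m u = 1" "cdot ?m v = 0" "cdot \<eta> v = 1"
    using coordinates_at_point[OF ind p mp \<eta>] by metis
  have pu: "polar g p u = 1 / 2" "polar g p v = 0" "polar h p u = \<kappa> / 2" "polar h p v = 0"
    by (simp_all add: polar_def \<kappa> d)
  have A: "polar g v v \<noteq> 0"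
    by (rule conic_tangent_direction[OF g x \<eta> d(3)]) (use pu in auto)
  define U where "U x = cdot l x + 2 * cdot \<eta> x * polar g u v + cdot ?m x * polar g u u" for x
  have expand: "ev q x = polar q v v * (cdot \<eta> x)\<^sup>2 + cdot ?m x *
      (2 * polar q p u * cdot l x + 2 * cdot \<eta> x * polar q u v + cdot ?m x * polar q u u)"
    if q: "q \<in> homogeneous_piece 2" and q0: "ev q p = 0" "polar q p v = 0" for q x
  proof -
    have "ev q x = polar q (cdot l x *s p + cdot ?m x *s u + cdot \<eta> x *s v) (cdot l x *s p + cdot ?m x *s u + cdot \<eta> x *s v)"
      using x[of x] polar(6)[OF q, of x] by simp
    also have "\<dots> = polar q v v * (cdot \<eta> x)\<^sup>2 + cdot ?m x *
      (2 * polar q p u * cdot l x + 2 * cdot \<eta> x * polar q u v + cdot ?m x * polar q u u)"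
      using polar(1)[OF q, of u p] polar(1)[OF q, of v p] polar(1)[OF q, of v u] q0 polar(6)[OF q, of p]
      by (simp add: polar(2-5)[OF q] power2_eq_square algebra_simps)
    finally show ?thesis .
  qed
  have gx: "ev g x = polar g v v * (cdot \<eta> x)\<^sup>2 + cdot ?m x * U x" for x
    unfolding expand[OF g2 g(2) pu(2), of x] U_def by (simp add: pu)
  define \<alpha> \<beta> \<gamma> where "\<alpha> = polar h v v - \<kappa> * polar g v v" and "\<beta> = 2 * (polar h u v - \<kappa> * polar g u v)"
    and "\<gamma> = polar h u u - \<kappa> * polar g u u"
  have R: "ev h x - \<kappa> * ev g x = \<alpha> * (cdot \<eta> x)\<^sup>2 + \<beta> * cdot \<eta> x * cdot ?m x + \<gamma> * (cdot ?m x)\<^sup>2" for x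
    unfolding expand[OF g2 g(2) pu(2), of x] expand[OF h2 h(2) pu(4), of x] \<alpha>_def \<beta>_def \<gamma>_def
    by (simp add: pu power2_eq_square algebra_simps)
  have "\<alpha> \<noteq> 0 \<or> \<beta> \<noteq> 0 \<or> \<gamma> \<noteq> 0"
  proof (rule ccontr)
    assume "\<not> (\<alpha> \<noteq> 0 \<or> \<beta> \<noteq> 0 \<or> \<gamma> \<noteq> 0)"
    then have "ev h x = \<kappa> * ev g x" for x using R[of x] by simp
    then show False using ne by blast
  qed
  from contact_estimate[OF A this] obtain C \<rho> where C: "C > 0" "\<rho> > 0" and est: "\<And>b c U G R.
     cmod b \<le> \<rho> \<Longrightarrow> 1/2 \<le> cmod U \<Longrightarrow> cmod U \<le> 2 \<Longrightarrow>
     G = polar g v v * b\<^sup>2 + c * U \<Longrightarrow> R = \<alpha> * b\<^sup>2 + \<beta> * b * c + \<gamma> * c\<^sup>2 \<Longrightarrow> cmod b ^ 4 \<le> C * (cmod G + cmod R)"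
    by metis
  have 1: "\<forall>\<^sub>F x in nhds p. cmod (U x - 1) < 1/2"
    unfolding U_def using l \<eta> mp by (intro eventually_cmod_less continuous_intros) auto
  have 2: "\<forall>\<^sub>F x in nhds p. cmod (cdot \<eta> x) < \<rho>"
    using \<eta> C by (intro eventually_cmod_less continuous_intros) auto
  from 1 2 have "\<forall>\<^sub>F x in nhds p. cmod (cdot \<eta> x) ^ 4 \<le> C * (1 + cmod \<kappa>) * (cmod (ev g x) + cmod (ev h x))"
  proof eventually_elim
    case (elim x)
    have U: "1/2 \<le> cmod (U x)" "cmod (U x) \<le> 2"
      using elim(1) norm_triangle_ineq2[of "U x" 1] norm_triangle_ineq2[of 1 "U x"] by (simp_all add: norm_minus_commute)
    have "cmod (cdot \<eta> x) ^ 4 \<le> C * (cmod (ev g x) + cmod (ev h x - \<kappa> * ev g x))"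
      using elim(2) U gx R by (intro est[of _ "U x" _ "cdot ?m x"]) auto
    also have "\<dots> \<le> C * ((1 + cmod \<kappa>) * (cmod (ev g x) + cmod (ev h x)))"
    proof (rule mult_left_mono)
      have "cmod (ev h x - \<kappa> * ev g x) \<le> cmod (ev h x) + cmod \<kappa> * cmod (ev g x)"
        by (metis norm_triangle_ineq4 norm_mult)
      then show "cmod (ev g x) + cmod (ev h x - \<kappa> * ev g x) \<le>
          (1 + cmod \<kappa>) * (cmod (ev g x) + cmod (ev h x))"
        by (simp add: algebra_simps) (smt (verit) mult_nonneg_nonneg norm_ge_zero)
    qed (use C in auto)
    finally show ?case by (simp only: mult.assoc)
  qed
  then show ?thesis by blast
qed

text \<open>An analytic form of the fact that two distinct components meet with multiplicity at most four: the fourth power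
  of the coordinate \<open>\<eta>\<close> lies in their local ideal at \<open>p\<close>.\<close>

lemma contact_at_most_four:
  assumes g: "is_line g \<or> is_smooth_conic g" "ev g p = 0"
    and h: "is_line h \<or> is_smooth_conic h" "ev h p = 0"
    and ne: "\<And>\<kappa>. \<exists>v. ev h v \<noteq> \<kappa> * ev g v"
    and p: "p \<noteq> 0" and \<eta>: "cdot \<eta> p = 0" and ind: "ccross (tgrad g p) \<eta> \<noteq> 0"
  shows "\<exists>C. \<forall>\<^sub>F x in nhds p. cmod (cdot \<eta> x) ^ 4 \<le> C * (cmod (ev g x) + cmod (ev h x))"
proof -
  obtain j where j: "g \<in> homogeneous_piece j" using g(1) by (auto simp: is_line_def is_smooth_conic_def)
  obtain k where k: "h \<in> homogeneous_piece k" using h(1) by (auto simp: is_line_def is_smooth_conic_def)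
  show ?thesis
  proof (cases "ccross (tgrad h p) (tgrad g p) = 0")
    case False
    from transversal_estimate[OF k h(2) j g(2) False p \<eta>] obtain C where
      1: "\<forall>\<^sub>F x in nhds p. cmod (cdot \<eta> x) \<le> C * (cmod (ev h x) + cmod (ev g x))" by blast
    have 2: "\<forall>\<^sub>F x in nhds p. cmod (cdot \<eta> x) < 1"
      using \<eta> by (intro eventually_cmod_less continuous_intros) auto
    from 1 2 have "\<forall>\<^sub>F x in nhds p. cmod (cdot \<eta> x) ^ 4 \<le> C * (cmod (ev g x) + cmod (ev h x))"
    proof eventually_elim
      case (elim x)
      have "cmod (cdot \<eta> x) ^ 4 \<le> cmod (cdot \<eta> x) ^ 1" using elim by (intro power_decreasing) auto
      then show ?case using elim by (simp add: add.commute)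
    qed
    then show ?thesis by blast
  next
    case True
    from ccross_0D[OF this gradient_nonzero[OF g p]] obtain \<kappa> where \<kappa>: "tgrad h p = \<kappa> *s tgrad g p" by blast
    have \<kappa>0: "\<kappa> \<noteq> 0" using \<kappa> gradient_nonzero[OF h p] by auto
    consider "is_line g" "is_line h" | "is_line g" "is_smooth_conic h" | "is_smooth_conic g" "is_line h"
      | "is_smooth_conic g" "is_smooth_conic h" using g h by blast
    then show ?thesis
    proof cases
      case 1
      then have "ev g x = cdot (tgrad g p) x" "ev h x = cdot (tgrad h p) x" for x
        using line_eval_at[of g] line_eval_at[of h] by (auto simp: is_line_def)
      then have "ev h x = \<kappa> * ev g x" for x by (simp add: \<kappa>)
      then show ?thesis using ne by blast
    next
      case 2
      then show ?thesis using contact_line_conic[OF _ g(2) _ h(2) p \<eta> ind \<kappa>] by blast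
    next
      case 3
      have \<kappa>': "tgrad g p = (1 / \<kappa>) *s tgrad h p" using \<kappa> \<kappa>0 by simp
      have "ccross (\<kappa> *s tgrad g p) \<eta> = \<kappa> *s ccross (tgrad g p) \<eta>"
        by (simp add: vec_eq_iff forall_3 algebra_simps)
      then have "ccross (tgrad h p) \<eta> \<noteq> 0" using \<kappa> \<kappa>0 ind by simp
      from contact_line_conic[OF 3(2) h(2) 3(1) g(2) p \<eta> this \<kappa>'] show ?thesis by (simp add: add.commute)
    next
      case 4
      then show ?thesis using contact_conic_conic[OF _ g(2) _ h(2) p \<eta> ind \<kappa> ne] by blast
    qed
  qed
qed

section \<open>Local integrability of \<open>\<bar>f\<bar>\<^sup>-\<^sup>2\<^sup>s\<close>\<close>

text \<open>Let the \<open>i\<close>-th factor be the smallest one. A factor tangent to it is split as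
  \<open>m k ^ (- 2 t) m k ^ (- 2 (s - t))\<close>; the first part is bounded by the same power of \<open>m i\<close> and the second one by a power
  of \<open>h ^ 4\<close>. A transversal factor is bounded by a power of \<open>h\<close> alone.\<close>

lemma branches_inequality:
  fixes m :: "nat \<Rightarrow> real"
  assumes I: "finite I" "card I \<le> 3" "I \<noteq> {}" and m: "\<And>i. i \<in> I \<Longrightarrow> 0 < m i \<and> m i \<le> 1"
    and h: "0 < h" "h \<le> 1" and C: "C \<ge> 1" and st: "0 < t" "t < s"
    and four: "\<And>i k. i \<in> I \<Longrightarrow> k \<in> I \<Longrightarrow> i \<noteq> k \<Longrightarrow> h ^ 4 \<le> C * (m i + m k)"
    and one: "\<And>i. i \<in> I \<Longrightarrow> \<exists>k0. \<forall>k\<in>I. k \<noteq> i \<longrightarrow> k \<noteq> k0 \<longrightarrow> h \<le> C * (m i + m k)"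
  shows "(\<Prod>i\<in>I. m i powr (- 2 * s)) \<le>
     (2 * C) powr (4 * s) * (\<Sum>i\<in>I. m i powr (- 2 * (s + t)) * h powr (- 2 * (5 * s - 4 * t)))"
proof -
  have "Min (m ` I) \<in> m ` I" using I by (intro Min_in) auto
  then obtain i where i: "i \<in> I" "Min (m ` I) = m i" by blast
  have "m i \<le> m k" if "k \<in> I" for k using Min_le[of "m ` I" "m k"] that I(1) i(2) by simp
  note i = i(1) this
  obtain k0 where k0: "\<And>k. k \<in> I \<Longrightarrow> k \<noteq> i \<Longrightarrow> k \<noteq> k0 \<Longrightarrow> h \<le> C * (m i + m k)" using one[OF i(1)] by blast
  define L where "L = 2 * C"
  have L: "L \<ge> 1" using C by (simp add: L_def)
  have div: "(a / L) powr (- e) = L powr e * a powr (- e)" for a e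
    by (simp add: divide_inverse powr_mult powr_minus inverse_powr)
  define J where "J = I - {i}"
  have J: "finite J" "card J \<le> 2" using I i by (auto simp: J_def)
  define E where "E = m i powr (- 2 * t)"
  define F where "F = L powr (2 * (s - t)) * h powr (- 8 * (s - t))"
  define G where "G = L powr (2 * s) * h powr (- 2 * s)"
  have h1: "h powr (- a) \<ge> 1" if "a \<ge> 0" for a
    using powr_mono2'[of "- a" h 1] that h by simp
  have E: "E \<ge> 1" using powr_mono2'[of "- 2 * t" "m i" 1] m[OF i(1)] st by (simp add: E_def)
  have L1: "L powr a \<ge> 1" if "a \<ge> 0" for a using L that by (simp add: ge_one_powr_ge_zero)
  have F: "F \<ge> 1" unfolding F_def
    using mult_mono[OF L1 h1, of "2 * (s - t)" "8 * (s - t)"] st by simp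
  have G: "G \<ge> 1" unfolding G_def using mult_mono[OF L1 h1, of "2 * s" "2 * s"] st by simp
  have f: "m k powr (- 2 * s) \<le> E * F" if k: "k \<in> J" for k
  proof -
    have kk: "k \<in> I" "k \<noteq> i" using k by (auto simp: J_def)
    have "h ^ 4 \<le> C * (m i + m k)" using four[OF i(1) kk(1)] kk by simp
    also have "\<dots> \<le> C * (m k + m k)" using i(2)[OF kk(1)] C by (intro mult_left_mono add_mono) auto
    finally have "h ^ 4 / L \<le> m k" using C by (simp add: L_def field_simps)
    then have "m k powr (- 2 * (s - t)) \<le> (h ^ 4 / L) powr (- 2 * (s - t))"
      using h L st by (intro powr_mono2') auto
    also have "\<dots> = F"
    proof -
      have h4: "h ^ 4 = h powr 4" using h by (simp add: powr_numeral)
      have "(h ^ 4) powr (- 2 * (s - t)) = h powr (- 8 * (s - t))"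
      proof -
        have "4 * (- 2 * (s - t)) = - 8 * (s - t)" by simp
        then show ?thesis by (simp only: h4 powr_powr)
      qed
      then show ?thesis using div[of "h ^ 4" "2 * (s - t)"] by (simp only: F_def mult_minus_left)
    qed
    finally have 1: "m k powr (- 2 * (s - t)) \<le> F" .
    have 2: "m k powr (- 2 * t) \<le> E" unfolding E_def using i(2)[OF kk(1)] m[OF i(1)] st by (intro powr_mono2') auto
    have "m k powr (- 2 * s) = m k powr (- 2 * t) * m k powr (- 2 * (s - t))"
      by (simp add: algebra_simps flip: powr_add)
    also have "\<dots> \<le> E * F" using E by (intro mult_mono 1 2) auto
    finally show ?thesis .
  qed
  have g: "m k powr (- 2 * s) \<le> G" if k: "k \<in> J" "k \<noteq> k0" for k
  proof -
    have kk: "k \<in> I" "k \<noteq> i" using k by (auto simp: J_def)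
    have "h \<le> C * (m i + m k)" using k0 kk k by simp
    also have "\<dots> \<le> C * (m k + m k)" using i(2)[OF kk(1)] C by (intro mult_left_mono add_mono) auto
    finally have "h / L \<le> m k" using C by (simp add: L_def field_simps)
    then have "m k powr (- 2 * s) \<le> (h / L) powr (- 2 * s)"
      using h L st by (intro powr_mono2') auto
    also have "\<dots> = G" using div[of h "2 * s"] by (simp add: G_def)
    finally show ?thesis .
  qed
  have "(\<Prod>k\<in>J. m k powr (- 2 * s)) \<le> E * F * G"
  proof -
    consider "card J = 0" | "card J = 1" | "card J = 2" using J(2) by linarith
    then show ?thesis
    proof cases
      case 1
      then have "J = {}" using J by simp
      then show ?thesis using mult_mono[OF mult_mono[OF E F] G] E F by simp
    next
      case 2
      then obtain k where "J = {k}" by (auto simp: card_1_singleton_iff)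
      then show ?thesis using f[of k] mult_mono[OF f[of k] G] E F by simp
    next
      case 3
      then obtain k l where kl: "J = {k, l}" "k \<noteq> l" by (auto simp: card_2_iff)
      have "m k powr (- 2 * s) * m l powr (- 2 * s) \<le> E * F * G"
      proof (cases "l = k0")
        case True
        then show ?thesis using mult_mono[OF f[of l] g[of k]] kl E F by (simp add: mult.commute)
      next
        case False
        then show ?thesis using mult_mono[OF f[of k] g[of l]] kl E F by simp
      qed
      then show ?thesis using kl by simp
    qed
  qed
  then have "(\<Prod>k\<in>I. m k powr (- 2 * s)) \<le> m i powr (- 2 * s) * (E * F * G)"
    using i(1) I(1) by (simp add: prod.remove[of I i] J_def mult_left_mono)
  also have "\<dots> = (L powr (4 * s - 2 * t)) * (m i powr (- 2 * (s + t)) * h powr (- 2 * (5 * s - 4 * t)))"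
  proof -
    have a: "m i powr (- 2 * s) * E = m i powr (- 2 * (s + t))" by (simp add: E_def algebra_simps flip: powr_add)
    have b: "F * G = (L powr (2 * (s - t)) * L powr (2 * s)) * (h powr (- 8 * (s - t)) * h powr (- 2 * s))"
      by (simp only: F_def G_def mult_ac)
    have c: "L powr (2 * (s - t)) * L powr (2 * s) = L powr (4 * s - 2 * t)"
      by (simp add: algebra_simps flip: powr_add)
    have d: "h powr (- 8 * (s - t)) * h powr (- 2 * s) = h powr (- 2 * (5 * s - 4 * t))"
      by (simp add: algebra_simps flip: powr_add)
    have "m i powr (- 2 * s) * (E * F * G) = (m i powr (- 2 * s) * E) * (F * G)" by (simp only: mult.assoc)
    also have "\<dots> = m i powr (- 2 * (s + t)) * (L powr (4 * s - 2 * t) * h powr (- 2 * (5 * s - 4 * t)))"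
      by (simp only: a b c d)
    finally show ?thesis by (simp only: mult_ac)
  qed
  also have "\<dots> \<le> L powr (4 * s) * (\<Sum>i\<in>I. m i powr (- 2 * (s + t)) * h powr (- 2 * (5 * s - 4 * t)))"
  proof (rule mult_mono)
    show "L powr (4 * s - 2 * t) \<le> L powr (4 * s)" using L st by (intro powr_mono) auto
    show "m i powr (- 2 * (s + t)) * h powr (- 2 * (5 * s - 4 * t)) \<le> (\<Sum>i\<in>I. m i powr (- 2 * (s + t)) * h powr (- 2 * (5 * s - 4 * t)))"
      using i(1) I(1) by (intro member_le_sum) auto
  qed auto
  finally show ?thesis by (simp add: L_def)
qed

text \<open>Points of the moment curve: each nonzero linear form has at most two zeros on it.\<close>

lemma exists_common_nonzero:
  assumes "finite F" "\<And>a. a \<in> F \<Longrightarrow> a \<noteq> 0"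
  shows "\<exists>e. \<forall>a\<in>F. cdot a e \<noteq> 0"
proof -
  define q where "q a = [: a $ 1, a $ 2, a $ (3::3) :]" for a :: "complex ^ 3"
  have "finite (\<Union>a\<in>F. {t. poly (q a) t = 0})"
  proof (intro finite_UN_I assms(1) poly_roots_finite)
    fix a assume "a \<in> F"
    then show "q a \<noteq> 0" using assms(2)[of a] by (auto simp: q_def vec_eq_iff forall_3)
  qed
  then obtain t where t: "t \<notin> (\<Union>a\<in>F. {t. poly (q a) t = 0})"
    using ex_new_if_finite[OF infinite_UNIV_char_0] by blast
  have "cdot a (vector [1, t, t\<^sup>2]) = poly (q a) t" for a
    by (simp add: cdot_3 q_def power2_eq_square algebra_simps)
  then show ?thesis using t by (intro exI[of _ "vector [1, t, t\<^sup>2]"]) auto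
qed

lemma finite_common_constant:
  fixes P Q :: "'i \<Rightarrow> 'x \<Rightarrow> real"
  assumes "finite A" "\<And>a. a \<in> A \<Longrightarrow> \<exists>C. \<forall>\<^sub>F x in F. P a x \<le> C * Q a x" "\<And>a x. Q a x \<ge> 0"
  shows "\<exists>C\<ge>1. \<forall>\<^sub>F x in F. \<forall>a\<in>A. P a x \<le> C * Q a x"
  using assms(1,2)
proof (induction A rule: finite_induct)
  case empty
  then show ?case by (intro exI[of _ 1]) auto
next
  case (insert a A)
  obtain C where C: "\<forall>\<^sub>F x in F. P a x \<le> C * Q a x" using insert.prems by blast
  obtain D where D: "D \<ge> 1" "\<forall>\<^sub>F x in F. \<forall>a\<in>A. P a x \<le> D * Q a x" using insert.IH insert.prems by blast
  have le: "P b x \<le> max C D * Q b x" if "P b x \<le> E * Q b x" "E \<le> max C D" for b x E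
    using that assms(3)[of b x] by (meson mult_right_mono order_trans)
  have "\<forall>\<^sub>F x in F. \<forall>b\<in>insert a A. P b x \<le> max C D * Q b x"
    using C D(2) by eventually_elim (use le in auto)
  then show ?case using D(1) by (intro exI[of _ "max C D"]) auto
qed

lemma finite_common_radius:
  assumes "finite A" "\<And>a. a \<in> A \<Longrightarrow> \<exists>\<rho>>0::real. R a \<rho>"
    and "\<And>a \<rho> \<rho>'. R a \<rho> \<Longrightarrow> 0 < \<rho>' \<Longrightarrow> \<rho>' \<le> \<rho> \<Longrightarrow> R a \<rho>'"
  shows "\<exists>\<rho>>0. \<forall>a\<in>A. R a \<rho>"
  using assms(1,2)
proof (induction A rule: finite_induct)
  case empty
  then show ?case by (intro exI[of _ 1]) auto
next
  case (insert a A)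
  obtain \<rho> where \<rho>: "\<rho> > 0" "R a \<rho>" using insert.prems by blast
  obtain \<rho>' where \<rho>': "\<rho>' > 0" "\<forall>a\<in>A. R a \<rho>'" using insert.IH insert.prems by blast
  show ?case using \<rho> \<rho>' assms(3) by (intro exI[of _ "min \<rho> \<rho>'"]) (auto intro: assms(3)[of _ \<rho>] assms(3)[of _ \<rho>'])
qed

lemma AE_linear_form_nonzero:
  assumes "\<eta> \<noteq> 0"
  shows "AE x in lborel. cdot \<eta> x \<noteq> 0"
proof -
  define q :: tpoly where "q = (\<Sum>i\<in>UNIV. Poly_Mapping.single (Poly_Mapping.single i 1) (\<eta> $ i))"
  have q: "ev q x = cdot \<eta> x" for x by (simp add: q_def cdot_def mon_single)
  have "(\<Sum>j\<in>UNIV. lookup (Poly_Mapping.single (i::3) (1::nat)) j) = 1" for i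
    by (simp add: lookup_single when_def)
  then have "q \<in> homogeneous_piece 1"
    unfolding q_def by (intro homogeneous_piece_sum) (simp add: homogeneous_piece_def)
  moreover have "q \<noteq> 0"
  proof
    assume "q = 0"
    then have "cdot \<eta> (axis i 1) = 0" for i using q[of "axis i 1"] by simp
    then show False using assms by (simp add: vec_eq_iff)
  qed
  ultimately show ?thesis using AE_tpoly_eval_nonzero[of q 1] by (simp add: q)
qed

text \<open>The two conditions on \<open>t\<close> say that the exponents produced by \<open>branches_inequality\<close>, \<open>s + t\<close> for a branch and
  \<open>5 s - 4 t\<close> for the linear form, are integrable ones. They can be met exactly if \<open>s < 5 / 9\<close>.\<close>

lemma local_integrability:
  fixes g :: "nat \<Rightarrow> tpoly" and n :: nat
  assumes u: "\<And>v. ev u v \<noteq> 0"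
    and f: "\<And>v. ev f v = ev u v * (\<Prod>i<n. ev (g i) v)"
    and g: "\<And>i. i < n \<Longrightarrow> is_line (g i) \<or> is_smooth_conic (g i)"
    and ne: "\<And>i k \<kappa>. i < n \<Longrightarrow> k < n \<Longrightarrow> i \<noteq> k \<Longrightarrow> \<exists>v. ev (g i) v \<noteq> \<kappa> * ev (g k) v"
    and p: "p \<noteq> 0"
    and I_def: "I = {i. i < n \<and> ev (g i) p = 0}" and card: "card I \<le> 3"
    and tangent: "\<And>i. i \<in> I \<Longrightarrow> \<exists>k0. \<forall>k\<in>I. k \<noteq> i \<longrightarrow> k \<noteq> k0 \<longrightarrow> ccross (tgrad (g i) p) (tgrad (g k) p) \<noteq> 0"
    and st: "0 < t" "t < s" "s + t < 1" "5 * s - 4 * t < 1"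
  shows "\<exists>\<rho>>0. (\<integral>\<^sup>+x\<in>cball p \<rho>. ennreal ((cmod (ev f x))\<^sup>2 powr (- s)) \<partial>lborel) < \<infinity>"
proof -
  have finI: "finite I" by (simp add: I_def)
  have I: "i < n" "ev (g i) p = 0" if "i \<in> I" for i using that by (auto simp: I_def)
  define q where "q x = ev u x * (\<Prod>i\<in>{..<n} - I. ev (g i) x)" for x
  have fq: "ev f x = q x * (\<Prod>i\<in>I. ev (g i) x)" for x
  proof -
    have "I \<subseteq> {..<n}" by (auto simp: I_def)
    then have "(\<Prod>i<n. ev (g i) x) = (\<Prod>i\<in>{..<n} - I. ev (g i) x) * (\<Prod>i\<in>I. ev (g i) x)"
      by (intro prod.subset_diff) auto
    then show ?thesis by (simp add: f q_def)
  qed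
  have contq: "continuous_on UNIV q" unfolding q_def by (intro continuous_intros)
  have qp: "q p \<noteq> 0" using u by (auto simp: q_def I_def)
  define c where "c = cmod (q p) / 2"
  have c: "c > 0" using qp by (simp add: c_def)
  have evq: "\<forall>\<^sub>F x in nhds p. cmod (q x - q p) < c"
    using c by (intro eventually_cmod_less continuous_intros contq) auto
  have qc: "c \<le> cmod (q x)" if "cmod (q x - q p) < c" for x
    using that norm_triangle_ineq2[of "q p" "q x"] by (simp add: c_def norm_minus_commute)
  have weight: "(cmod (ev f x))\<^sup>2 powr (- s) \<le> c powr (- 2 * s) * (\<Prod>i\<in>I. cmod (ev (g i) x) powr (- 2 * s))"
    if "cmod (q x - q p) < c" for x
  proof -
    have "(cmod (ev f x))\<^sup>2 powr (- s) = cmod (ev f x) powr (- 2 * s)"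
    proof (cases "ev f x = 0")
      case False
      then have "(cmod (ev f x))\<^sup>2 = cmod (ev f x) powr 2" by simp
      then show ?thesis by (simp only: powr_powr) simp
    qed simp
    also have "\<dots> = cmod (q x) powr (- 2 * s) * (\<Prod>i\<in>I. cmod (ev (g i) x)) powr (- 2 * s)"
      by (simp add: fq norm_mult prod_norm[symmetric] powr_mult)
    also have "(\<Prod>i\<in>I. cmod (ev (g i) x)) powr (- 2 * s) = (\<Prod>i\<in>I. cmod (ev (g i) x) powr (- 2 * s))"
      by (rule prod_powr_distrib)
    also have "cmod (q x) powr (- 2 * s) * \<dots> \<le> c powr (- 2 * s) * \<dots>"
      using qc[OF that] c st by (intro mult_right_mono powr_mono2' prod_nonneg) auto
    finally show ?thesis .
  qed
  show ?thesis
  proof (cases "I = {}")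
    case True
    from evq obtain \<rho> where \<rho>: "\<rho> > 0" "\<And>x. dist x p < \<rho> \<Longrightarrow> cmod (q x - q p) < c"
      by (auto simp: eventually_nhds_metric)
    have "(\<integral>\<^sup>+x\<in>cball p (\<rho> / 2). ennreal ((cmod (ev f x))\<^sup>2 powr (- s)) \<partial>lborel) \<le>
      (\<integral>\<^sup>+x. ennreal (c powr (- 2 * s)) * indicator (cball p (\<rho> / 2)) x \<partial>lborel)"
    proof (rule nn_integral_mono)
      fix x
      show "ennreal ((cmod (ev f x))\<^sup>2 powr (- s)) * indicator (cball p (\<rho> / 2)) x \<le>
        ennreal (c powr (- 2 * s)) * indicator (cball p (\<rho> / 2)) x"
      proof (cases "x \<in> cball p (\<rho> / 2)")
        case x: True
        then have "dist x p < \<rho>" using \<rho>(1) by (simp add: dist_commute)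
        from weight[OF \<rho>(2)[OF this]] show ?thesis using True by (auto intro!: mult_right_mono ennreal_leI)
      qed simp
    qed
    also have "\<dots> = ennreal (c powr (- 2 * s)) * emeasure lborel (cball p (\<rho> / 2))"
      by (simp add: nn_integral_cmult_indicator)
    also have "\<dots> < \<infinity>"
      using emeasure_bounded_finite[of "cball p (\<rho> / 2)"] by (simp add: ennreal_mult_less_top)
    finally show ?thesis using \<rho>(1) by (intro exI[of _ "\<rho> / 2"]) auto
  next
    case False
    define N where "N i = tgrad (g i) p" for i
    have N0: "N i \<noteq> 0" if "i \<in> I" for i unfolding N_def using gradient_nonzero g I p that by blast
    have Np: "cdot (N i) p = 0" if i: "i \<in> I" for i
    proof -
      obtain j where "g i \<in> homogeneous_piece j" using g[OF I(1)[OF i]] by (auto simp: is_line_def is_smooth_conic_def)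
      from tpoly_euler[OF this, of p] show ?thesis using I(2)[OF i] by (simp add: N_def)
    qed
    \<comment> \<open>A direction tangent to none of the branches, and a linear form \<open>\<eta>\<close> that vanishes at \<open>p\<close> and along \<open>e\<close>.\<close>
    have "\<exists>e. \<forall>a\<in>N ` I. cdot a e \<noteq> 0" using finI N0 by (intro exists_common_nonzero) auto
    then obtain e where e: "\<And>i. i \<in> I \<Longrightarrow> cdot (N i) e \<noteq> 0" by blast
    obtain i0 where i0: "i0 \<in> I" using False by blast
    have e0: "e \<noteq> 0" using e[OF i0] by auto
    define \<eta> where "\<eta> = ccross p e"
    have \<eta>p: "cdot \<eta> p = 0" and \<eta>e: "cdot \<eta> e = 0" by (simp_all add: \<eta>_def cdot_3 algebra_simps)
    have \<eta>0: "\<eta> \<noteq> 0"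
    proof
      assume "\<eta> = 0"
      then obtain \<kappa> where \<kappa>: "p = \<kappa> *s e" using ccross_0D[of p e] e0 by (auto simp: \<eta>_def)
      then have "\<kappa> * cdot (N i0) e = 0" using Np[OF i0] by simp
      then show False using e[OF i0] \<kappa> p by simp
    qed
    have ind: "ccross (N i) \<eta> \<noteq> 0" if "i \<in> I" for i
    proof
      assume "ccross (N i) \<eta> = 0"
      then obtain \<kappa> where "N i = \<kappa> *s \<eta>" using ccross_0D \<eta>0 by blast
      then show False using e[OF that] \<eta>e by simp
    qed
    let ?m = "\<lambda>i x. cmod (ev (g i) x)" and ?h = "\<lambda>x. cmod (cdot \<eta> x)"
    have "\<exists>C\<ge>1. \<forall>\<^sub>F x in nhds p. \<forall>z\<in>{z \<in> I \<times> I. fst z \<noteq> snd z}. ?h x ^ 4 \<le> C * (?m (fst z) x + ?m (snd z) x)"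
    proof (rule finite_common_constant)
      fix z assume "z \<in> {z \<in> I \<times> I. fst z \<noteq> snd z}"
      then obtain i k where z: "z = (i, k)" "i \<in> I" "k \<in> I" "k \<noteq> i" by (cases z) auto
      have "\<exists>v. ev (g k) v \<noteq> \<kappa> * ev (g i) v" for \<kappa>
        by (rule ne[OF I(1)[OF z(3)] I(1)[OF z(2)] z(4)])
      from contact_at_most_four[OF g[OF I(1)[OF z(2)]] I(2)[OF z(2)] g[OF I(1)[OF z(3)]] I(2)[OF z(3)] this p \<eta>p
          ind[OF z(2), unfolded N_def]]
      show "\<exists>C. \<forall>\<^sub>F x in nhds p. ?h x ^ 4 \<le> C * (?m (fst z) x + ?m (snd z) x)" by (simp add: z)
    qed (use finI in auto)
    then obtain C1 where C1: "C1 \<ge> 1" "\<forall>\<^sub>F x in nhds p. \<forall>z\<in>{z \<in> I \<times> I. fst z \<noteq> snd z}. ?h x ^ 4 \<le> C1 * (?m (fst z) x + ?m (snd z) x)"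
      by blast
    have "\<exists>C\<ge>1. \<forall>\<^sub>F x in nhds p. \<forall>z\<in>{z \<in> I \<times> I. ccross (N (fst z)) (N (snd z)) \<noteq> 0}. ?h x \<le> C * (?m (fst z) x + ?m (snd z) x)"
    proof (rule finite_common_constant)
      fix z assume z: "z \<in> {z \<in> I \<times> I. ccross (N (fst z)) (N (snd z)) \<noteq> 0}"
      have hom: "\<exists>j. g i \<in> homogeneous_piece j" if "i \<in> I" for i
        using g[OF I(1)[OF that]] by (auto simp: is_line_def is_smooth_conic_def)
      obtain j k where "g (fst z) \<in> homogeneous_piece j" "g (snd z) \<in> homogeneous_piece k" using hom z by fastforce
      then show "\<exists>C. \<forall>\<^sub>F x in nhds p. ?h x \<le> C * (?m (fst z) x + ?m (snd z) x)"
        using z I p \<eta>p by (intro transversal_estimate) (auto simp: N_def)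
    qed (use finI in auto)
    then obtain C2 where C2: "C2 \<ge> 1" "\<forall>\<^sub>F x in nhds p. \<forall>z\<in>{z \<in> I \<times> I. ccross (N (fst z)) (N (snd z)) \<noteq> 0}. ?h x \<le> C2 * (?m (fst z) x + ?m (snd z) x)"
      by blast
    have evm: "\<forall>\<^sub>F x in nhds p. \<forall>i\<in>I. ?m i x < 1"
      using I finI by (intro eventually_ball_finite ballI eventually_cmod_less continuous_intros) auto
    have evh: "\<forall>\<^sub>F x in nhds p. ?h x < 1"
      using \<eta>p by (intro eventually_cmod_less continuous_intros) auto
    define C where "C = max C1 C2"
    from C1(2) C2(2) evm evh evq have "\<forall>\<^sub>F x in nhds p. (\<forall>i\<in>I. \<forall>k\<in>I. i \<noteq> k \<longrightarrow> ?h x ^ 4 \<le> C * (?m i x + ?m k x)) \<and>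
       (\<forall>i\<in>I. \<forall>k\<in>I. ccross (N i) (N k) \<noteq> 0 \<longrightarrow> ?h x \<le> C * (?m i x + ?m k x)) \<and>
       (\<forall>i\<in>I. ?m i x < 1) \<and> ?h x < 1 \<and> cmod (q x - q p) < c"
    proof eventually_elim
      case (elim x)
      have "C1 * (?m i x + ?m k x) \<le> C * (?m i x + ?m k x)" "C2 * (?m i x + ?m k x) \<le> C * (?m i x + ?m k x)" for i k
        by (intro mult_right_mono; simp add: C_def)+
      note up = order_trans[OF _ this(1)] order_trans[OF _ this(2)]
      have "?h x ^ 4 \<le> C * (?m i x + ?m k x)" if "i \<in> I" "k \<in> I" "i \<noteq> k" for i k
        using elim(1) that by (intro up(1)) force
      moreover have "?h x \<le> C * (?m i x + ?m k x)" if "i \<in> I" "k \<in> I" "ccross (N i) (N k) \<noteq> 0" for i k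
        using elim(2) that by (intro up(2)) force
      ultimately show ?case using elim(3-5) by blast
    qed
    then obtain \<rho>0 where \<rho>0: "\<rho>0 > 0" and near: "\<And>x. dist x p < \<rho>0 \<Longrightarrow> (\<forall>i\<in>I. \<forall>k\<in>I. i \<noteq> k \<longrightarrow> ?h x ^ 4 \<le> C * (?m i x + ?m k x)) \<and>
       (\<forall>i\<in>I. \<forall>k\<in>I. ccross (N i) (N k) \<noteq> 0 \<longrightarrow> ?h x \<le> C * (?m i x + ?m k x)) \<and>
       (\<forall>i\<in>I. ?m i x < 1) \<and> ?h x < 1 \<and> cmod (q x - q p) < c"
      unfolding eventually_nhds_metric by metis
    define R where "R i \<rho> \<longleftrightarrow> (\<forall>x t t'. x + t *s e \<in> cball p \<rho> \<longrightarrow> x + t' *s e \<in> cball p \<rho> \<longrightarrow>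
       cmod (cdot (N i) e) / 2 * cmod (t - t') \<le> cmod (ev (g i) (x + t *s e) - ev (g i) (x + t' *s e)))" for i \<rho>
    have "\<exists>\<rho>>0. R i \<rho>" if i: "i \<in> I" for i
    proof -
      have "0 < cmod (cdot (N i) e) / (2 * norm e)" using e[OF i] e0 by simp
      then obtain \<rho> where \<rho>: "\<rho> > 0" "\<And>x y. x \<in> cball p \<rho> \<Longrightarrow> y \<in> cball p \<rho> \<Longrightarrow>
        cmod (ev (g i) x - ev (g i) y - cdot (N i) (x - y)) \<le> cmod (cdot (N i) e) / (2 * norm e) * norm (x - y)"
        unfolding N_def by (metis tpoly_strictly_differentiable)
      have "R i \<rho>" unfolding R_def
      proof (intro allI impI)
        fix x t t' assume xt: "x + t *s e \<in> cball p \<rho>" "x + t' *s e \<in> cball p \<rho>"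
        let ?d = "ev (g i) (x + t *s e) - ev (g i) (x + t' *s e)"
        have d: "x + t *s e - (x + t' *s e) = (t - t') *s e" by (simp add: algebra_simps)
        have "cmod (?d - (t - t') * cdot (N i) e) \<le> cmod (cdot (N i) e) / (2 * norm e) * (cmod (t - t') * norm e)"
          using \<rho>(2)[OF xt] unfolding d by (simp only: norm_vscale cdot_simps(8))
        also have "\<dots> = cmod (cdot (N i) e) / 2 * cmod (t - t')" using e0 by simp
        finally have "cmod (?d - (t - t') * cdot (N i) e) \<le> cmod (cdot (N i) e) / 2 * cmod (t - t')" .
        moreover have "cmod (cdot (N i) e) * cmod (t - t') \<le> cmod ?d + cmod (?d - (t - t') * cdot (N i) e)"
          using norm_triangle_ineq4[of ?d "?d - (t - t') * cdot (N i) e"] by (simp add: norm_mult mult.commute)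
        ultimately show "cmod (cdot (N i) e) / 2 * cmod (t - t') \<le> cmod ?d" by simp
      qed
      then show ?thesis using \<rho>(1) by blast
    qed
    moreover have "R i \<rho>'" if "R i \<rho>" "0 < \<rho>'" "\<rho>' \<le> \<rho>" for i \<rho> \<rho>'
      using that by (auto simp: R_def)
    ultimately obtain \<rho>1 where \<rho>1: "\<rho>1 > 0" "\<And>i. i \<in> I \<Longrightarrow> R i \<rho>1"
      using finite_common_radius[of I R] finI by metis
    define \<rho> where "\<rho> = min (\<rho>0 / 2) \<rho>1"
    have \<rho>: "\<rho> > 0" using \<rho>0 \<rho>1 by (simp add: \<rho>_def)
    define T where "T i x = ?m i x powr (- 2 * (s + t)) * ?h x powr (- 2 * (5 * s - 4 * t))" for i x
    define M where "M = c powr (- 2 * s) * (2 * C) powr (4 * s)"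
    have M: "M \<ge> 0" by (simp add: M_def)
    have fin: "(\<integral>\<^sup>+x\<in>cball p \<rho>. ennreal (T i x) \<partial>lborel) < \<infinity>" if i: "i \<in> I" for i
      unfolding T_def
    proof (rule nn_integral_line_powr[where c = "cmod (cdot (N i) e) / 2"])
      show "cmod (cdot (N i) e) / 2 * cmod (t - t') \<le> cmod (ev (g i) (x + t *s e) - ev (g i) (x + t' *s e))"
        if "x + t *s e \<in> cball p \<rho>" "x + t' *s e \<in> cball p \<rho>" for x t t'
        using \<rho>1(2)[OF i] that by (auto simp: R_def \<rho>_def)
    qed (use st e[OF i] \<eta>0 \<eta>e in \<open>auto intro!: continuous_intros\<close>)
    have ae: "AE x in lborel. (\<forall>i\<in>I. ev (g i) x \<noteq> 0) \<and> cdot \<eta> x \<noteq> 0"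
    proof -
      have "AE x in lborel. ev (g i) x \<noteq> 0" if "i \<in> I" for i
        using g[OF I(1)[OF that]] AE_tpoly_eval_nonzero by (auto simp: is_line_def is_smooth_conic_def)
      then have "AE x in lborel. \<forall>i\<in>I. ev (g i) x \<noteq> 0" using finI by (intro AE_finite_allI) auto
      then show ?thesis using AE_linear_form_nonzero[OF \<eta>0] by eventually_elim auto
    qed
    have [measurable]: "T i \<in> borel_measurable borel" for i
    proof -
      have [measurable]: "ev (g i) \<in> borel_measurable borel" "cdot \<eta> \<in> borel_measurable borel"
        by (intro borel_measurable_continuous_onI continuous_intros)+
      show ?thesis unfolding T_def by measurable
    qed
    have [measurable]: "cball p \<rho> \<in> sets borel" by simp
    have "(\<integral>\<^sup>+x\<in>cball p \<rho>. ennreal ((cmod (ev f x))\<^sup>2 powr (- s)) \<partial>lborel) \<le>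
      (\<integral>\<^sup>+x. ennreal M * (\<Sum>i\<in>I. ennreal (T i x) * indicator (cball p \<rho>) x) \<partial>lborel)"
    proof (rule nn_integral_mono_AE)
      show "AE x in lborel. ennreal ((cmod (ev f x))\<^sup>2 powr (- s)) * indicator (cball p \<rho>) x \<le>
         ennreal M * (\<Sum>i\<in>I. ennreal (T i x) * indicator (cball p \<rho>) x)"
        using ae
      proof eventually_elim
        case (elim x)
        show ?case
        proof (cases "x \<in> cball p \<rho>")
          case True
          then have "dist x p < \<rho>0" using \<rho>0 by (auto simp: \<rho>_def dist_commute)
          note n = near[OF this]
          have "(\<Prod>i\<in>I. ?m i x powr (- 2 * s)) \<le> (2 * C) powr (4 * s) * (\<Sum>i\<in>I. T i x)"
            unfolding T_def
          proof (rule branches_inequality[OF finI card False])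
            show "C \<ge> 1" using C1(1) by (simp add: C_def)
            show "\<exists>k0. \<forall>k\<in>I. k \<noteq> i \<longrightarrow> k \<noteq> k0 \<longrightarrow> ?h x \<le> C * (?m i x + ?m k x)" if "i \<in> I" for i
              using tangent[OF that] n that unfolding N_def by blast
          qed (use n elim st in \<open>auto simp: less_imp_le\<close>)
          then have "(cmod (ev f x))\<^sup>2 powr (- s) \<le> c powr (- 2 * s) * ((2 * C) powr (4 * s) * (\<Sum>i\<in>I. T i x))"
            using n by (intro order_trans[OF weight] mult_left_mono) auto
          then have "ennreal ((cmod (ev f x))\<^sup>2 powr (- s)) \<le> ennreal (M * (\<Sum>i\<in>I. T i x))"
            by (intro ennreal_leI) (simp add: M_def mult.assoc)
          also have "\<dots> = ennreal M * (\<Sum>i\<in>I. ennreal (T i x))"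
          proof -
            have "T i x \<ge> 0" for i by (simp add: T_def)
            then have "(\<Sum>i\<in>I. ennreal (T i x)) = ennreal (\<Sum>i\<in>I. T i x)" by simp
            then show ?thesis using M by (simp only: ennreal_mult')
          qed
          finally show ?thesis using True by simp
        qed simp
      qed
    qed
    also have "\<dots> = ennreal M * (\<Sum>i\<in>I. \<integral>\<^sup>+x\<in>cball p \<rho>. ennreal (T i x) \<partial>lborel)"
      by (subst nn_integral_cmult) (auto simp: nn_integral_sum)
    also have "\<dots> < \<infinity>"
      using fin finI by (auto simp: ennreal_mult_less_top)
    finally show ?thesis using \<rho> by blast
  qed
qed

lemma nn_integral_compact_finite:
  fixes W :: "complex ^ 3 \<Rightarrow> ennreal"
  assumes [measurable]: "W \<in> borel_measurable borel" and K: "compact K"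
    and loc: "\<And>p. p \<in> K \<Longrightarrow> \<exists>\<rho>>0. (\<integral>\<^sup>+x\<in>cball p \<rho>. W x \<partial>lborel) < \<infinity>"
  shows "(\<integral>\<^sup>+x\<in>K. W x \<partial>lborel) < \<infinity>"
proof -
  from loc obtain \<rho> where \<rho>: "\<And>p. p \<in> K \<Longrightarrow> \<rho> p > 0" "\<And>p. p \<in> K \<Longrightarrow> (\<integral>\<^sup>+x\<in>cball p (\<rho> p). W x \<partial>lborel) < \<infinity>"
    by metis
  have "K \<subseteq> (\<Union>p\<in>K. ball p (\<rho> p))" using \<rho>(1) by force
  then obtain D where D: "D \<subseteq> K" "finite D" "K \<subseteq> (\<Union>p\<in>D. ball p (\<rho> p))"
    using compactE_image[OF K, of K "\<lambda>p. ball p (\<rho> p)"] by auto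
  have [measurable]: "cball p (\<rho> p) \<in> sets borel" for p by simp
  have "(\<integral>\<^sup>+x\<in>K. W x \<partial>lborel) \<le> (\<integral>\<^sup>+x. (\<Sum>p\<in>D. W x * indicator (cball p (\<rho> p)) x) \<partial>lborel)"
  proof (rule nn_integral_mono)
    fix x
    show "W x * indicator K x \<le> (\<Sum>p\<in>D. W x * indicator (cball p (\<rho> p)) x)"
    proof (cases "x \<in> K")
      case True
      then obtain p where p: "p \<in> D" "x \<in> cball p (\<rho> p)" using D(3) by (force simp: less_imp_le)
      have "W x = W x * indicator (cball p (\<rho> p)) x" using p by simp
      also have "\<dots> \<le> (\<Sum>p\<in>D. W x * indicator (cball p (\<rho> p)) x)"
        using p(1) D(2) by (intro member_le_sum) auto
      finally show ?thesis using True by simp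
    qed simp
  qed
  also have "\<dots> = (\<Sum>p\<in>D. \<integral>\<^sup>+x\<in>cball p (\<rho> p). W x \<partial>lborel)" by (rule nn_integral_sum) measurable
  also have "\<dots> < \<infinity>" using \<rho>(2) D by (auto intro!: ennreal_sum_less_top)
  finally show ?thesis .
qed

section \<open>Branches of ADE singularities\<close>

lemma holomorphic_vanishing_order:
  assumes S: "S holomorphic_on ball 0 r" "r > 0" "S 0 = 0" and D: "(S has_field_derivative D) (at 0)"
  shows "\<exists>C>0. \<forall>\<^sub>F \<tau> in at 0. cmod (S \<tau>) \<le> C * cmod \<tau>"
    and "D = 0 \<Longrightarrow> \<exists>C>0. \<forall>\<^sub>F \<tau> in at 0. cmod (S \<tau>) \<le> C * cmod \<tau> ^ 2"
    and "D \<noteq> 0 \<Longrightarrow> \<exists>C>0. \<forall>\<^sub>F \<tau> in at 0. cmod \<tau> \<le> C * cmod (S \<tau>)"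
proof -
  have lim: "((\<lambda>\<tau>. S \<tau> / \<tau>) \<longlongrightarrow> D) (at 0)"
    using D S(3) by (simp add: has_field_derivative_iff)
  have "\<forall>\<^sub>F \<tau> in at 0. dist (S \<tau> / \<tau>) D < 1" using lim by (rule tendstoD) simp
  moreover have "\<forall>\<^sub>F \<tau> in at (0::complex). \<tau> \<noteq> 0" by (simp add: eventually_at_filter)
  ultimately have "\<forall>\<^sub>F \<tau> in at 0. cmod (S \<tau>) \<le> (cmod D + 1) * cmod \<tau>"
  proof eventually_elim
    case (elim \<tau>)
    have "cmod (S \<tau> / \<tau>) \<le> cmod D + 1" using elim(1) norm_triangle_ineq2[of "S \<tau> / \<tau>" D] by (simp add: dist_norm)
    then show ?case using elim(2) by (simp add: norm_divide field_simps)
  qed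
  then show "\<exists>C>0. \<forall>\<^sub>F \<tau> in at 0. cmod (S \<tau>) \<le> C * cmod \<tau>"
    by (intro exI[of _ "cmod D + 1"]) (auto intro: add_nonneg_pos)
  show "\<exists>C>0. \<forall>\<^sub>F \<tau> in at 0. cmod \<tau> \<le> C * cmod (S \<tau>)" if "D \<noteq> 0"
  proof -
    have "\<forall>\<^sub>F \<tau> in at 0. dist (S \<tau> / \<tau>) D < cmod D / 2" using lim by (rule tendstoD) (use that in simp)
    moreover have "\<forall>\<^sub>F \<tau> in at (0::complex). \<tau> \<noteq> 0" by (simp add: eventually_at_filter)
    ultimately have "\<forall>\<^sub>F \<tau> in at 0. cmod \<tau> \<le> (2 / cmod D) * cmod (S \<tau>)"
    proof eventually_elim
      case (elim \<tau>)
      have "cmod D / 2 \<le> cmod (S \<tau> / \<tau>)" using elim(1) norm_triangle_ineq2[of D "S \<tau> / \<tau>"] by (simp add: dist_norm norm_minus_commute)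
      then show ?case using elim(2) that by (simp add: norm_divide field_simps)
    qed
    then show ?thesis using that by (intro exI[of _ "2 / cmod D"]) auto
  qed
  show "\<exists>C>0. \<forall>\<^sub>F \<tau> in at 0. cmod (S \<tau>) \<le> C * cmod \<tau> ^ 2" if "D = 0"
  proof -
    have d: "((deriv ^^ i) S has_field_derivative (deriv ^^ Suc i) S z) (at z)" if "z \<in> ball 0 r" for i z
      using holomorphic_derivI[OF holomorphic_higher_deriv[OF S(1) open_ball] open_ball that] by simp
    have "continuous_on (cball 0 (r / 2)) ((deriv ^^ 2) S)"
    proof (rule continuous_on_subset)
      show "continuous_on (ball 0 r) ((deriv ^^ 2) S)"
        by (rule holomorphic_on_imp_continuous_on[OF holomorphic_higher_deriv[OF S(1) open_ball]])
      show "cball 0 (r / 2) \<subseteq> ball (0::complex) r" using S(2) by auto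
    qed
    then have "bounded ((deriv ^^ 2) S ` cball 0 (r / 2))"
      by (intro compact_imp_bounded compact_continuous_image) auto
    then obtain B where B: "B > 0" "\<And>z. z \<in> cball 0 (r / 2) \<Longrightarrow> cmod ((deriv ^^ 2) S z) \<le> B" by (auto simp: bounded_pos)
    have "deriv S 0 = 0" using D that by (simp add: DERIV_imp_deriv)
    have "cmod (S \<tau>) \<le> B * cmod \<tau> ^ 2" if \<tau>: "\<tau> \<in> cball 0 (r / 2)" for \<tau>
    proof -
      have "cmod ((deriv ^^ 0) S \<tau> - (\<Sum>i\<le>1. (deriv ^^ i) S 0 * (\<tau> - 0) ^ i / fact i)) \<le> B * cmod (\<tau> - 0) ^ Suc 1 / fact 1"
      proof (rule complex_Taylor[of "cball 0 (r / 2)" 1 "\<lambda>i. (deriv ^^ i) S"])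
        show "((deriv ^^ i) S has_field_derivative (deriv ^^ Suc i) S z) (at z within cball 0 (r / 2))"
          if "z \<in> cball 0 (r / 2)" for i z
          using that S(2) by (intro has_field_derivative_at_within[OF d]) auto
        show "cmod ((deriv ^^ Suc 1) S z) \<le> B" if "z \<in> cball 0 (r / 2)" for z
          using B(2)[OF that] by (simp add: numeral_2_eq_2)
      qed (use \<tau> S(2) in auto)
      then show ?thesis using S(3) \<open>deriv S 0 = 0\<close> by (simp add: power2_eq_square)
    qed
    moreover have "\<forall>\<^sub>F \<tau> in at 0. \<tau> \<in> cball (0::complex) (r / 2)"
      using S(2) by (auto simp: eventually_at intro!: exI[of _ "r / 2"] less_imp_le)
    ultimately show ?thesis using B(1) by (intro exI[of _ B]) (auto elim: eventually_mono)
  qed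
qed

text \<open>Curves in the domain of a coordinate change are used to stay within holomorphic functions of one variable.\<close>

lemma holomorphic2_on_has_derivative_compose:
  assumes F: "(F has_derivative (\<lambda>h. a * fst h + b * snd h)) (at (c1 \<tau>, c2 \<tau>))"
    and c: "(c1 has_field_derivative v1) (at \<tau>)" "(c2 has_field_derivative v2) (at \<tau>)"
  shows "((\<lambda>\<tau>. F (c1 \<tau>, c2 \<tau>)) has_field_derivative (a * v1 + b * v2)) (at \<tau>)"
proof -
  have "((\<lambda>\<tau>. (c1 \<tau>, c2 \<tau>)) has_derivative (\<lambda>h. (v1 * h, v2 * h))) (at \<tau>)"
    using c by (intro has_derivative_Pair) (auto simp: has_field_derivative_def)
  from has_derivative_compose[OF this F]
  have "((\<lambda>\<tau>. F (c1 \<tau>, c2 \<tau>)) has_derivative (\<lambda>h. a * (v1 * h) + b * (v2 * h))) (at \<tau>)" by simp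
  moreover have "(\<lambda>h. a * (v1 * h) + b * (v2 * h)) = (*) (a * v1 + b * v2)" by (auto simp: algebra_simps)
  ultimately show ?thesis by (simp add: has_field_derivative_def)
qed

lemma holomorphic2_on_continuous: "holomorphic2_on F U \<Longrightarrow> z \<in> U \<Longrightarrow> isCont F z"
  unfolding holomorphic2_on_def using has_derivative_continuous by blast

text \<open>The germ of \<open>f\<close> at \<open>p\<close>, written in the affine chart \<open>p + x a + y b\<close> and transformed by \<open>\<Phi>\<close> into a unit \<open>w\<close> times \<open>G\<close>.\<close>

locale ade_point =
  fixes f u :: tpoly and g :: "nat \<Rightarrow> tpoly" and n :: nat and p a b :: "complex ^ 3"
    and \<Phi> :: "complex \<times> complex \<Rightarrow> complex \<times> complex" and U :: "(complex \<times> complex) set"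
    and w G :: "complex \<times> complex \<Rightarrow> complex"
  assumes u: "\<And>v. ev u v \<noteq> 0"
    and f: "\<And>v. ev f v = ev u v * (\<Prod>i<n. ev (g i) v)"
    and U: "open U" "(0, 0) \<in> U" "\<Phi> (0, 0) = (0, 0)"
    and \<Phi>: "holomorphic2_on (fst \<circ> \<Phi>) U" "holomorphic2_on (snd \<circ> \<Phi>) U"
    and w: "holomorphic2_on w U"
    and eq: "\<And>z. z \<in> U \<Longrightarrow> w z \<noteq> 0 \<and> ev f (p + fst (\<Phi> z) *s a + snd (\<Phi> z) *s b) = w z * G z"
begin

definition I :: "nat set" where "I = {i. i < n \<and> ev (g i) p = 0}"

lemma finI: "finite I" by (simp add: I_def)

text \<open>The \<open>k\<close>-th component, pulled back to the curve \<open>(c1, c2)\<close> in the coordinates of the normal form.\<close>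

definition branch :: "nat \<Rightarrow> (complex \<Rightarrow> complex) \<Rightarrow> (complex \<Rightarrow> complex) \<Rightarrow> complex \<Rightarrow> complex" where
  "branch k c1 c2 \<tau> = ev (g k) (p + fst (\<Phi> (c1 \<tau>, c2 \<tau>)) *s a + snd (\<Phi> (c1 \<tau>, c2 \<tau>)) *s b)"

lemma curve_near:
  assumes c: "c1 holomorphic_on UNIV" "c2 holomorphic_on UNIV" "c1 0 = 0" "c2 0 = 0"
  obtains r where "r > 0" "\<And>\<tau>. \<tau> \<in> ball 0 r \<Longrightarrow> (c1 \<tau>, c2 \<tau>) \<in> U"
proof -
  have "continuous_on UNIV (\<lambda>\<tau>. (c1 \<tau>, c2 \<tau>))"
    by (intro continuous_on_Pair holomorphic_on_imp_continuous_on c)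
  then have "open ((\<lambda>\<tau>. (c1 \<tau>, c2 \<tau>)) -` U)" using U by (intro open_vimage)
  moreover have "0 \<in> (\<lambda>\<tau>. (c1 \<tau>, c2 \<tau>)) -` U" using U c by simp
  ultimately obtain r where "r > 0" "ball 0 r \<subseteq> (\<lambda>\<tau>. (c1 \<tau>, c2 \<tau>)) -` U" using openE by blast
  then show thesis by (intro that[of r]) auto
qed

text \<open>The chain rule: the point of \<open>\<complex>\<^sup>3\<close> moves with a velocity linear in the initial direction of the curve. That
  \<open>X\<close> and \<open>Y\<close> serve all branches at once is what makes tangency visible in the coordinates of the normal form.\<close>

lemma branch_derivative:
  "\<exists>X Y. \<forall>k\<in>I. \<forall>c1 c2 v1 v2. c1 holomorphic_on UNIV \<longrightarrow> c2 holomorphic_on UNIV \<longrightarrow> c1 0 = 0 \<longrightarrow> c2 0 = 0 \<longrightarrow>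
     (c1 has_field_derivative v1) (at 0) \<longrightarrow> (c2 has_field_derivative v2) (at 0) \<longrightarrow>
     branch k c1 c2 0 = 0 \<and> (branch k c1 c2 has_field_derivative (v1 * cdot (tgrad (g k) p) X + v2 * cdot (tgrad (g k) p) Y)) (at 0) \<and>
     (\<exists>r>0. branch k c1 c2 holomorphic_on ball 0 r)"
proof -
  obtain a1 b1 where 1: "((fst \<circ> \<Phi>) has_derivative (\<lambda>h. a1 * fst h + b1 * snd h)) (at (0, 0))"
    using \<Phi>(1) U(2) unfolding holomorphic2_on_def by blast
  obtain a2 b2 where 2: "((snd \<circ> \<Phi>) has_derivative (\<lambda>h. a2 * fst h + b2 * snd h)) (at (0, 0))"
    using \<Phi>(2) U(2) unfolding holomorphic2_on_def by blast
  define X where "X = a1 *s a + a2 *s b"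
  define Y where "Y = b1 *s a + b2 *s b"
  show ?thesis
  proof (rule exI[of _ X], rule exI[of _ Y], intro ballI allI impI)
    fix k c1 c2 v1 v2
    assume k: "k \<in> I" and c: "c1 holomorphic_on UNIV" "c2 holomorphic_on UNIV" "c1 0 = 0" "c2 0 = 0"
      and v: "(c1 has_field_derivative v1) (at 0)" "(c2 has_field_derivative v2) (at 0)"
    have bl: "bounded_linear (\<lambda>t. t *s y)" for y :: "complex ^ 3"
      by (rule bounded_linear_intro[where K = "norm y"]) (auto simp: norm_vscale vec_eq_iff algebra_simps)
    have der: "(branch k c1 c2 has_field_derivative (cdot (tgrad (g k) (p + fst (\<Phi> (c1 \<tau>, c2 \<tau>)) *s a + snd (\<Phi> (c1 \<tau>, c2 \<tau>)) *s b)) (x' *s a + y' *s b))) (at \<tau>)"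
      if "((\<lambda>\<tau>. (fst \<circ> \<Phi>) (c1 \<tau>, c2 \<tau>)) has_field_derivative x') (at \<tau>)" "((\<lambda>\<tau>. (snd \<circ> \<Phi>) (c1 \<tau>, c2 \<tau>)) has_field_derivative y') (at \<tau>)"
      for \<tau> x' y'
    proof -
      have "((\<lambda>\<tau>. p + fst (\<Phi> (c1 \<tau>, c2 \<tau>)) *s a + snd (\<Phi> (c1 \<tau>, c2 \<tau>)) *s b) has_derivative (\<lambda>h. 0 + (x' * h) *s a + (y' * h) *s b)) (at \<tau>)"
        using that unfolding has_field_derivative_def comp_def
        by (intro has_derivative_add has_derivative_const bounded_linear.has_derivative[OF bl])
      from has_derivative_compose[OF this tpoly_eval_has_derivative[of "g k"]]
      have "(branch k c1 c2 has_derivative (\<lambda>h. cdot (tgrad (g k) (p + fst (\<Phi> (c1 \<tau>, c2 \<tau>)) *s a + snd (\<Phi> (c1 \<tau>, c2 \<tau>)) *s b)) (0 + (x' * h) *s a + (y' * h) *s b))) (at \<tau>)"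
        unfolding branch_def[abs_def] .
      then show ?thesis unfolding has_field_derivative_def
        by (rule has_derivative_eq_rhs) (auto simp: algebra_simps)
    qed
    have "branch k c1 c2 0 = 0" using k c U(3) by (simp add: branch_def I_def)
    moreover have "(branch k c1 c2 has_field_derivative (v1 * cdot (tgrad (g k) p) X + v2 * cdot (tgrad (g k) p) Y)) (at 0)"
    proof -
      have "((\<lambda>\<tau>. (fst \<circ> \<Phi>) (c1 \<tau>, c2 \<tau>)) has_field_derivative (a1 * v1 + b1 * v2)) (at 0)"
        "((\<lambda>\<tau>. (snd \<circ> \<Phi>) (c1 \<tau>, c2 \<tau>)) has_field_derivative (a2 * v1 + b2 * v2)) (at 0)"
      proof -
        have z: "(c1 0, c2 0) = (0, 0)" using c by simp
        note h = holomorphic2_on_has_derivative_compose[where \<tau> = 0 and ?c1.0 = c1 and ?c2.0 = c2, unfolded z, OF _ v]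
        show "((\<lambda>\<tau>. (fst \<circ> \<Phi>) (c1 \<tau>, c2 \<tau>)) has_field_derivative (a1 * v1 + b1 * v2)) (at 0)" by (rule h[OF 1])
        show "((\<lambda>\<tau>. (snd \<circ> \<Phi>) (c1 \<tau>, c2 \<tau>)) has_field_derivative (a2 * v1 + b2 * v2)) (at 0)" by (rule h[OF 2])
      qed
      from der[OF this] show ?thesis using c U(3) by (simp add: X_def Y_def algebra_simps)
    qed
    moreover have "\<exists>r>0. branch k c1 c2 holomorphic_on ball 0 r"
    proof -
      obtain r where r: "r > 0" "\<And>\<tau>. \<tau> \<in> ball 0 r \<Longrightarrow> (c1 \<tau>, c2 \<tau>) \<in> U" using curve_near[OF c] by blast
      have "\<exists>D. (branch k c1 c2 has_field_derivative D) (at \<tau>)" if \<tau>: "\<tau> \<in> ball 0 r" for \<tau>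
      proof -
        obtain a1 b1 where 1: "((fst \<circ> \<Phi>) has_derivative (\<lambda>h. a1 * fst h + b1 * snd h)) (at (c1 \<tau>, c2 \<tau>))"
          using \<Phi>(1) r(2)[OF \<tau>] unfolding holomorphic2_on_def by blast
        obtain a2 b2 where 2: "((snd \<circ> \<Phi>) has_derivative (\<lambda>h. a2 * fst h + b2 * snd h)) (at (c1 \<tau>, c2 \<tau>))"
          using \<Phi>(2) r(2)[OF \<tau>] unfolding holomorphic2_on_def by blast
        have "(c1 has_field_derivative deriv c1 \<tau>) (at \<tau>)" "(c2 has_field_derivative deriv c2 \<tau>) (at \<tau>)"
          using c by (auto intro: holomorphic_derivI)
        from der[OF holomorphic2_on_has_derivative_compose[OF 1 this] holomorphic2_on_has_derivative_compose[OF 2 this]]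
        show ?thesis by blast
      qed
      then have "branch k c1 c2 holomorphic_on ball 0 r"
        by (auto simp: holomorphic_on_open)
      then show ?thesis using r(1) by blast
    qed
    ultimately show "branch k c1 c2 0 = 0 \<and> (branch k c1 c2 has_field_derivative (v1 * cdot (tgrad (g k) p) X + v2 * cdot (tgrad (g k) p) Y)) (at 0) \<and>
     (\<exists>r>0. branch k c1 c2 holomorphic_on ball 0 r)" by blast
  qed
qed

text \<open>The components that do not pass through \<open>p\<close> and the unit \<open>w\<close> are bounded and bounded away from \<open>0\<close>.\<close>

lemma normal_form_comparison:
  assumes c: "c1 holomorphic_on UNIV" "c2 holomorphic_on UNIV" "c1 0 = 0" "c2 0 = 0"
  shows "\<exists>C>0. \<forall>\<^sub>F \<tau> in at 0. cmod (G (c1 \<tau>, c2 \<tau>)) \<le> C * (\<Prod>k\<in>I. cmod (branch k c1 c2 \<tau>)) \<and>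
     (\<Prod>k\<in>I. cmod (branch k c1 c2 \<tau>)) \<le> C * cmod (G (c1 \<tau>, c2 \<tau>))"
proof -
  define x where "x \<tau> = p + fst (\<Phi> (c1 \<tau>, c2 \<tau>)) *s a + snd (\<Phi> (c1 \<tau>, c2 \<tau>)) *s b" for \<tau>
  define q where "q y = ev u y * (\<Prod>i\<in>{..<n} - I. ev (g i) y)" for y
  have fq: "ev f y = q y * (\<Prod>i\<in>I. ev (g i) y)" for y
  proof -
    have "I \<subseteq> {..<n}" by (auto simp: I_def)
    then have "(\<Prod>i<n. ev (g i) y) = (\<Prod>i\<in>{..<n} - I. ev (g i) y) * (\<Prod>i\<in>I. ev (g i) y)"
      by (intro prod.subset_diff) auto
    then show ?thesis by (simp add: f q_def)
  qed
  have q0: "q p \<noteq> 0" using u by (auto simp: q_def I_def)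
  have cc: "isCont (\<lambda>\<tau>. (c1 \<tau>, c2 \<tau>)) 0"
    using c(1,2)[THEN holomorphic_on_imp_continuous_on] by (intro continuous_intros) (auto simp: continuous_on_eq_continuous_at)
  have c\<Phi>: "isCont (\<lambda>\<tau>. (fst \<circ> \<Phi>) (c1 \<tau>, c2 \<tau>)) 0" "isCont (\<lambda>\<tau>. (snd \<circ> \<Phi>) (c1 \<tau>, c2 \<tau>)) 0" "isCont (\<lambda>\<tau>. w (c1 \<tau>, c2 \<tau>)) 0"
  proof -
    have z: "(c1 0, c2 0) = (0, 0)" using c by simp
    note h = isCont_o2[OF cc, unfolded z, OF holomorphic2_on_continuous[OF _ U(2)]]
    show "isCont (\<lambda>\<tau>. (fst \<circ> \<Phi>) (c1 \<tau>, c2 \<tau>)) 0" by (rule h[OF \<Phi>(1)])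
    show "isCont (\<lambda>\<tau>. (snd \<circ> \<Phi>) (c1 \<tau>, c2 \<tau>)) 0" by (rule h[OF \<Phi>(2)])
    show "isCont (\<lambda>\<tau>. w (c1 \<tau>, c2 \<tau>)) 0" by (rule h[OF w])
  qed
  have "isCont q (x 0)"
  proof -
    have "continuous_on UNIV q" unfolding q_def by (intro continuous_intros)
    then show ?thesis by (simp add: continuous_on_eq_continuous_at)
  qed
  moreover have "isCont x 0"
  proof -
    have bl: "bounded_linear (\<lambda>t. t *s y)" for y :: "complex ^ 3"
      by (rule bounded_linear_intro[where K = "norm y"]) (auto simp: norm_vscale vec_eq_iff algebra_simps)
    show ?thesis unfolding x_def using c\<Phi>
      by (intro isCont_add continuous_const bounded_linear.isCont[OF bl]) (auto simp: comp_def)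
  qed
  ultimately have "isCont (\<lambda>\<tau>. q (x \<tau>)) 0" by (rule isCont_o2[rotated])
  then have "((\<lambda>\<tau>. w (c1 \<tau>, c2 \<tau>) / q (x \<tau>)) \<longlongrightarrow> w (0, 0) / q p) (at 0)"
    and "((\<lambda>\<tau>. q (x \<tau>)) \<longlongrightarrow> q p) (at 0)"
    using c\<Phi>(3) q0 c U(3) by (auto simp: isCont_def x_def intro!: tendsto_divide)
  note lim = this
  have w0: "w (0, 0) / q p \<noteq> 0" using eq[OF U(2)] q0 by simp
  define L where "L = cmod (w (0, 0) / q p)"
  have L: "L > 0" using w0 by (simp add: L_def)
  have 1: "\<forall>\<^sub>F \<tau> in at 0. dist (w (c1 \<tau>, c2 \<tau>) / q (x \<tau>)) (w (0, 0) / q p) < L / 2"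
    using L by (intro tendstoD lim) auto
  have 2: "\<forall>\<^sub>F \<tau> in at 0. q (x \<tau>) \<noteq> 0" using lim(2) q0 by (rule tendsto_imp_eventually_ne)
  obtain r where r: "r > 0" "\<And>\<tau>. \<tau> \<in> ball 0 r \<Longrightarrow> (c1 \<tau>, c2 \<tau>) \<in> U" using curve_near[OF c] by blast
  have 3: "\<forall>\<^sub>F \<tau> in at 0. (c1 \<tau>, c2 \<tau>) \<in> U"
    using r by (auto simp: eventually_at intro!: exI[of _ r])
  define C where "C = max (2 / L) (2 * L)"
  have C: "C > 0" using L by (simp add: C_def)
  from 1 2 3 have "\<forall>\<^sub>F \<tau> in at 0. cmod (G (c1 \<tau>, c2 \<tau>)) \<le> C * (\<Prod>k\<in>I. cmod (branch k c1 c2 \<tau>)) \<and>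
     (\<Prod>k\<in>I. cmod (branch k c1 c2 \<tau>)) \<le> C * cmod (G (c1 \<tau>, c2 \<tau>))"
  proof eventually_elim
    case (elim \<tau>)
    let ?W = "w (c1 \<tau>, c2 \<tau>) / q (x \<tau>)" and ?P = "\<Prod>k\<in>I. cmod (branch k c1 c2 \<tau>)"
    have "q (x \<tau>) * (\<Prod>k\<in>I. branch k c1 c2 \<tau>) = w (c1 \<tau>, c2 \<tau>) * G (c1 \<tau>, c2 \<tau>)"
      using eq[OF elim(3)] fq[of "x \<tau>"] by (simp add: x_def branch_def)
    then have "(\<Prod>k\<in>I. branch k c1 c2 \<tau>) = ?W * G (c1 \<tau>, c2 \<tau>)" using elim(2) by (simp add: field_simps)
    then have P: "?P = cmod ?W * cmod (G (c1 \<tau>, c2 \<tau>))" by (metis prod_norm norm_mult)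
    have W: "L / 2 \<le> cmod ?W" "cmod ?W \<le> 2 * L"
      using elim(1) norm_triangle_ineq2[of "w (0, 0) / q p" ?W] norm_triangle_ineq2[of ?W "w (0, 0) / q p"] L
      by (auto simp: dist_norm L_def[symmetric] norm_minus_commute)
    have "?P \<le> (2 * L) * cmod (G (c1 \<tau>, c2 \<tau>))" unfolding P using W by (intro mult_right_mono) auto
    also have "\<dots> \<le> C * cmod (G (c1 \<tau>, c2 \<tau>))" by (intro mult_right_mono) (auto simp: C_def)
    finally have u: "?P \<le> C * cmod (G (c1 \<tau>, c2 \<tau>))" .
    have "L / 2 * cmod (G (c1 \<tau>, c2 \<tau>)) \<le> ?P" unfolding P using W by (intro mult_right_mono) auto
    then have "cmod (G (c1 \<tau>, c2 \<tau>)) \<le> (2 / L) * ?P" using L by (simp add: field_simps)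
    also have "\<dots> \<le> C * ?P" by (intro mult_right_mono prod_nonneg) (auto simp: C_def)
    finally show ?case using u by blast
  qed
  then show ?thesis using C by blast
qed

end

lemma prod_bound:
  fixes s t :: "'k \<Rightarrow> 'x \<Rightarrow> real"
  assumes "finite I" "\<And>k. k \<in> I \<Longrightarrow> \<exists>C>0. \<forall>\<^sub>F x in F. s k x \<le> C * t k x"
    and nn: "\<And>k x. 0 \<le> s k x" "\<And>k x. 0 \<le> t k x"
  shows "\<exists>C>0. \<forall>\<^sub>F x in F. (\<Prod>k\<in>I. s k x) \<le> C * (\<Prod>k\<in>I. t k x)"
  using assms(1,2)
proof (induction I rule: finite_induct)
  case empty
  then show ?case by (intro exI[of _ 1]) auto
next
  case (insert i I)
  obtain C where C: "C > 0" "\<forall>\<^sub>F x in F. s i x \<le> C * t i x" using insert.prems by blast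
  obtain D where D: "D > 0" "\<forall>\<^sub>F x in F. (\<Prod>k\<in>I. s k x) \<le> D * (\<Prod>k\<in>I. t k x)"
    using insert.IH insert.prems by blast
  have "\<forall>\<^sub>F x in F. (\<Prod>k\<in>insert i I. s k x) \<le> (C * D) * (\<Prod>k\<in>insert i I. t k x)"
    using C(2) D(2)
  proof eventually_elim
    case (elim x)
    have "s i x * (\<Prod>k\<in>I. s k x) \<le> (C * t i x) * (D * (\<Prod>k\<in>I. t k x))"
      using elim C D nn by (intro mult_mono prod_nonneg) auto
    then show ?case using insert.hyps by (simp add: mult_ac)
  qed
  then show ?case using C(1) D(1) by (intro exI[of _ "C * D"]) auto
qed

lemma power_order_contradiction:
  fixes F :: "complex \<Rightarrow> real"
  assumes "\<forall>\<^sub>F \<tau> in at 0. F \<tau> \<le> C * cmod \<tau> ^ j" "C > 0" "i < j"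
    and low: "\<And>t. 0 < t \<Longrightarrow> t \<le> 1 \<Longrightarrow> t ^ i \<le> F (of_real t)"
  shows False
proof -
  obtain d where d: "d > 0" "\<And>\<tau>. \<tau> \<noteq> 0 \<Longrightarrow> cmod \<tau> < d \<Longrightarrow> F \<tau> \<le> C * cmod \<tau> ^ j"
    using assms(1) by (auto simp: eventually_at)
  define t where "t = min (d / 2) (min 1 (1 / (2 * C)))"
  have "0 < t" "t \<le> 1" "t \<le> d / 2" using d(1) assms(2) by (auto simp: t_def)
  then have t: "0 < t" "t \<le> 1" "t < d" using d(1) by auto
  have Ct: "C * t \<le> 1 / 2"
  proof -
    have "t \<le> 1 / (2 * C)" by (simp add: t_def)
    then show ?thesis using assms(2) by (simp add: field_simps)
  qed
  have "t ^ i \<le> C * t ^ j" using low[OF t(1,2)] d(2)[of "of_real t"] t by simp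
  also have "\<dots> \<le> C * t ^ Suc i" using t assms by (intro mult_left_mono power_decreasing) auto
  also have "\<dots> = (C * t) * t ^ i" by simp
  also have "\<dots> \<le> 1 / 2 * t ^ i" using Ct t by (intro mult_right_mono) auto
  finally show False using zero_less_power[OF t(1), of i] by simp
qed

context ade_point
begin

lemma normal_form_upper:
  assumes c: "c1 holomorphic_on UNIV" "c2 holomorphic_on UNIV" "c1 0 = 0" "c2 0 = 0"
    and s: "\<And>k. k \<in> I \<Longrightarrow> \<exists>C>0. \<forall>\<^sub>F \<tau> in at 0. cmod (branch k c1 c2 \<tau>) \<le> C * cmod \<tau> ^ e"
  shows "\<exists>C>0. \<forall>\<^sub>F \<tau> in at 0. cmod (G (c1 \<tau>, c2 \<tau>)) \<le> C * cmod \<tau> ^ (e * card I)"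
proof -
  obtain C where C: "C > 0" "\<forall>\<^sub>F \<tau> in at 0. cmod (G (c1 \<tau>, c2 \<tau>)) \<le> C * (\<Prod>k\<in>I. cmod (branch k c1 c2 \<tau>))"
    using normal_form_comparison[OF c] unfolding eventually_conj_iff by blast
  have "\<exists>D>0. \<forall>\<^sub>F \<tau> in at 0. (\<Prod>k\<in>I. cmod (branch k c1 c2 \<tau>)) \<le> D * (\<Prod>k\<in>I. cmod \<tau> ^ e)"
    by (rule prod_bound[OF finI s]) auto
  then obtain D where D: "D > 0" "\<forall>\<^sub>F \<tau> in at 0. (\<Prod>k\<in>I. cmod (branch k c1 c2 \<tau>)) \<le> D * cmod \<tau> ^ (e * card I)"
    by (auto simp: power_mult)
  have "\<forall>\<^sub>F \<tau> in at 0. cmod (G (c1 \<tau>, c2 \<tau>)) \<le> (C * D) * cmod \<tau> ^ (e * card I)"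
    using C(2) D(2)
  proof eventually_elim
    case (elim \<tau>)
    show ?case unfolding mult.assoc
      by (rule order_trans[OF elim(1) mult_left_mono[OF elim(2) less_imp_le[OF C(1)]]])
  qed
  then show ?thesis using C(1) D(1) by (intro exI[of _ "C * D"]) auto
qed

lemma normal_form_lower:
  assumes c: "c1 holomorphic_on UNIV" "c2 holomorphic_on UNIV" "c1 0 = 0" "c2 0 = 0"
    and s: "\<And>k. k \<in> I \<Longrightarrow> \<exists>C>0. \<forall>\<^sub>F \<tau> in at 0. cmod \<tau> \<le> C * cmod (branch k c1 c2 \<tau>)"
  shows "\<exists>C>0. \<forall>\<^sub>F \<tau> in at 0. cmod \<tau> ^ card I \<le> C * cmod (G (c1 \<tau>, c2 \<tau>))"
proof -
  obtain C where C: "C > 0" "\<forall>\<^sub>F \<tau> in at 0. (\<Prod>k\<in>I. cmod (branch k c1 c2 \<tau>)) \<le> C * cmod (G (c1 \<tau>, c2 \<tau>))"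
    using normal_form_comparison[OF c] unfolding eventually_conj_iff by blast
  have "\<exists>D>0. \<forall>\<^sub>F \<tau> in at 0. (\<Prod>k\<in>I. cmod \<tau>) \<le> D * (\<Prod>k\<in>I. cmod (branch k c1 c2 \<tau>))"
    by (rule prod_bound[OF finI s]) auto
  then obtain D where D: "D > 0" "\<forall>\<^sub>F \<tau> in at 0. cmod \<tau> ^ card I \<le> D * (\<Prod>k\<in>I. cmod (branch k c1 c2 \<tau>))"
    by auto
  have "\<forall>\<^sub>F \<tau> in at 0. cmod \<tau> ^ card I \<le> (D * C) * cmod (G (c1 \<tau>, c2 \<tau>))"
    using C(2) D(2)
  proof eventually_elim
    case (elim \<tau>)
    show ?case unfolding mult.assoc
      by (rule order_trans[OF elim(2) mult_left_mono[OF elim(1) less_imp_le[OF D(1)]]])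
  qed
  then show ?thesis using C(1) D(1) by (intro exI[of _ "D * C"]) auto
qed

lemma branch_order:
  obtains X Y where
    "\<And>k c1 c2 v1 v2. k \<in> I \<Longrightarrow> c1 holomorphic_on UNIV \<Longrightarrow> c2 holomorphic_on UNIV \<Longrightarrow> c1 0 = 0 \<Longrightarrow> c2 0 = 0 \<Longrightarrow>
      (c1 has_field_derivative v1) (at 0) \<Longrightarrow> (c2 has_field_derivative v2) (at 0) \<Longrightarrow>
      \<exists>C>0. \<forall>\<^sub>F \<tau> in at 0. cmod (branch k c1 c2 \<tau>) \<le> C * cmod \<tau>"
    "\<And>k c1 c2 v1 v2. k \<in> I \<Longrightarrow> c1 holomorphic_on UNIV \<Longrightarrow> c2 holomorphic_on UNIV \<Longrightarrow> c1 0 = 0 \<Longrightarrow> c2 0 = 0 \<Longrightarrow>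
      (c1 has_field_derivative v1) (at 0) \<Longrightarrow> (c2 has_field_derivative v2) (at 0) \<Longrightarrow>
      v1 * cdot (tgrad (g k) p) X + v2 * cdot (tgrad (g k) p) Y = 0 \<Longrightarrow>
      \<exists>C>0. \<forall>\<^sub>F \<tau> in at 0. cmod (branch k c1 c2 \<tau>) \<le> C * cmod \<tau> ^ 2"
    "\<And>k c1 c2 v1 v2. k \<in> I \<Longrightarrow> c1 holomorphic_on UNIV \<Longrightarrow> c2 holomorphic_on UNIV \<Longrightarrow> c1 0 = 0 \<Longrightarrow> c2 0 = 0 \<Longrightarrow>
      (c1 has_field_derivative v1) (at 0) \<Longrightarrow> (c2 has_field_derivative v2) (at 0) \<Longrightarrow>
      v1 * cdot (tgrad (g k) p) X + v2 * cdot (tgrad (g k) p) Y \<noteq> 0 \<Longrightarrow>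
      \<exists>C>0. \<forall>\<^sub>F \<tau> in at 0. cmod \<tau> \<le> C * cmod (branch k c1 c2 \<tau>)"
proof -
  obtain X Y where XY: "\<And>k c1 c2 v1 v2. k \<in> I \<Longrightarrow> c1 holomorphic_on UNIV \<Longrightarrow> c2 holomorphic_on UNIV \<Longrightarrow> c1 0 = 0 \<Longrightarrow> c2 0 = 0 \<Longrightarrow>
     (c1 has_field_derivative v1) (at 0) \<Longrightarrow> (c2 has_field_derivative v2) (at 0) \<Longrightarrow>
     branch k c1 c2 0 = 0 \<and> (branch k c1 c2 has_field_derivative (v1 * cdot (tgrad (g k) p) X + v2 * cdot (tgrad (g k) p) Y)) (at 0) \<and>
     (\<exists>r>0. branch k c1 c2 holomorphic_on ball 0 r)"
    using branch_derivative by blast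
  show thesis
  proof
    fix k c1 c2 v1 v2
    assume a: "k \<in> I" "c1 holomorphic_on UNIV" "c2 holomorphic_on UNIV" "c1 0 = 0" "c2 0 = 0"
      "(c1 has_field_derivative v1) (at 0)" "(c2 has_field_derivative v2) (at 0)"
    from XY[OF a] obtain r where r: "branch k c1 c2 0 = 0" "r > 0" "branch k c1 c2 holomorphic_on ball 0 r"
      and d: "(branch k c1 c2 has_field_derivative (v1 * cdot (tgrad (g k) p) X + v2 * cdot (tgrad (g k) p) Y)) (at 0)"
      by blast
    note h = holomorphic_vanishing_order[OF r(3) r(2) r(1) d]
    show "\<exists>C>0. \<forall>\<^sub>F \<tau> in at 0. cmod (branch k c1 c2 \<tau>) \<le> C * cmod \<tau>" by (rule h(1))
    show "v1 * cdot (tgrad (g k) p) X + v2 * cdot (tgrad (g k) p) Y = 0 \<Longrightarrow>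
      \<exists>C>0. \<forall>\<^sub>F \<tau> in at 0. cmod (branch k c1 c2 \<tau>) \<le> C * cmod \<tau> ^ 2" by (rule h(2))
    show "v1 * cdot (tgrad (g k) p) X + v2 * cdot (tgrad (g k) p) Y \<noteq> 0 \<Longrightarrow>
      \<exists>C>0. \<forall>\<^sub>F \<tau> in at 0. cmod \<tau> \<le> C * cmod (branch k c1 c2 \<tau>)" by (rule h(3))
  qed
qed

lemma cmod_of_real_add_powers:
  "cmod ((of_real t) ^ i + (of_real t) ^ j) = t ^ i + t ^ j" if "0 \<le> t" for t :: real
proof -
  have "complex_of_real t ^ i + of_real t ^ j = of_real (t ^ i + t ^ j)" by simp
  then show ?thesis using that by (simp only: norm_of_real) simp
qed

text \<open>The normal forms have multiplicity at most three, which is visible on the diagonal.\<close>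

lemma at_most_three_branches:
  assumes G: "G \<in> ADE_normal_forms"
  shows "card I \<le> 3"
proof (rule ccontr)
  assume "\<not> card I \<le> 3"
  obtain X Y where XY: "\<And>k c1 c2 v1 v2. k \<in> I \<Longrightarrow> c1 holomorphic_on UNIV \<Longrightarrow> c2 holomorphic_on UNIV \<Longrightarrow> c1 0 = 0 \<Longrightarrow> c2 0 = 0 \<Longrightarrow>
      (c1 has_field_derivative v1) (at 0) \<Longrightarrow> (c2 has_field_derivative v2) (at 0) \<Longrightarrow>
      \<exists>C>0. \<forall>\<^sub>F \<tau> in at 0. cmod (branch k c1 c2 \<tau>) \<le> C * cmod \<tau>"
    by (rule branch_order) blast
  have "\<exists>C>0. \<forall>\<^sub>F \<tau> in at 0. cmod (G (\<tau>, \<tau>)) \<le> C * cmod \<tau> ^ (1 * card I)"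
    by (rule normal_form_upper) (auto intro!: XY[of _ _ _ 1 1] holomorphic_intros derivative_eq_intros)
  then obtain C where C: "C > 0" "\<forall>\<^sub>F \<tau> in at 0. cmod (G (\<tau>, \<tau>)) \<le> C * cmod \<tau> ^ card I" by auto
  have "t ^ 3 \<le> cmod (G (of_real t, of_real t))" if t: "0 < t" "t \<le> 1" for t :: real
  proof -
    have p: "t ^ 3 \<le> t ^ i + t ^ j" if "i \<le> 3" for i j
      using power_decreasing[OF that, of t] t by (simp add: add_increasing2)
    from G show ?thesis unfolding ADE_normal_forms_def
    proof (elim UnE CollectE exE conjE insertE emptyE)
      fix k assume k: "G = (\<lambda>(x, y). x\<^sup>2 + y ^ (k + 1))"
      have "cmod (G (of_real t, of_real t)) = t ^ 2 + t ^ (k + 1)"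
        unfolding k using cmod_of_real_add_powers[of t 2 "k + 1"] t by simp
      then show ?thesis using p[of 2 "k + 1"] by simp
    next
      fix k assume k: "G = (\<lambda>(x, y). x\<^sup>2 * y + y ^ (k - 1))"
      have "cmod (G (of_real t, of_real t)) = t ^ 3 + t ^ (k - 1)"
        unfolding k using cmod_of_real_add_powers[of t 3 "k - 1"] t by (simp add: power2_eq_square power3_eq_cube)
      then show ?thesis using p[of 3 "k - 1"] by simp
    next
      assume k: "G = (\<lambda>(x, y). x ^ 3 + y ^ 4)"
      have "cmod (G (of_real t, of_real t)) = t ^ 3 + t ^ 4"
        unfolding k using cmod_of_real_add_powers[of t 3 4] t by simp
      then show ?thesis using p[of 3 4] by simp
    next
      assume k: "G = (\<lambda>(x, y). x ^ 3 + x * y ^ 3)"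
      have "cmod (G (of_real t, of_real t)) = t ^ 3 + t ^ 4"
        unfolding k using cmod_of_real_add_powers[of t 3 4] t by (simp add: power3_eq_cube power4_eq_xxxx mult.assoc)
      then show ?thesis using p[of 3 4] by simp
    next
      assume k: "G = (\<lambda>(x, y). x ^ 3 + y ^ 5)"
      have "cmod (G (of_real t, of_real t)) = t ^ 3 + t ^ 5"
        unfolding k using cmod_of_real_add_powers[of t 3 5] t by simp
      then show ?thesis using p[of 3 5] by simp
    qed
  qed
  then show False
    using power_order_contradiction[OF C(2) C(1), of 3] \<open>\<not> card I \<le> 3\<close> by simp
qed

text \<open>In the coordinates of the normal form the common tangent is an axis: on that axis the normal form vanishes at
  least to order four, whereas three branches transversal to it vanish to order three only. Along the
  parabola tangent to this axis each branch vanishes to order two, hence \<open>f\<close> to order six, but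
  the normal forms of type \<open>D\<close> and \<open>E\<close> vanish to order at most five there. Type \<open>A\<close> is excluded by its multiplicity.\<close>

lemma not_three_tangent_branches:
  assumes G: "G \<in> ADE_normal_forms" and card: "card I = 3" and i: "i \<in> I"
    and tang: "\<And>k. k \<in> I \<Longrightarrow> \<exists>\<kappa>. \<kappa> \<noteq> 0 \<and> tgrad (g k) p = \<kappa> *s tgrad (g i) p"
  shows False
proof -
  obtain X Y where ord1: "\<And>k c1 c2 v1 v2. k \<in> I \<Longrightarrow> c1 holomorphic_on UNIV \<Longrightarrow> c2 holomorphic_on UNIV \<Longrightarrow> c1 0 = 0 \<Longrightarrow> c2 0 = 0 \<Longrightarrow>
      (c1 has_field_derivative v1) (at 0) \<Longrightarrow> (c2 has_field_derivative v2) (at 0) \<Longrightarrow>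
      \<exists>C>0. \<forall>\<^sub>F \<tau> in at 0. cmod (branch k c1 c2 \<tau>) \<le> C * cmod \<tau>"
    and ord2: "\<And>k c1 c2 v1 v2. k \<in> I \<Longrightarrow> c1 holomorphic_on UNIV \<Longrightarrow> c2 holomorphic_on UNIV \<Longrightarrow> c1 0 = 0 \<Longrightarrow> c2 0 = 0 \<Longrightarrow>
      (c1 has_field_derivative v1) (at 0) \<Longrightarrow> (c2 has_field_derivative v2) (at 0) \<Longrightarrow>
      v1 * cdot (tgrad (g k) p) X + v2 * cdot (tgrad (g k) p) Y = 0 \<Longrightarrow>
      \<exists>C>0. \<forall>\<^sub>F \<tau> in at 0. cmod (branch k c1 c2 \<tau>) \<le> C * cmod \<tau> ^ 2"
    and low: "\<And>k c1 c2 v1 v2. k \<in> I \<Longrightarrow> c1 holomorphic_on UNIV \<Longrightarrow> c2 holomorphic_on UNIV \<Longrightarrow> c1 0 = 0 \<Longrightarrow> c2 0 = 0 \<Longrightarrow>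
      (c1 has_field_derivative v1) (at 0) \<Longrightarrow> (c2 has_field_derivative v2) (at 0) \<Longrightarrow>
      v1 * cdot (tgrad (g k) p) X + v2 * cdot (tgrad (g k) p) Y \<noteq> 0 \<Longrightarrow>
      \<exists>C>0. \<forall>\<^sub>F \<tau> in at 0. cmod \<tau> \<le> C * cmod (branch k c1 c2 \<tau>)"
    by (rule branch_order) blast
  have allX: "cdot (tgrad (g k) p) Z = 0 \<longleftrightarrow> cdot (tgrad (g i) p) Z = 0" if "k \<in> I" for k Z
    using tang[OF that] by auto
  \<comment> \<open>Order three is not order four.\<close>
  have z4: False if "\<forall>\<^sub>F \<tau> in at 0. cmod \<tau> ^ 3 \<le> C * cmod (F \<tau>)" "C > 0" "\<And>\<tau>. cmod \<tau> \<le> 1 \<Longrightarrow> cmod (F \<tau>) \<le> cmod \<tau> ^ 4"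
    for C and F :: "complex \<Rightarrow> complex"
  proof (rule power_order_contradiction[where C = C and i = 3 and j = 4 and F = "\<lambda>\<tau>. cmod \<tau> ^ 3"])
    have "\<forall>\<^sub>F \<tau> in at (0::complex). cmod \<tau> \<le> 1"
      by (auto simp: eventually_at intro!: exI[of _ 1])
    with that(1) show "\<forall>\<^sub>F \<tau> in at 0. cmod \<tau> ^ 3 \<le> C * cmod \<tau> ^ 4"
    proof eventually_elim
      case (elim \<tau>)
      show ?case
        by (rule order_trans[OF elim(1) mult_left_mono[OF that(3)[OF elim(2)] less_imp_le[OF that(2)]]])
    qed
  qed (use that in auto)
  have hol: "(\<lambda>\<tau>::complex. \<tau>) holomorphic_on UNIV" "(\<lambda>\<tau>::complex. 0::complex) holomorphic_on UNIV"
    "(\<lambda>\<tau>::complex. \<tau>\<^sup>2) holomorphic_on UNIV" by (intro holomorphic_intros)+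
  have der: "((\<lambda>\<tau>::complex. \<tau>) has_field_derivative 1) (at 0)" "((\<lambda>\<tau>::complex. 0::complex) has_field_derivative 0) (at 0)"
    "((\<lambda>\<tau>::complex. \<tau>\<^sup>2) has_field_derivative 0) (at 0)"
    by (auto intro!: derivative_eq_intros)
  have Xzero: "cdot (tgrad (g k) p) X = 0"
    if F: "\<And>\<tau>. cmod \<tau> \<le> 1 \<Longrightarrow> cmod (G (\<tau>, 0)) \<le> cmod \<tau> ^ 4" and k: "k \<in> I" for k
  proof (rule ccontr)
    assume "cdot (tgrad (g k) p) X \<noteq> 0"
    then have nz: "cdot (tgrad (g l) p) X \<noteq> 0" if "l \<in> I" for l using allX k that by blast
    have "\<exists>C>0. \<forall>\<^sub>F \<tau> in at 0. cmod \<tau> ^ card I \<le> C * cmod (G (\<tau>, 0))"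
      by (rule normal_form_lower[OF hol(1,2)], simp, simp, rule low[OF _ hol(1,2) _ _ der(1,2)]) (use nz in auto)
    then show False using z4[of _ "\<lambda>\<tau>. G (\<tau>, 0)"] F card by auto
  qed
  have Yzero: "cdot (tgrad (g k) p) Y = 0"
    if F: "\<And>\<tau>. cmod \<tau> \<le> 1 \<Longrightarrow> cmod (G (0, \<tau>)) \<le> cmod \<tau> ^ 4" and k: "k \<in> I" for k
  proof (rule ccontr)
    assume "cdot (tgrad (g k) p) Y \<noteq> 0"
    then have nz: "cdot (tgrad (g l) p) Y \<noteq> 0" if "l \<in> I" for l using allX k that by blast
    have "\<exists>C>0. \<forall>\<^sub>F \<tau> in at 0. cmod \<tau> ^ card I \<le> C * cmod (G (0, \<tau>))"
      by (rule normal_form_lower[OF hol(2,1)], simp, simp, rule low[OF _ hol(2,1) _ _ der(2,1)]) (use nz in auto)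
    then show False using z4[of _ "\<lambda>\<tau>. G (0, \<tau>)"] F card by auto
  qed
  have Xparabola: False if F: "\<And>k. k \<in> I \<Longrightarrow> cdot (tgrad (g k) p) X = 0"
    and lo: "\<And>t::real. 0 < t \<Longrightarrow> t \<le> 1 \<Longrightarrow> t ^ 5 \<le> cmod (G (of_real t, (of_real t)\<^sup>2))"
  proof -
    have "\<exists>C>0. \<forall>\<^sub>F \<tau> in at 0. cmod (G (\<tau>, \<tau>\<^sup>2)) \<le> C * cmod \<tau> ^ (2 * card I)"
      by (rule normal_form_upper[OF hol(1,3)], simp, simp, rule ord2[OF _ hol(1,3) _ _ der(1,3)]) (use F in auto)
    then show False using power_order_contradiction[of "\<lambda>\<tau>. cmod (G (\<tau>, \<tau>\<^sup>2))" _ 6 5] lo card by auto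
  qed
  have Yparabola: False if F: "\<And>k. k \<in> I \<Longrightarrow> cdot (tgrad (g k) p) Y = 0"
    and lo: "\<And>t::real. 0 < t \<Longrightarrow> t \<le> 1 \<Longrightarrow> t ^ 5 \<le> cmod (G ((of_real t)\<^sup>2, of_real t))"
  proof -
    have "\<exists>C>0. \<forall>\<^sub>F \<tau> in at 0. cmod (G (\<tau>\<^sup>2, \<tau>)) \<le> C * cmod \<tau> ^ (2 * card I)"
      by (rule normal_form_upper[OF hol(3,1)], simp, simp, rule ord2[OF _ hol(3,1) _ _ der(3,1)]) (use F in auto)
    then show False using power_order_contradiction[of "\<lambda>\<tau>. cmod (G (\<tau>\<^sup>2, \<tau>))" _ 6 5] lo card by auto
  qed
  have pw: "t ^ 5 \<le> t ^ i + t ^ j" if "i \<le> 5" "0 < t" "t \<le> 1" for i j and t :: real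
    using power_decreasing[OF that(1), of t] that by (simp add: add_increasing2)
  note real_powers = cmod_of_real_add_powers
  from G show False unfolding ADE_normal_forms_def
  proof (elim UnE CollectE exE conjE insertE emptyE)
    fix k assume k: "G = (\<lambda>(x, y). x\<^sup>2 + y ^ (k + 1))"
    have "\<exists>C>0. \<forall>\<^sub>F \<tau> in at 0. cmod (G (\<tau>, 0)) \<le> C * cmod \<tau> ^ (1 * card I)"
      by (rule normal_form_upper[OF hol(1,2)], simp, simp, simp, rule ord1[OF _ hol(1,2) _ _ der(1,2)]) auto
    then obtain C where "C > 0" "\<forall>\<^sub>F \<tau> in at 0. cmod (G (\<tau>, 0)) \<le> C * cmod \<tau> ^ 3" using card by auto
    then show False
      by (intro power_order_contradiction[of "\<lambda>\<tau>. cmod (G (\<tau>, 0))" C 3 2]) (auto simp: k norm_power)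
  next
    fix k :: nat assume k: "G = (\<lambda>(x, y). x\<^sup>2 * y + y ^ (k - 1))" "4 \<le> k"
    show False
    proof (rule Xparabola)
      show "cdot (tgrad (g l) p) X = 0" if "l \<in> I" for l
        using k by (intro Xzero that) (auto simp: zero_power)
      fix t :: real assume t: "0 < t" "t \<le> 1"
      have "cmod (G (of_real t, (of_real t)\<^sup>2)) = t ^ 4 + t ^ (2 * (k - 1))"
        unfolding k using real_powers[of t 4 "2 * (k - 1)"] t by (simp add: power_mult power2_eq_square power4_eq_xxxx mult.assoc)
      then show "t ^ 5 \<le> cmod (G (of_real t, (of_real t)\<^sup>2))" using pw[of 4 t] t by simp
    qed
  next
    assume k: "G = (\<lambda>(x, y). x ^ 3 + y ^ 4)"
    show False
    proof (rule Yparabola)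
      show "cdot (tgrad (g l) p) Y = 0" if "l \<in> I" for l
        by (intro Yzero that) (auto simp: k norm_power)
      fix t :: real assume t: "0 < t" "t \<le> 1"
      have "cmod (G ((of_real t)\<^sup>2, of_real t)) = t ^ 6 + t ^ 4"
        unfolding k using real_powers[of t 6 4] t by (simp flip: power_mult)
      then show "t ^ 5 \<le> cmod (G ((of_real t)\<^sup>2, of_real t))" using pw[of 4 t 6] t by simp
    qed
  next
    assume k: "G = (\<lambda>(x, y). x ^ 3 + x * y ^ 3)"
    show False
    proof (rule Yparabola)
      show "cdot (tgrad (g l) p) Y = 0" if "l \<in> I" for l
        by (intro Yzero that) (auto simp: k)
      fix t :: real assume t: "0 < t" "t \<le> 1"
      have "cmod (G ((of_real t)\<^sup>2, of_real t)) = t ^ 6 + t ^ 5"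
        unfolding k using real_powers[of t 6 5] t by (simp flip: power_mult power_add)
      then show "t ^ 5 \<le> cmod (G ((of_real t)\<^sup>2, of_real t))" using pw[of 5 t 6] t by simp
    qed
  next
    assume k: "G = (\<lambda>(x, y). x ^ 3 + y ^ 5)"
    show False
    proof (rule Yparabola)
      show "cdot (tgrad (g l) p) Y = 0" if "l \<in> I" for l
      proof (rule Yzero[OF _ that])
        fix \<tau> :: complex assume "cmod \<tau> \<le> 1"
        then have "cmod \<tau> ^ 5 \<le> cmod \<tau> ^ 4" by (intro power_decreasing) auto
        then show "cmod (G (0, \<tau>)) \<le> cmod \<tau> ^ 4" by (simp add: k norm_power)
      qed
      fix t :: real assume t: "0 < t" "t \<le> 1"
      have "cmod (G ((of_real t)\<^sup>2, of_real t)) = t ^ 6 + t ^ 5"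
        unfolding k using real_powers[of t 6 5] t by (simp flip: power_mult)
      then show "t ^ 5 \<le> cmod (G ((of_real t)\<^sup>2, of_real t))" using pw[of 5 t 6] t by simp
    qed
  qed
qed

end

section \<open>Conic-line arrangements with ADE singularities\<close>

text \<open>The affine charts are parametrized by affine planes through a multiple of \<open>q\<close>.\<close>

lemma local_equation_chart:
  assumes "q \<noteq> 0"
  obtains c a b where "c \<noteq> 0"
    "\<And>z. local_equation f q z = ev f (c *s q + fst z *s a + snd z *s b)"
proof -
  consider "q $ 1 \<noteq> 0" | "q $ 1 = 0" "q $ 2 \<noteq> 0" | "q $ 1 = 0" "q $ 2 = 0" "q $ 3 \<noteq> 0"
    using assms by (auto simp: vec_eq_iff forall_3)
  then show thesis
  proof cases
    case 1
    have "local_equation f q z = ev f ((1 / q $ 1) *s q + fst z *s axis 2 1 + snd z *s axis 3 1)" for z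
      unfolding local_equation_def using 1
      by (auto simp: case_prod_beta intro!: arg_cong[where f = "ev f"] simp: vec_eq_iff forall_3 axis_def)
    then show thesis using 1 by (intro that[of "1 / q $ 1"]) auto
  next
    case 2
    have "local_equation f q z = ev f ((1 / q $ 2) *s q + fst z *s axis 1 1 + snd z *s axis 3 1)" for z
      unfolding local_equation_def using 2
      by (auto simp: case_prod_beta intro!: arg_cong[where f = "ev f"] simp: vec_eq_iff forall_3 axis_def)
    then show thesis using 2 by (intro that[of "1 / q $ 2"]) auto
  next
    case 3
    have "local_equation f q z = ev f ((1 / q $ 3) *s q + fst z *s axis 1 1 + snd z *s axis 2 1)" for z
      unfolding local_equation_def using 3
      by (auto simp: case_prod_beta intro!: arg_cong[where f = "ev f"] simp: vec_eq_iff forall_3 axis_def)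
    then show thesis using 3 by (intro that[of "1 / q $ 3"]) auto
  qed
qed

lemma component_gradient_scale:
  assumes "is_line g \<or> is_smooth_conic g" "c \<noteq> 0"
  shows "\<exists>\<kappa>. \<kappa> \<noteq> 0 \<and> tgrad g (c *s p) = \<kappa> *s tgrad g p"
  using assms(1)
proof
  assume "is_line g"
  then have "g \<in> homogeneous_piece 1" by (simp add: is_line_def)
  then have "tgrad g (c *s p) = tgrad g p" using line_eval(1)[of g "c *s p"] line_eval(1)[of g p] by simp
  then show ?thesis by (intro exI[of _ 1]) simp
next
  assume "is_smooth_conic g"
  then have "g \<in> homogeneous_piece 2" by (simp add: is_smooth_conic_def)
  then show ?thesis using assms(2) conic_gradient_linear(2) by blast
qed

lemma two_components_singular:
  fixes g :: "nat \<Rightarrow> tpoly" and n :: nat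
  assumes f: "\<And>v. ev f v = ev u v * (\<Prod>i<n. ev (g i) v)"
    and ik: "i < n" "k < n" "i \<noteq> k" "ev (g i) p = 0" "ev (g k) p = 0" and p: "p \<noteq> 0"
  shows "singular_point f p"
proof -
  define R where "R = u * (g k * (\<Prod>j\<in>{..<n} - {i} - {k}. g j))"
  have ev: "ev f v = ev (g i) v * ev R v" for v
    using ik by (simp add: f R_def prod.remove[of "{..<n}" i] prod.remove[of "{..<n} - {i}" k])
  have R0: "ev R p = 0" using ik by (simp add: R_def)
  have "wirt (\<lambda>v. ev (g i) v * ev R v) p
     (ev R p *s tgrad (g i) p + ev (g i) p *s tgrad R p) (ev R p *s 0 + ev (g i) p *s 0)"
    by (intro wirt_mult wirt_tpoly)
  then have "(ev f has_derivative (\<lambda>v. 0)) (at p)"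
    using ik R0 by (simp add: wirt_def ev[abs_def])
  then have zero: "cdot (tgrad f p) = (\<lambda>v. 0)" using has_derivative_unique tpoly_eval_has_derivative by blast
  have "tgrad f p $ i = 0" for i
  proof -
    have "tgrad f p $ i = cdot (tgrad f p) (axis i 1)" by simp
    then show ?thesis by (simp only: zero)
  qed
  then show ?thesis using p ev[of p] R0 by (simp add: singular_point_def tgrad_def)
qed

lemma ADE_branch_conditions:
  fixes g :: "nat \<Rightarrow> tpoly" and n :: nat
  assumes u: "\<And>v. ev u v \<noteq> 0"
    and f: "\<And>v. ev f v = ev u v * (\<Prod>i<n. ev (g i) v)"
    and g: "\<And>i. i < n \<Longrightarrow> is_line (g i) \<or> is_smooth_conic (g i)"
    and ADE: "only_ADE_singularities f" and p: "p \<noteq> 0"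
    and I_def: "I = {i. i < n \<and> ev (g i) p = 0}"
  shows "card I \<le> 3"
    and "\<And>i. i \<in> I \<Longrightarrow> \<exists>k0. \<forall>k\<in>I. k \<noteq> i \<longrightarrow> k \<noteq> k0 \<longrightarrow> ccross (tgrad (g i) p) (tgrad (g k) p) \<noteq> 0"
proof -
  have finite_I: "finite I" by (simp add: I_def)
  have main: "card I \<le> 3 \<and> \<not> (\<exists>i k l. i \<in> I \<and> k \<in> I \<and> l \<in> I \<and> i \<noteq> k \<and> i \<noteq> l \<and> k \<noteq> l \<and>
      ccross (tgrad (g i) p) (tgrad (g k) p) = 0 \<and> ccross (tgrad (g i) p) (tgrad (g l) p) = 0)"
  proof (cases "\<exists>i k. i \<in> I \<and> k \<in> I \<and> i \<noteq> k")
    case False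
    then have "card I \<le> 1" using card_le_Suc0_iff_eq[OF finite_I] by auto
    then show ?thesis using False by auto
  next
    case True
    then obtain i k where "i \<in> I" "k \<in> I" "i \<noteq> k" by blast
    then have "singular_point f p" using two_components_singular[OF f _ _ _ _ _ p] by (auto simp: I_def)
    then obtain G where G: "G \<in> ADE_normal_forms" "analytically_equivalent (local_equation f p) G"
      using ADE by (auto simp: only_ADE_singularities_def)
    obtain c a b where c: "c \<noteq> 0" and chart: "\<And>z. local_equation f p z = ev f (c *s p + fst z *s a + snd z *s b)"
      using local_equation_chart[OF p] by blast
    obtain U V \<Phi> \<Psi> w where e: "biholomorphic2 U V \<Phi> \<Psi>" "(0, 0) \<in> U" "\<Phi> (0, 0) = (0, 0)" "holomorphic2_on w U"
      "\<forall>z\<in>U. w z \<noteq> 0 \<and> local_equation f p (\<Phi> z) = w z * G z"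
      using G(2) unfolding analytically_equivalent_def by blast
    interpret ade_point f u g n "c *s p" a b \<Phi> U w G
      by unfold_locales (use u f e chart in \<open>auto simp: biholomorphic2_def\<close>)
    have I_eq: "ade_point.I g n (c *s p) = I"
    proof -
      have "ev (g i) (c *s p) = 0 \<longleftrightarrow> ev (g i) p = 0" if "i < n" for i
      proof -
        have "\<exists>j. g i \<in> homogeneous_piece j" using g[OF that] by (auto simp: is_line_def is_smooth_conic_def)
        then obtain j where "g i \<in> homogeneous_piece j" ..
        from tpoly_eval_homogeneous[OF this] show ?thesis using c by simp
      qed
      then show ?thesis by (auto simp: local.I_def assms(6))
    qed
    have card: "card I \<le> 3" using at_most_three_branches[OF G(1)] by (simp only: I_eq)
    moreover have False if ikl: "i \<in> I" "k \<in> I" "l \<in> I" "i \<noteq> k" "i \<noteq> l" "k \<noteq> l"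
      "ccross (tgrad (g i) p) (tgrad (g k) p) = 0" "ccross (tgrad (g i) p) (tgrad (g l) p) = 0" for i k l
    proof (rule not_three_tangent_branches[OF G(1)])
      have sub: "{i, k, l} \<subseteq> I" "card {i, k, l} = 3" using ikl by auto
      then have Ieq: "{i, k, l} = I" using card finite_I by (intro card_seteq) auto
      then show "card (ade_point.I g n (c *s p)) = 3" using sub(2) by (simp only: I_eq)
      show "i \<in> ade_point.I g n (c *s p)" using ikl(1) by (simp only: I_eq)
      have comp: "is_line (g j) \<or> is_smooth_conic (g j)" "ev (g j) p = 0" if "j \<in> I" for j
        using g that by (auto simp: assms(6))
      fix j assume "j \<in> ade_point.I g n (c *s p)"
      then have j: "j \<in> I" by (simp only: I_eq)
      have "ccross (tgrad (g i) p) (tgrad (g j) p) = 0"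
        using j ikl by (auto simp: Ieq[symmetric] vec_eq_iff forall_3)
      then obtain \<mu> where \<mu>: "tgrad (g i) p = \<mu> *s tgrad (g j) p"
        using ccross_0D gradient_nonzero[OF comp[OF j] p] by blast
      then have \<mu>0: "\<mu> \<noteq> 0" using gradient_nonzero[OF comp[OF ikl(1)] p] by auto
      obtain \<kappa> where \<kappa>: "\<kappa> \<noteq> 0" "tgrad (g j) (c *s p) = \<kappa> *s tgrad (g j) p"
        using component_gradient_scale[OF comp(1)[OF j] c] by blast
      obtain \<kappa>' where \<kappa>': "\<kappa>' \<noteq> 0" "tgrad (g i) (c *s p) = \<kappa>' *s tgrad (g i) p"
        using component_gradient_scale[OF comp(1)[OF ikl(1)] c] by blast
      show "\<exists>\<kappa>. \<kappa> \<noteq> 0 \<and> tgrad (g j) (c *s p) = \<kappa> *s tgrad (g i) (c *s p)"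
        using \<kappa> \<kappa>' \<mu> \<mu>0 by (intro exI[of _ "\<kappa> / (\<kappa>' * \<mu>)"]) simp
    qed
    ultimately show ?thesis by blast
  qed
  then show "card I \<le> 3" by blast
  show "\<exists>k0. \<forall>k\<in>I. k \<noteq> i \<longrightarrow> k \<noteq> k0 \<longrightarrow> ccross (tgrad (g i) p) (tgrad (g k) p) \<noteq> 0" if "i \<in> I" for i
  proof (cases "\<exists>k\<in>I. k \<noteq> i \<and> ccross (tgrad (g i) p) (tgrad (g k) p) = 0")
    case True
    then obtain k where k: "k \<in> I" "k \<noteq> i" "ccross (tgrad (g i) p) (tgrad (g k) p) = 0" by blast
    show ?thesis
    proof (intro exI[of _ k] ballI impI notI)
      fix l assume "l \<in> I" "l \<noteq> i" "l \<noteq> k" "ccross (tgrad (g i) p) (tgrad (g l) p) = 0"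
      then show False using main that k by blast
    qed
  next
    case False
    then show ?thesis by blast
  qed
qed

text \<open>Singularities enter only through the number and the tangency of the branches at each point.\<close>

lemma conic_line_arrangement_integrable:
  assumes arr: "conic_line_arrangement d f" and ADE: "only_ADE_singularities f" and A: "0 < A"
    and s: "11 / 20 \<le> s" "s < 5 / 9"
  shows "integrable lborel (\<lambda>x. indicator {x. A \<le> (norm x)\<^sup>2 \<and> (norm x)\<^sup>2 \<le> B} x *\<^sub>R (cmod (ev f x))\<^sup>2 powr (- s))"
proof (rule conic_line_arrangement_components[OF arr])
  fix u :: tpoly and n :: nat and g :: "nat \<Rightarrow> tpoly"
  assume u: "\<And>v. ev u v \<noteq> 0"
    and f: "\<And>v. ev f v = ev u v * (\<Prod>i<n. ev (g i) v)"
    and g: "\<And>i. i < n \<Longrightarrow> is_line (g i) \<or> is_smooth_conic (g i)"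
    and ne: "\<And>i k \<kappa>. i < n \<Longrightarrow> k < n \<Longrightarrow> i \<noteq> k \<Longrightarrow> \<exists>v. ev (g i) v \<noteq> \<kappa> * ev (g k) v"
  \<comment> \<open>The midpoint of \<open>(5 s - 1) / 4\<close> and \<open>1 - s\<close>, the bounds imposed on \<open>t\<close> from below and above.\<close>
  define t where "t = (5 * s - 1) / 8 + (1 - s) / 2"
  have t: "0 < t" "t < s" "s + t < 1" "5 * s - 4 * t < 1" using s by (auto simp: t_def field_simps)
  define K where "K = {x::complex^3. A \<le> (norm x)\<^sup>2 \<and> (norm x)\<^sup>2 \<le> B}"
  have K: "compact K"
  proof -
    have "K \<subseteq> cball 0 (sqrt B)" by (auto simp: K_def intro: real_le_rsqrt)
    then have "bounded K" using bounded_cball bounded_subset by blast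
    moreover have "closed K" unfolding K_def
      by (intro closed_Collect_conj closed_Collect_le continuous_intros)
    ultimately show ?thesis by (simp add: compact_eq_bounded_closed)
  qed
  have [measurable]: "ev f \<in> borel_measurable borel"
    by (intro borel_measurable_continuous_onI continuous_intros)
  have [measurable]: "K \<in> sets borel" using K by (simp add: borel_compact)
  have "(\<integral>\<^sup>+x\<in>K. ennreal ((cmod (ev f x))\<^sup>2 powr (- s)) \<partial>lborel) < \<infinity>"
  proof (rule nn_integral_compact_finite[OF _ K])
    fix p assume "p \<in> K"
    then have p: "p \<noteq> 0" using A by (auto simp: K_def)
    show "\<exists>\<rho>>0. (\<integral>\<^sup>+x\<in>cball p \<rho>. ennreal ((cmod (ev f x))\<^sup>2 powr (- s)) \<partial>lborel) < \<infinity>"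
      by (rule local_integrability[OF u f g ne p refl ADE_branch_conditions[OF u f g ADE p refl] t])
  qed measurable
  then show ?thesis unfolding K_def[symmetric]
    by (intro integrableI_bounded) (auto simp: ennreal_indicator ennreal_mult' mult.commute)
qed

theorem corollary3p3:
  fixes f :: tpoly and d m :: nat
  assumes "conic_line_arrangement d f"
    and "d = 2 * m" and "d \<ge> 4"
    and "only_ADE_singularities f"
    and "maximizing d f"
  shows "d \<le> 18"
proof (rule ccontr)
  assume "\<not> d \<le> 18"
  obtain k \<phi> where k: "d = 2 * k" and \<phi>: "graded_iso_AR f (k - 1) k \<phi>"
    using assms(5) by (auto simp: maximizing_def free_with_exponents_def)
  have k10: "k \<ge> 10" using \<open>\<not> d \<le> 18\<close> k by simp
  have f: "f \<noteq> 0" "f \<in> homogeneous_piece d"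
    using assms(1) by (auto simp: conic_line_arrangement_def reduced_plane_curve_def)
  define \<theta> where "\<theta> = \<phi> (1, 0)"
  have "1 \<in> shifted_piece (k - 1) (k - 1)" "0 \<in> shifted_piece k (k - 1)"
    by (auto simp: shifted_piece_def homogeneous_piece_def)
  then have "\<theta> \<in> \<phi> ` (shifted_piece (k - 1) (k - 1) \<times> shifted_piece k (k - 1))" by (auto simp: \<theta>_def)
  also have "\<dots> = AR_piece f (k - 1)" using \<phi> by (simp add: graded_iso_AR_def)
  finally have \<theta>: "\<theta> \<in> AR f" "\<And>i. \<theta> $ i \<in> homogeneous_piece (k - 1)" by (auto simp: AR_piece_def)
  \<comment> \<open>Any \<open>s\<close> with \<open>11 / 20 < s < 5 / 9\<close> would do: \<open>s d > k + 1\<close> amounts to \<open>s > 1 / 2 + 1 / (2 k)\<close>, and \<open>k \<ge> 10\<close>.\<close>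
  interpret syzygy f \<theta> d "k - 1" "69 / 125"
  proof
    show "69 / 125 * real d > real (k - 1 + 2)"
      using k10 by (simp add: k of_nat_diff field_simps)
    show "AE x in lborel. ev f x \<noteq> 0" using f by (intro AE_tpoly_eval_nonzero)
    show "integrable lborel (\<lambda>x. indicator {x. A \<le> (norm x)\<^sup>2 \<and> (norm x)\<^sup>2 \<le> B} x *\<^sub>R (cmod (ev f x))\<^sup>2 powr (- (69 / 125)))"
      if "0 < A" for A B
      using assms that by (intro conic_line_arrangement_integrable[of d]) auto
  qed (use f \<theta> k k10 in auto)
  have add: "\<phi> (x + y) = \<phi> x + \<phi> y" for x y using \<phi> unfolding graded_iso_AR_def by blast
  \<comment> \<open>So the nonzero pair \<open>(1, 0)\<close> would be in the kernel of the injective map \<open>\<phi>\<close>.\<close>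
  have "\<phi> (0, 0) + \<phi> (0, 0) = \<phi> (0, 0)" using add[of "(0, 0)" "(0, 0)"] by simp
  then have "\<phi> (0, 0) = \<phi> (1, 0)" using \<theta>_eq_0 by (simp add: \<theta>_def)
  moreover have "inj \<phi>" using \<phi> by (simp add: graded_iso_AR_def bij_betw_def)
  ultimately have "(0, 0) = (1 :: tpoly, 0 :: tpoly)" by (rule injD[rotated])
  then show False by simp
qed

end
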